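(* There exist constants $c,\varepsilon_0>0$ such that for all $\varepsilon\in(0,\varepsilon_0)$, all $a>1$ and all $\ell>0$ the following holds in dimension $n=2$. With $$\mu_0=\mathcal{L}^1\llcorner([0,\ell]\times\{0\}),\qquad \mu_1=\mathcal{L}^1\llcorner([0,\ell]\times\{1\})$$ (one-dimensional Lebesgue measure on two parallel segments in $\mathbb{R}^2$), one has $$\min_{\mathcal F}\mathcal{E}^{\varepsilon,a,\mu_0,\mu_1}[\mathcal F]-\mathcal{E}^{*,a,\mu_0,\mu_1}\ \geq\ c\,\ell\,\min\{\varepsilon^{2/3},a-1\},$$ $$\min_{\mathcal F}\mathcal{M}^{\varepsilon,\mu_0,\mu_1}[\mathcal F]-\mathcal{M}^{*,\mu_0,\mu_1}\ \geq\ c\,\ell\,\varepsilon|\log\varepsilon| .$$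
   Context: Notation: $\mathrm{fbm}(\mathbb{R}^2)$ is the set of non-negative finite Borel measures on $\mathbb{R}^2$, $\mathrm{rca}(\mathbb{R}^2;\mathbb{R}^2)$ the set of $\mathbb{R}^2$-valued Radon (regular countably additive) measures, $\overset{*}{\rightharpoonup}$ is weak-$*$ convergence of measures, $\mathcal{H}^1$ the one-dimensional Hausdorff measure, $\llcorner$ restriction of measures. Discrete mass flux. A transport path is a weighted directed graph $G$ in $\mathbb{R}^2$ with vertices $V(G)$, straight edges $E(G)$ and weights $w:E(G)\to[0,\infty)$. An edge $e$ with initial point $e^+$, final point $e^-$ has direction $\hat e=\frac{e^--e^+}{|e^--e^+|}$ and length $l(e)$. The corresponding discrete mass flux is the vector measure $\mathcal F_G=\sum_{e\in E(G)}w(e)\,\hat e\,(\mathcal H^1\llcorner e)$. For finite discrete non-negative measures $\mu_+=\sum_{i=1}^k a_i\delta_{x_i}$, $\mu_-=\sum_{i=1}^m b_i\delta_{y_i}$ with $a_i,b_i>0$ and equal mass, $G$ is a transport path (and $\mathcal F_G$ a discrete mass flux) between $\mu_+$ and $\mu_-$ if $\operatorname{div}\mathcal F_G=\mu_+-\mu_-$ in the distributional sense. Costs of discrete fluxes. For $a>1$, $\varepsilon\ge0$: urban planning cost $E^{\varepsilon,a}(G)=\sum_{e\in E(G)}\min(a\,w(e),w(e)+\varepsilon)\,l(e)$. For $\varepsilon\in[0,1)$: branched transport cost $M^\varepsilon(G)=\sum_{e\in E(G)}w(e)^{1-\varepsilon}l(e)$. Continuous mass flux. For $\mu_+,\mu_-\in\mathrm{fbm}(\mathbb{R}^2)$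 of equal mass, $\mathcal F\in\mathrm{rca}(\mathbb{R}^2;\mathbb{R}^2)$ is a mass flux between $\mu_+$ and $\mu_-$ if there are discrete measures $\mu_\pm^k\overset{*}{\rightharpoonup}\mu_\pm$ and discrete mass fluxes $\mathcal F_{G_k}$ between $\mu_+^k$ and $\mu_-^k$ with $\mathcal F_{G_k}\overset{*}{\rightharpoonup}\mathcal F$; write $(\mu_+^k,\mu_-^k,\mathcal F_{G_k})\overset{*}{\rightharpoonup}(\mu_+,\mu_-,\mathcal F)$ for such an approximating graph sequence. For a mass flux $\mathcal F$ between $\mu_+$ and $\mu_-$, $$E^{\varepsilon,a}(\mathcal F)=\inf\{\liminf_{k\to\infty}E^{\varepsilon,a}(G_k):(\mu_+^k,\mu_-^k,\mathcal F_{G_k})\overset{*}{\rightharpoonup}(\mu_+,\mu_-,\mathcal F)\},$$ $$M^{\varepsilon}(\mathcal F)=\inf\{\liminf_{k\to\infty}M^{\varepsilon}(G_k):(\mu_+^k,\mu_-^k,\mathcal F_{G_k})\overset{*}{\rightharpoonup}(\mu_+,\mu_-,\mathcal F)\}.$$ Functionals. $\mathcal E^{\varepsilon,a,\mu_+,\mu_-}[\mathcal F]=E^{\varepsilon,a}(\mathcal F)$ and $\mathcal M^{\varepsilon,\mu_+,\mu_-}[\mathcal F]=M^\varepsilon(\mathcal F)$ if $\mathcal F$ is a mass flux between $\mu_+$ and $\mu_-$, and both equal $\infty$ otherwise. The minima are taken over all $\mathcal F\in\mathrm{rca}(\mathbb{R}^2;\mathbb{R}^2)$. Reference values ($\varepsilon=0$):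 $\mathcal E^{*,a,\mu_0,\mu_1}:=\min_{\mathcal F}\mathcal E^{0,a,\mu_0,\mu_1}[\mathcal F]$ and $\mathcal M^{*,\mu_0,\mu_1}:=\min_{\mathcal F}\mathcal M^{0,\mu_0,\mu_1}[\mathcal F]$; both equal the Wasserstein-1 distance between $\mu_0$ and $\mu_1$, which is $\ell$. *)

theory Defs
  imports "HOL-Probability.Probability" "Graph_Theory.Pair_Digraph"
begin

section \<open>Measures and weak-* convergence\<close>

definition fbm :: "'a::euclidean_space measure set" where
  "fbm = {\<mu>. sets \<mu> = sets borel \<and> finite_measure \<mu>}"

text \<open>
  A vector-valued measure is a function on sets, of which only the values on Borel sets matter.
\<close>

definition regular_set_fun :: "('a::euclidean_space set \<Rightarrow> 'b::euclidean_space) \<Rightarrow> bool" where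
  "regular_set_fun F \<longleftrightarrow>
    (\<forall>A\<in>sets borel. \<forall>e>0. \<exists>K U. compact K \<and> open U \<and> K \<subseteq> A \<and> A \<subseteq> U \<and>
      (\<forall>B\<in>sets borel. B \<subseteq> U - K \<longrightarrow> norm (F B) < e))"

definition rca :: "('a::euclidean_space set \<Rightarrow> 'b::euclidean_space) set" where
  "rca = {F. regular_set_fun F \<and>
    (\<forall>A :: nat \<Rightarrow> 'a set. range A \<subseteq> sets borel \<and> disjoint_family A \<longrightarrow>
      (\<lambda>n. F (A n)) sums F (\<Union>n. A n))}"

text \<open>
  Jordan decomposition: the positive variation of a signed measure \<open>\<nu>\<close> is
  \<open>\<nu>\<^sup>+ A = sup {\<nu> B | B \<subseteq> A}\<close>, and the negative variation of \<open>\<nu>\<close> is the positive variation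
  of \<open>- \<nu>\<close>. The truncation of negative values by \<open>ennreal\<close> is harmless because of \<open>B = {}\<close>.
\<close>

definition pos_variation :: "('a::euclidean_space set \<Rightarrow> real) \<Rightarrow> 'a measure" where
  "pos_variation \<nu> =
    measure_of UNIV (sets borel) (\<lambda>A. SUP B\<in>{B\<in>sets borel. B \<subseteq> A}. ennreal (\<nu> B))"

definition signed_integral :: "('a::euclidean_space set \<Rightarrow> real) \<Rightarrow> ('a \<Rightarrow> real) \<Rightarrow> real" where
  "signed_integral \<nu> f =
    (LINT x|pos_variation \<nu>. f x) - (LINT x|pos_variation (\<lambda>A. - \<nu> A). f x)"

text \<open>\<open>\<integral> f \<cdot> dF\<close> for a vector field \<open>f\<close>.\<close>

definition vector_integral ::
    "('a::euclidean_space set \<Rightarrow> 'b::euclidean_space) \<Rightarrow> ('a \<Rightarrow> 'b) \<Rightarrow> real" where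
  "vector_integral F f = (\<Sum>b\<in>Basis. signed_integral (\<lambda>A. F A \<bullet> b) (\<lambda>x. f x \<bullet> b))"

text \<open>The predual of the space of finite Radon measures.\<close>

definition C0 :: "('a::euclidean_space \<Rightarrow> 'b::euclidean_space) set" where
  "C0 = {f. continuous_on UNIV f \<and> (f \<longlongrightarrow> 0) at_infinity}"

definition weak_star :: "(nat \<Rightarrow> 'a::euclidean_space measure) \<Rightarrow> 'a measure \<Rightarrow> bool" where
  "weak_star \<mu>s \<mu> \<longleftrightarrow> (\<forall>f\<in>C0. (\<lambda>k. LINT x|\<mu>s k. f x) \<longlonglongrightarrow> (LINT x|\<mu>. (f x :: real)))"

definition vector_weak_star ::
    "(nat \<Rightarrow> 'a::euclidean_space set \<Rightarrow> 'b::euclidean_space) \<Rightarrow> ('a set \<Rightarrow> 'b) \<Rightarrow> bool" where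
  "vector_weak_star Fs F \<longleftrightarrow>
    (\<forall>f\<in>C0. (\<lambda>k. vector_integral (Fs k) f) \<longlonglongrightarrow> vector_integral F f)"

definition hausdorff1_pre :: "real \<Rightarrow> 'a::metric_space set \<Rightarrow> ennreal" where
  "hausdorff1_pre \<delta> A = Inf {(\<Sum>i. ennreal (diameter (C i))) | C :: nat \<Rightarrow> 'a set.
    A \<subseteq> (\<Union>i. C i) \<and> (\<forall>i. bounded (C i) \<and> diameter (C i) \<le> \<delta>)}"

definition hausdorff1 :: "'a::metric_space set \<Rightarrow> ennreal" where
  "hausdorff1 A = (SUP \<delta>\<in>{0<..}. hausdorff1_pre \<delta> A)"

section \<open>Distributional divergence\<close>

primrec Ck :: "nat \<Rightarrow> ('a::euclidean_space \<Rightarrow> real) \<Rightarrow> bool" where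
  "Ck 0 f \<longleftrightarrow> continuous_on UNIV f"
| "Ck (Suc k) f \<longleftrightarrow>
    (\<exists>D. (\<forall>x. GDERIV f x :> D x) \<and> (\<forall>b\<in>Basis. Ck k (\<lambda>x. D x \<bullet> b)))"

definition test_function :: "('a::euclidean_space \<Rightarrow> real) \<Rightarrow> bool" where
  "test_function f \<longleftrightarrow> (\<forall>k. Ck k f) \<and> compact (closure {x. f x \<noteq> 0})"

definition has_divergence ::
    "('a::euclidean_space set \<Rightarrow> 'a) \<Rightarrow> 'a measure \<Rightarrow> 'a measure \<Rightarrow> bool" where
  \<comment> \<open>\<open>div F = \<mu> - \<nu>\<close> in the sense of distributions\<close>
  "has_divergence F \<mu> \<nu> \<longleftrightarrow>
    (\<forall>f D. test_function f \<and> (\<forall>x. GDERIV f x :> D x) \<longrightarrow>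
      - vector_integral F D = (LINT x|\<mu>. f x) - (LINT x|\<nu>. f x))"

section \<open>Discrete mass fluxes and their costs\<close>

text \<open>
  A transport path is a finite directed graph \<open>G\<close> without loops together with edge weights \<open>w\<close>.
  An edge \<open>e\<close> is the pair of its initial point \<open>fst e\<close> and its final point \<open>snd e\<close>.
\<close>

definition edge_segment :: "'a::euclidean_space \<times> 'a \<Rightarrow> 'a set" where
  "edge_segment e = closed_segment (fst e) (snd e)"

definition edge_length :: "'a::euclidean_space \<times> 'a \<Rightarrow> real" where
  "edge_length e = norm (snd e - fst e)"

definition edge_direction :: "'a::euclidean_space \<times> 'a \<Rightarrow> 'a" where
  "edge_direction e = (snd e - fst e) /\<^sub>R norm (snd e - fst e)"

definition discrete_flux ::
    "'a::euclidean_space pair_pre_digraph \<Rightarrow> ('a \<times> 'a \<Rightarrow> real) \<Rightarrow> 'a set \<Rightarrow> 'a" where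
  "discrete_flux G w A =
    (\<Sum>e\<in>parcs G. (w e * enn2real (hausdorff1 (A \<inter> edge_segment e))) *\<^sub>R edge_direction e)"

definition discrete_measure :: "'a::euclidean_space measure \<Rightarrow> bool" where
  "discrete_measure \<mu> \<longleftrightarrow> sets \<mu> = sets borel \<and>
    (\<exists>(k::nat) (a :: nat \<Rightarrow> real) (x :: nat \<Rightarrow> 'a). (\<forall>i\<in>{1..k}. a i > 0) \<and>
      (\<forall>A\<in>sets borel. emeasure \<mu> A =
        (\<Sum>i\<in>{1..k}. ennreal (a i) * emeasure (return borel (x i)) A)))"

definition transport_path ::
    "'a::euclidean_space measure \<Rightarrow> 'a measure \<Rightarrow> 'a pair_pre_digraph \<Rightarrow> ('a \<times> 'a \<Rightarrow> real) \<Rightarrow> bool"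
  where
  "transport_path \<mu>p \<mu>m G w \<longleftrightarrow>
    pair_digraph G \<and> (\<forall>e\<in>parcs G. w e \<ge> 0) \<and>
    discrete_measure \<mu>p \<and> discrete_measure \<mu>m \<and> emeasure \<mu>p UNIV = emeasure \<mu>m UNIV \<and>
    has_divergence (discrete_flux G w) \<mu>p \<mu>m"

definition urban_cost ::
    "real \<Rightarrow> real \<Rightarrow> 'a::euclidean_space pair_pre_digraph \<Rightarrow> ('a \<times> 'a \<Rightarrow> real) \<Rightarrow> real" where
  "urban_cost \<epsilon> a G w = (\<Sum>e\<in>parcs G. min (a * w e) (w e + \<epsilon>) * edge_length e)"

definition branched_cost ::
    "real \<Rightarrow> 'a::euclidean_space pair_pre_digraph \<Rightarrow> ('a \<times> 'a \<Rightarrow> real) \<Rightarrow> real" where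
  "branched_cost \<epsilon> G w = (\<Sum>e\<in>parcs G. w e powr (1 - \<epsilon>) * edge_length e)"

section \<open>Continuous mass fluxes and the relaxed functionals\<close>

definition approximating_graph_sequence ::
    "'a::euclidean_space measure \<Rightarrow> 'a measure \<Rightarrow> ('a set \<Rightarrow> 'a) \<Rightarrow>
      (nat \<Rightarrow> 'a measure) \<Rightarrow> (nat \<Rightarrow> 'a measure) \<Rightarrow>
      (nat \<Rightarrow> 'a pair_pre_digraph) \<Rightarrow> (nat \<Rightarrow> 'a \<times> 'a \<Rightarrow> real) \<Rightarrow> bool" where
  "approximating_graph_sequence \<mu>p \<mu>m F \<mu>ps \<mu>ms Gs ws \<longleftrightarrow>
    (\<forall>k. transport_path (\<mu>ps k) (\<mu>ms k) (Gs k) (ws k)) \<and>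
    weak_star \<mu>ps \<mu>p \<and> weak_star \<mu>ms \<mu>m \<and>
    vector_weak_star (\<lambda>k. discrete_flux (Gs k) (ws k)) F"

definition mass_flux ::
    "'a::euclidean_space measure \<Rightarrow> 'a measure \<Rightarrow> ('a set \<Rightarrow> 'a) \<Rightarrow> bool" where
  "mass_flux \<mu>p \<mu>m F \<longleftrightarrow>
    \<mu>p \<in> fbm \<and> \<mu>m \<in> fbm \<and> emeasure \<mu>p UNIV = emeasure \<mu>m UNIV \<and> F \<in> rca \<and>
    (\<exists>\<mu>ps \<mu>ms Gs ws. approximating_graph_sequence \<mu>p \<mu>m F \<mu>ps \<mu>ms Gs ws)"

definition relaxed_cost ::
    "('a::euclidean_space pair_pre_digraph \<Rightarrow> ('a \<times> 'a \<Rightarrow> real) \<Rightarrow> real) \<Rightarrow>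
      'a measure \<Rightarrow> 'a measure \<Rightarrow> ('a set \<Rightarrow> 'a) \<Rightarrow> ereal" where
  "relaxed_cost J \<mu>p \<mu>m F =
    Inf {liminf (\<lambda>k. ereal (J (Gs k) (ws k))) | \<mu>ps \<mu>ms Gs ws.
      approximating_graph_sequence \<mu>p \<mu>m F \<mu>ps \<mu>ms Gs ws}"

definition urban_functional ::
    "real \<Rightarrow> real \<Rightarrow> 'a::euclidean_space measure \<Rightarrow> 'a measure \<Rightarrow> ('a set \<Rightarrow> 'a) \<Rightarrow> ereal" where
  "urban_functional \<epsilon> a \<mu>p \<mu>m F =
    (if mass_flux \<mu>p \<mu>m F then relaxed_cost (urban_cost \<epsilon> a) \<mu>p \<mu>m F else \<infinity>)"

definition branched_functional ::
    "real \<Rightarrow> 'a::euclidean_space measure \<Rightarrow> 'a measure \<Rightarrow> ('a set \<Rightarrow> 'a) \<Rightarrow> ereal" where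
  "branched_functional \<epsilon> \<mu>p \<mu>m F =
    (if mass_flux \<mu>p \<mu>m F then relaxed_cost (branched_cost \<epsilon>) \<mu>p \<mu>m F else \<infinity>)"

text \<open>
  The minimal values are rendered as infima in the extended reals. The differences with the
  reference values for \<open>\<epsilon> = 0\<close> are not affected by the convention \<open>\<infinity> - \<infinity> = \<infinity>\<close>, since the reference
  values are finite for the measures below.
\<close>

definition urban_min ::
    "real \<Rightarrow> real \<Rightarrow> 'a::euclidean_space measure \<Rightarrow> 'a measure \<Rightarrow> ereal" where
  "urban_min \<epsilon> a \<mu>p \<mu>m = (INF F\<in>rca. urban_functional \<epsilon> a \<mu>p \<mu>m F)"

definition branched_min ::
    "real \<Rightarrow> 'a::euclidean_space measure \<Rightarrow> 'a measure \<Rightarrow> ereal" where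
  "branched_min \<epsilon> \<mu>p \<mu>m = (INF F\<in>rca. branched_functional \<epsilon> \<mu>p \<mu>m F)"

text \<open>One-dimensional Lebesgue measure on the segment \<open>[0,l] \<times> {h}\<close>.\<close>

definition segment_measure :: "real \<Rightarrow> real \<Rightarrow> (real^2) measure" where
  "segment_measure l h = distr (restrict_space lborel {0..l}) borel (\<lambda>s. vector [s, h])"

end

theory Submission
  imports Defs "HOL-Library.Transitive_Closure_Table" "HOL-Real_Asymp.Real_Asymp"
begin

text \<open>
  At \<open>\<epsilon> = 0\<close> vertical transport costs \<open>l\<close>, and this bounds the reference values from above
  (\<open>urban_reference_le\<close>, \<open>branched_reference_le\<close>). It remains to show that for \<open>\<epsilon> > 0\<close> every flow
  costs noticeably more than \<open>l\<close>.

  Per unit length, the urban planning cost charges a weight \<open>w\<close> with \<open>w + min ((a - 1) w) \<epsilon>\<close>. The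
  branched transport cost charges at least \<open>(1 - 9 \<epsilon>) min w 9\<close> plus a surcharge of the same shape
  (\<open>powr_excess_bound\<close>). So consider the cost \<open>min w 9 + m w\<close>, where the surcharge \<open>m w\<close> is
  \<open>a w\<close> for light edges and a constant \<open>m0\<close> for heavy ones. The claim is that its lower limit
  along an approximating sequence is at least \<open>l + l h\<^sup>2 / 128\<close>, where \<open>h\<close> is the width of the cells
  introduced below and satisfies \<open>h\<^sup>3 \<le> 32 m0\<close> and \<open>h\<^sup>2 \<le> 4 a\<close>. Choosing \<open>h\<close> of the largest
  admissible order yields the two scaling laws.

  The reason is geometric. Let \<open>X\<close> be the total surcharge. At some height \<open>t\<close> strictly between the two
  segments, at most \<open>2 X / m0\<close> heavy edges cross the line \<open>y = t\<close> upwards, and the light edges that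
  cross it upwards carry mass at most \<open>2 X / a\<close> (\<open>good_level\<close>). Cut the lower segment into cells of
  width \<open>h\<close>. If \<open>X\<close> is small compared to \<open>l h\<^sup>2\<close>, most cells contain no crossing of a heavy edge
  above them, so that the mass starting there is displaced sideways by a distance of order \<open>h\<close> before
  it reaches height \<open>t\<close>. This lengthens its way by a multiple of \<open>h\<^sup>2\<close>. If \<open>X\<close> is not small, the
  surcharge itself is large enough. Both cases are covered by one inequality (\<open>discrete_excess\<close>).

  The lengthening is measured by calibration. The flow is decomposed according to the sources of its
  mass (\<open>flow_decomposition\<close>), and each source gets a potential of its own (\<open>potential\<close>), which is
  1-Lipschitz except for a small jump across the line \<open>y = t\<close>. A potential per source, rather than one
  for the whole flow, is what controls the branched transport cost, which is sublinear and therefore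
  cheap for huge weights: the potential is constant at distance at least 2 from its source, so an edge is
  charged at each of its points only by sources within distance 2, whose total mass is eventually at
  most 9 along an approximating sequence. Hence a weight \<open>w\<close> enters the estimate only through \<open>min w 9\<close>.

  To apply this to fluxes, the distributional divergence condition is turned into Kirchhoff's law at the
  finitely many vertices (\<open>transport_path_balanced\<close>), and the source and sink masses of an
  approximating sequence are controlled by finitely many test functions (\<open>excess_eventually\<close>).
\<close>

section \<open>Decomposition of a flow by its sources\<close>

abbreviation flow_gain :: "('a \<times> 'a) set \<Rightarrow> ('a \<times> 'a \<Rightarrow> real) \<Rightarrow> ('a \<Rightarrow> real) \<Rightarrow> real" where
  "flow_gain E w f \<equiv> (\<Sum>e\<in>E. w e * (f (snd e) - f (fst e)))"

text \<open>
  The indicator of the edges of the path. Distinctness of the vertices keeps its values at most 1, which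
  ensures that a commodity never puts more than its own mass on an edge.
\<close>

lemma path_unit_flow:
  fixes r :: "'a \<Rightarrow> 'a \<Rightarrow> bool"
  assumes "rtrancl_path r x xs y" "distinct (x # xs)" "finite E" "{(a, b). r a b} \<subseteq> E"
  shows "\<exists>v :: 'a \<times> 'a \<Rightarrow> real. (\<forall>e. 0 \<le> v e \<and> v e \<le> 1) \<and>
    (\<forall>e. v e \<noteq> 0 \<longrightarrow> r (fst e) (snd e) \<and> fst e \<in> set (x # xs)) \<and>
    (\<forall>f :: 'a \<Rightarrow> real. flow_gain E v f = f y - f x)"
  using assms(1,2)
proof (induction rule: rtrancl_path.induct)
  case (base x)
  show ?case by (rule exI[of _ "\<lambda>_. 0"]) simp
next
  case (step x y ys z)
  then have "distinct (y # ys)" by simp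
  from step.IH[OF this] obtain v :: "'a \<times> 'a \<Rightarrow> real" where v: "\<And>e. 0 \<le> v e" "\<And>e. v e \<le> 1"
    "\<And>e. v e \<noteq> 0 \<Longrightarrow> r (fst e) (snd e) \<and> fst e \<in> set (y # ys)"
    "\<And>f :: 'a \<Rightarrow> real. flow_gain E v f = f z - f y"
    by blast
  have xy: "(x, y) \<in> E" using step(1) assms(4) by blast
  have vxy: "v (x, y) = 0" using v(3)[of "(x, y)"] step.prems by auto
  show ?case
  proof (intro exI[of _ "\<lambda>e. v e + (if e = (x, y) then 1 else 0)"] conjI allI impI)
    fix f :: "'a \<Rightarrow> real"
    have "flow_gain E (\<lambda>e. v e + (if e = (x, y) then 1 else 0)) f
      = flow_gain E v f + (\<Sum>e\<in>E. if e = (x, y) then f y - f x else 0)"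
      unfolding sum.distrib[symmetric] by (rule sum.cong) (auto simp: algebra_simps)
    then show "flow_gain E (\<lambda>e. v e + (if e = (x, y) then 1 else 0)) f = f z - f x"
      using v(4)[of f] xy assms(3) by simp
  next
    fix e assume "v e + (if e = (x, y) then 1 else 0) \<noteq> 0"
    then show "r (fst e) (snd e)" "fst e \<in> set (x # y # ys)"
      using v(3)[of e] step(1) by (auto split: if_splits)
  qed (use v vxy in auto)
qed

lemma reachable_unit_flow:
  assumes "(x, y) \<in> R\<^sup>*" "finite E" "R \<subseteq> E"
  shows "\<exists>v :: 'a \<times> 'a \<Rightarrow> real. (\<forall>e. 0 \<le> v e \<and> v e \<le> 1) \<and> (\<forall>e. e \<notin> R \<longrightarrow> v e = 0) \<and>
    (\<forall>f :: 'a \<Rightarrow> real. flow_gain E v f = f y - f x)"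
proof -
  have "(\<lambda>a b. (a, b) \<in> R)\<^sup>*\<^sup>* x y" using assms(1) by (simp add: rtranclp_rtrancl_eq)
  then obtain xs where "rtrancl_path (\<lambda>a b. (a, b) \<in> R) x xs y"
    by (auto simp: rtranclp_eq_rtrancl_path)
  then obtain xs' where xs': "rtrancl_path (\<lambda>a b. (a, b) \<in> R) x xs' y" "distinct (x # xs')"
    by (rule rtrancl_path_distinct)
  have "{(a, b). (a, b) \<in> R} \<subseteq> E" using assms(3) by simp
  from path_unit_flow[OF xs' assms(2) this] show ?thesis
    by (rule ex_forward) (simp, blast)
qed

text \<open>
  Conservation of mass with sources \<open>\<alpha>\<close> and sinks \<open>\<beta>\<close>, in weak form with arbitrary functions of the
  vertices as test functions. This form is linear in the flow and is what calibration uses directly.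
\<close>

definition balanced :: "('a \<times> 'a) set \<Rightarrow> ('a \<times> 'a \<Rightarrow> real) \<Rightarrow> 'a set \<Rightarrow> ('a \<Rightarrow> real) \<Rightarrow> ('a \<Rightarrow> real) \<Rightarrow> bool" where
  "balanced E w V \<alpha> \<beta> \<longleftrightarrow>
    (\<forall>f :: 'a \<Rightarrow> real. flow_gain E w f = (\<Sum>v\<in>V. (\<beta> v - \<alpha> v) * f v))"

text \<open>
  Test the balance with the indicator of the set of vertices reachable from \<open>q\<close>: no mass leaves this
  set, so the mass supplied by \<open>q\<close> has to be absorbed inside it.
\<close>

lemma source_reaches_sink:
  assumes "finite E" "finite V" "balanced E w V \<alpha> \<beta>"
    and w: "\<And>e. e \<in> E \<Longrightarrow> w e \<ge> 0" and "\<And>v. v \<in> V \<Longrightarrow> \<alpha> v \<ge> 0"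
    and q: "q \<in> V" "\<alpha> q > 0"
  shows "\<exists>z\<in>V. \<beta> z > 0 \<and> (q, z) \<in> {e \<in> E. w e > 0}\<^sup>*"
proof (rule ccontr)
  assume neg: "\<not> ?thesis"
  define R where "R = {e \<in> E. w e > 0}"
  define f :: "'a \<Rightarrow> real" where "f = (\<lambda>v. if (q, v) \<in> R\<^sup>* then 1 else 0)"
  have "w e * (f (snd e) - f (fst e)) \<ge> 0" if "e \<in> E" for e
  proof (cases "w e > 0")
    case True
    then have "(fst e, snd e) \<in> R" using that by (simp add: R_def)
    then have "f (snd e) \<ge> f (fst e)" by (auto simp: f_def intro: rtrancl.rtrancl_into_rtrancl)
    then show ?thesis using True by simp
  next
    case False
    then show ?thesis using w[OF that] by simp
  qed
  then have "0 \<le> flow_gain E w f" by (rule sum_nonneg)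
  also have "\<dots> = (\<Sum>v\<in>V. (\<beta> v - \<alpha> v) * f v)" using assms(3) by (simp add: balanced_def)
  also have "\<dots> < (\<Sum>v\<in>V. 0)"
  proof (rule sum_strict_mono_ex1)
    show "\<forall>v\<in>V. (\<beta> v - \<alpha> v) * f v \<le> 0"
    proof
      fix v assume v: "v \<in> V"
      show "(\<beta> v - \<alpha> v) * f v \<le> 0"
        using neg v assms(5)[OF v] by (auto simp: f_def R_def not_less)
    qed
    have "\<beta> q \<le> 0" using neg q by auto
    then have "(\<beta> q - \<alpha> q) * f q < 0" using q by (simp add: f_def)
    then show "\<exists>v\<in>V. (\<beta> v - \<alpha> v) * f v < 0" using q by blast
  qed (use assms in auto)
  finally show False by simp
qed

definition pos_count :: "'a set \<Rightarrow> ('a \<Rightarrow> real) \<Rightarrow> nat" where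
  "pos_count A u = card {x \<in> A. u x > 0}"

lemma pos_count_mono:
  assumes "finite A" "\<And>x. x \<in> A \<Longrightarrow> u' x \<le> u x"
  shows "pos_count A u' \<le> pos_count A u"
  unfolding pos_count_def using assms by (intro card_mono) (auto intro: less_le_trans)

lemma pos_count_less:
  assumes "finite A" "\<And>x. x \<in> A \<Longrightarrow> u' x \<le> u x" "x \<in> A" "u x > 0" "u' x \<le> 0"
  shows "pos_count A u' < pos_count A u"
proof -
  have "x \<in> {x \<in> A. u x > 0} - {x \<in> A. u' x > 0}" using assms by simp
  moreover have "{x \<in> A. u' x > 0} \<subseteq> {x \<in> A. u x > 0}" using assms(2) less_le_trans by auto
  ultimately show ?thesis unfolding pos_count_def using assms(1) by (intro psubset_card_mono) auto
qed

text \<open>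
  Mass is routed along a path from a source to a sink until an edge, the source or the sink is exhausted.
  Every such step reduces the number of positive entries, so the procedure ends. Here \<open>W q\<close> is the flow
  of the mass from \<open>q\<close> and \<open>B q v\<close> is the part of it that arrives at \<open>v\<close>; cycles of the original flow
  remain, whence the inequality for the sum of the \<open>W q\<close>.
\<close>

lemma flow_decomposition:
  fixes w :: "'a \<times> 'a \<Rightarrow> real"
  assumes fin: "finite E" "finite V" and bal: "balanced E w V \<alpha> \<beta>"
    and "\<And>e. e \<in> E \<Longrightarrow> w e \<ge> 0" "\<And>v. v \<in> V \<Longrightarrow> \<alpha> v \<ge> 0" "\<And>v. v \<in> V \<Longrightarrow> \<beta> v \<ge> 0"
  shows "\<exists>W B. (\<forall>q e. W q e \<ge> 0) \<and> (\<forall>q\<in>V. \<forall>e. W q e \<le> \<alpha> q) \<and> (\<forall>q v. B q v \<ge> 0) \<and>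
    (\<forall>e\<in>E. (\<Sum>q\<in>V. W q e) \<le> w e) \<and> (\<forall>v\<in>V. (\<Sum>q\<in>V. B q v) \<le> \<beta> v) \<and>
    (\<forall>q\<in>V. \<forall>f :: 'a \<Rightarrow> real. flow_gain E (W q) f = (\<Sum>v\<in>V. B q v * f v) - \<alpha> q * f q)"
  using assms(3-)
proof (induction "pos_count E w + pos_count V \<alpha> + pos_count V \<beta>" arbitrary: w \<alpha> \<beta> rule: less_induct)
  case less
  note bal = less.prems(1) and w0 = less.prems(2) and a0 = less.prems(3) and b0 = less.prems(4)
  show ?case
  proof (cases "\<exists>q\<in>V. \<alpha> q > 0")
    case False
    then have "\<alpha> q = 0" if "q \<in> V" for q using a0[OF that] that by (meson not_less order_antisym)
    then show ?thesis using w0 b0 by (intro exI[of _ "\<lambda>_ _. 0"]) auto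
  next
    case True
    then obtain q where q: "q \<in> V" "\<alpha> q > 0" by blast
    define R where "R = {e \<in> E. w e > 0}"
    obtain z where z: "z \<in> V" "\<beta> z > 0" "(q, z) \<in> R\<^sup>*"
      using source_reaches_sink[OF fin bal w0 a0 q] unfolding R_def by blast
    obtain v where v: "\<And>e. v e \<ge> 0" and v1: "\<And>e. v e \<le> 1" and v23: "\<And>e. e \<notin> R \<Longrightarrow> v e = 0"
      "\<And>f :: 'a \<Rightarrow> real. flow_gain E v f = f z - f q"
      using reachable_unit_flow[OF z(3) fin(1)] unfolding R_def by blast
    note v = v v23
    \<comment> \<open>The largest amount that can be sent along the path; it empties some edge, the source or the sink.\<close>
    define T where "T = {\<alpha> q, \<beta> z} \<union> (\<lambda>e. w e / v e) ` {e \<in> E. v e > 0}"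
    define \<tau> where "\<tau> = Min T"
    have finT: "finite T" "T \<noteq> {}" using fin by (auto simp: T_def)
    have \<tau>T: "\<tau> \<in> T" unfolding \<tau>_def using finT by (rule Min_in)
    have \<tau>le: "\<tau> \<le> x" if "x \<in> T" for x unfolding \<tau>_def using finT(1) that by (rule Min_le)
    have Tpos: "x > 0" if "x \<in> T" for x
    proof -
      have "w e > 0" if "v e > 0" for e using v(2)[of e] that by (cases "e \<in> R") (auto simp: R_def)
      then show ?thesis using that q z by (auto simp: T_def)
    qed
    then have \<tau>pos: "\<tau> > 0" using \<tau>T by blast
    define w' where "w' = (\<lambda>e. w e - \<tau> * v e)"
    define \<alpha>' where "\<alpha>' = (\<lambda>x. \<alpha> x - (if x = q then \<tau> else 0))"
    define \<beta>' where "\<beta>' = (\<lambda>x. \<beta> x - (if x = z then \<tau> else 0))"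
    have w'0: "w' e \<ge> 0" if "e \<in> E" for e
    proof (cases "v e > 0")
      case True
      then have "\<tau> \<le> w e / v e" using that by (intro \<tau>le) (auto simp: T_def)
      then show ?thesis using True by (simp add: w'_def field_simps)
    next
      case False
      then have "v e = 0" using v(1)[of e] by simp
      then show ?thesis using w0[OF that] by (simp add: w'_def)
    qed
    have a'0: "\<alpha>' x \<ge> 0" if "x \<in> V" for x
      using a0[OF that] \<tau>le[of "\<alpha> q"] by (auto simp: \<alpha>'_def T_def)
    have b'0: "\<beta>' x \<ge> 0" if "x \<in> V" for x
      using b0[OF that] \<tau>le[of "\<beta> z"] by (auto simp: \<beta>'_def T_def)
    have bal': "balanced E w' V \<alpha>' \<beta>'"
      unfolding balanced_def
    proof
      fix f :: "'a \<Rightarrow> real"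
      have "flow_gain E w' f
        = flow_gain E w f - \<tau> * flow_gain E v f"
        unfolding sum_distrib_left sum_subtractf[symmetric]
        by (rule sum.cong) (auto simp: w'_def algebra_simps)
      also have "\<dots> = (\<Sum>x\<in>V. (\<beta> x - \<alpha> x) * f x) - \<tau> * (f z - f q)"
        using bal v(3)[of f] by (simp add: balanced_def)
      also have "\<tau> * (f z - f q) = (\<Sum>x\<in>V. (if x = z then \<tau> * f x else 0) - (if x = q then \<tau> * f x else 0))"
        unfolding sum_subtractf using fin q z by (simp add: algebra_simps)
      also have "(\<Sum>x\<in>V. (\<beta> x - \<alpha> x) * f x) - \<dots> = (\<Sum>x\<in>V. (\<beta>' x - \<alpha>' x) * f x)"
        unfolding sum_subtractf[symmetric]
        by (rule sum.cong) (auto simp: \<alpha>'_def \<beta>'_def algebra_simps)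
      finally show "flow_gain E w' f = (\<Sum>x\<in>V. (\<beta>' x - \<alpha>' x) * f x)" .
    qed
    have lew: "w' e \<le> w e" for e using v(1)[of e] \<tau>pos by (simp add: w'_def)
    have lea: "\<alpha>' x \<le> \<alpha> x" for x using \<tau>pos by (simp add: \<alpha>'_def)
    have leb: "\<beta>' x \<le> \<beta> x" for x using \<tau>pos by (simp add: \<beta>'_def)
    have mw: "pos_count E w' \<le> pos_count E w" and ma: "pos_count V \<alpha>' \<le> pos_count V \<alpha>"
      and mb: "pos_count V \<beta>' \<le> pos_count V \<beta>"
      using fin lew lea leb by (auto intro: pos_count_mono)
    have "pos_count E w' < pos_count E w \<or> pos_count V \<alpha>' < pos_count V \<alpha> \<or> pos_count V \<beta>' < pos_count V \<beta>"
    proof -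
      consider "\<tau> = \<alpha> q" | "\<tau> = \<beta> z" | e where "e \<in> E" "v e > 0" "\<tau> = w e / v e"
        using \<tau>T by (auto simp: T_def)
      then show ?thesis
      proof cases
        case 1
        then have "pos_count V \<alpha>' < pos_count V \<alpha>"
          using fin q lea by (intro pos_count_less[of _ _ _ q]) (auto simp: \<alpha>'_def)
        then show ?thesis by blast
      next
        case 2
        then have "pos_count V \<beta>' < pos_count V \<beta>"
          using fin z leb by (intro pos_count_less[of _ _ _ z]) (auto simp: \<beta>'_def)
        then show ?thesis by blast
      next
        case (3 e)
        then have "w e > 0" using \<tau>pos by (simp add: zero_less_divide_iff)
        then have "pos_count E w' < pos_count E w"
          using fin lew 3 by (intro pos_count_less[of _ _ _ e]) (auto simp: w'_def)
        then show ?thesis by blast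
      qed
    qed
    then have "pos_count E w' + pos_count V \<alpha>' + pos_count V \<beta>' < pos_count E w + pos_count V \<alpha> + pos_count V \<beta>"
      using mw ma mb by linarith
    from less.hyps[OF this bal' w'0 a'0 b'0]
    obtain W B where Wa: "\<And>q e. q \<in> V \<Longrightarrow> W q e \<le> \<alpha>' q" and WB: "\<And>q e. W q e \<ge> 0" "\<And>q v. B q v \<ge> 0"
      "\<And>e. e \<in> E \<Longrightarrow> (\<Sum>q\<in>V. W q e) \<le> w' e" "\<And>v. v \<in> V \<Longrightarrow> (\<Sum>q\<in>V. B q v) \<le> \<beta>' v"
      "\<And>q (f :: 'a \<Rightarrow> real). q \<in> V \<Longrightarrow>
         flow_gain E (W q) f = (\<Sum>v\<in>V. B q v * f v) - \<alpha>' q * f q"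
      by blast
    define W' where "W' = (\<lambda>x e. W x e + (if x = q then \<tau> * v e else 0))"
    define B' where "B' = (\<lambda>x y. B x y + (if x = q \<and> y = z then \<tau> else 0))"
    show ?thesis
    proof (intro exI[of _ W'] exI[of _ B'] conjI allI ballI)
      show "W' x e \<ge> 0" for x e using WB(1)[of x e] v(1)[of e] \<tau>pos by (simp add: W'_def)
      show "W' x e \<le> \<alpha> x" if "x \<in> V" for x e
      proof (cases "x = q")
        case True
        have "\<tau> * v e \<le> \<tau>" using v1[of e] \<tau>pos by (simp add: mult_left_le)
        then show ?thesis using Wa[OF that, of e] True by (simp add: W'_def \<alpha>'_def)
      qed (use Wa[OF that, of e] in \<open>simp add: W'_def \<alpha>'_def\<close>)
      show "B' x y \<ge> 0" for x y using WB(2)[of x y] \<tau>pos by (simp add: B'_def)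
      show "(\<Sum>x\<in>V. W' x e) \<le> w e" if "e \<in> E" for e
        using WB(3)[OF that] fin q by (simp add: W'_def w'_def sum.distrib)
      show "(\<Sum>x\<in>V. B' x y) \<le> \<beta> y" if "y \<in> V" for y
      proof (cases "y = z")
        case True
        then show ?thesis using WB(4)[OF that] fin q by (simp add: B'_def \<beta>'_def sum.distrib)
      next
        case False
        then show ?thesis using WB(4)[OF that] by (simp add: B'_def \<beta>'_def)
      qed
      fix x and f :: "'a \<Rightarrow> real" assume x: "x \<in> V"
      show "flow_gain E (W' x) f = (\<Sum>y\<in>V. B' x y * f y) - \<alpha> x * f x"
      proof (cases "x = q")
        case False
        then show ?thesis using WB(5)[OF x, of f] by (simp add: W'_def B'_def \<alpha>'_def)
      next
        case True
        have "flow_gain E (W' x) f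
          = flow_gain E (W x) f + \<tau> * flow_gain E v f"
          unfolding sum_distrib_left sum.distrib[symmetric]
          by (rule sum.cong) (auto simp: W'_def True algebra_simps)
        also have "\<dots> = (\<Sum>y\<in>V. B x y * f y) - \<alpha>' x * f x + \<tau> * (f z - f q)"
          using WB(5)[OF x, of f] v(3)[of f] by simp
        also have "\<dots> = (\<Sum>y\<in>V. B x y * f y) + (\<Sum>y\<in>V. if y = z then \<tau> * f y else 0) - \<alpha> x * f x"
          using fin z by (simp add: True \<alpha>'_def algebra_simps)
        also have "(\<Sum>y\<in>V. B x y * f y) + (\<Sum>y\<in>V. if y = z then \<tau> * f y else 0) = (\<Sum>y\<in>V. B' x y * f y)"
          unfolding sum.distrib[symmetric]
          by (rule sum.cong) (auto simp: B'_def True algebra_simps)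
        finally show ?thesis .
      qed
    qed
  qed
qed

section \<open>The potential attached to a source\<close>

text \<open>
  Below height \<open>t\<close> this is the distance to the source \<open>q\<close>, normalised such that its value at \<open>q\<close> is the
  height of \<open>q\<close> minus a reward \<open>g\<close>. Above height \<open>t\<close> it is at least the height. The two formulas agree
  at points of height \<open>t\<close> that can be reached from \<open>q\<close> only by a way that is longer than the vertical one
  by at least \<open>g\<close>; elsewhere the potential jumps by at most \<open>g\<close>. Truncation at 1 makes it constant far
  away from \<open>q\<close> and on sinks at height 1.
\<close>

definition potential :: "real \<Rightarrow> real \<Rightarrow> real^2 \<Rightarrow> real^2 \<Rightarrow> real" where
  "potential t g q p =
    min 1 (if p $ 2 \<le> t then dist p q + q $ 2 - g else max (p $ 2) (dist p q + q $ 2 - g))"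

text \<open>
  The point at height \<open>t\<close> on the line through \<open>p0\<close> and \<open>p1\<close>.
\<close>

definition crossing :: "real \<Rightarrow> real^2 \<Rightarrow> real^2 \<Rightarrow> real^2" where
  "crossing t p0 p1 = p0 + ((t - p0 $ 2) / (p1 $ 2 - p0 $ 2)) *\<^sub>R (p1 - p0)"

definition upward :: "real \<Rightarrow> (real^2) \<times> (real^2) \<Rightarrow> bool" where
  "upward t e \<longleftrightarrow> fst e $ 2 \<le> t \<and> t < snd e $ 2"

lemma component_le_dist: "\<bar>p $ i - q $ i\<bar> \<le> dist p q" for p q :: "real^2"
  using component_le_norm_cart[of "p - q" i] by (simp add: dist_norm)

lemma dist_scale_from: "dist p0 (p0 + b *\<^sub>R (p1 - p0)) = \<bar>b\<bar> * dist p0 p1" for p0 p1 :: "'a::real_normed_vector"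
  by (simp add: dist_norm norm_minus_commute)

lemma crossing:
  assumes "p0 $ 2 \<le> t" "t < p1 $ 2"
  shows "crossing t p0 p1 $ 2 = t"
    and "dist p0 (crossing t p0 p1) + dist (crossing t p0 p1) p1 = dist p0 p1"
proof -
  define s where "s = (t - p0 $ 2) / (p1 $ 2 - p0 $ 2)"
  have s: "0 \<le> s" "s \<le> 1" "s * (p1 $ 2 - p0 $ 2) = t - p0 $ 2"
    using assms by (auto simp: s_def divide_simps)
  have c: "crossing t p0 p1 = p0 + s *\<^sub>R (p1 - p0)" by (simp add: crossing_def s_def)
  show "crossing t p0 p1 $ 2 = t" using s by (simp add: c)
  have "crossing t p0 p1 - p1 = (1 - s) *\<^sub>R (p0 - p1)" by (simp add: c algebra_simps)
  then have "dist (crossing t p0 p1) p1 = (1 - s) * dist p0 p1" using s by (simp add: dist_norm)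
  moreover have "dist p0 (crossing t p0 p1) = s * dist p0 p1"
    using s dist_scale_from[of p0 s p1] by (simp add: c)
  ultimately show "dist p0 (crossing t p0 p1) + dist (crossing t p0 p1) p1 = dist p0 p1"
    by (simp add: algebra_simps)
qed

text \<open>
  Only an upward crossing of height \<open>t\<close> meets the jump in the unfavourable direction; the segment is split
  there, and both branches of the potential are 1-Lipschitz.
\<close>

lemma potential_diff_le:
  assumes "J \<ge> 0"
    and "p0 $ 2 \<le> t \<Longrightarrow> t < p1 $ 2 \<Longrightarrow> dist (crossing t p0 p1) q + q $ 2 - g \<ge> t - J"
  shows "potential t g q p1 - potential t g q p0 \<le> dist p0 p1 + J"
proof -
  have h: "\<bar>p0 $ 2 - p1 $ 2\<bar> \<le> dist p0 p1" by (rule component_le_dist)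
  have d: "dist p1 q \<le> dist p0 q + dist p0 p1" using dist_triangle3[of p1 q p0] by (simp add: dist_commute)
  show ?thesis
  proof (cases "p0 $ 2 \<le> t \<and> t < p1 $ 2")
    case True
    define c where "c = crossing t p0 p1"
    have c: "c $ 2 = t" "dist p0 c + dist c p1 = dist p0 p1" using crossing True by (auto simp: c_def)
    have "dist c q + q $ 2 - g \<ge> t - J" using assms(2) True by (simp add: c_def)
    moreover have "dist c q \<le> dist p0 q + dist p0 c" using dist_triangle3[of c q p0] by (simp add: dist_commute)
    moreover have "dist p1 q \<le> dist c q + dist c p1" using dist_triangle3[of p1 q c] by (simp add: dist_commute)
    moreover have "p1 $ 2 \<le> t + dist c p1" using component_le_dist[of c 2 p1] c by simp
    ultimately show ?thesis using True c assms(1) zero_le_dist[of p0 c] zero_le_dist[of c p1]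
      unfolding potential_def by (smt (verit))
  next
    case False
    then show ?thesis using h d assms(1) unfolding potential_def by (smt (verit))
  qed
qed

lemma potential_le_1: "potential t g q p \<le> 1"
  by (simp add: potential_def)

lemma potential_far:
  assumes "dist p q \<ge> 2" "g - q $ 2 \<le> 1"
  shows "potential t g q p = 1"
  using assms by (auto simp: potential_def)

text \<open>
  The potential has its maximal value 1 outside the disc of radius 2 around \<open>q\<close>. Since the disc is convex,
  an edge that starts inside and ends outside can be cut at its exit point, so that only the part within
  the disc contributes to the increase.
\<close>

lemma potential_edge:
  fixes p0 p1 q :: "real^2"
  assumes "J \<ge> 0" "g - q $ 2 \<le> 1"
    and J: "p0 $ 2 \<le> t \<Longrightarrow> t < p1 $ 2 \<Longrightarrow> dist (crossing t p0 p1) q + q $ 2 - g \<ge> t - J"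
  defines "T \<equiv> {s \<in> {0..1::real}. dist (p0 + s *\<^sub>R (p1 - p0)) q \<le> 2}"
  shows "potential t g q p1 - potential t g q p0 \<le> dist p0 p1 * measure lborel T + J"
proof -
  define p where "p = (\<lambda>s. p0 + s *\<^sub>R (p1 - p0))"
  have p_conv: "p s = (1 - s) *\<^sub>R p0 + s *\<^sub>R p1" for s by (simp add: p_def algebra_simps)
  have T: "T = {0..1} \<inter> (\<lambda>s. dist (p s) q) -` {..2}" by (auto simp: T_def p_def)
  have "closed T" unfolding T p_def
    by (intro continuous_closed_preimage continuous_intros)
  then have Tm: "T \<in> sets lborel" by simp
  have mT: "measure lborel {0..b} \<le> measure lborel T" if "{0..b} \<subseteq> T" for b
  proof -
    have "emeasure lborel T \<le> emeasure lborel {0..1::real}"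
      by (rule emeasure_mono) (auto simp: T)
    then have "T \<in> fmeasurable lborel" using Tm by (intro fmeasurableI) (auto intro: le_less_trans)
    then show ?thesis using that by (intro measure_mono_fmeasurable) auto
  qed
  consider "dist p0 q \<ge> 2" | "dist p0 q \<le> 2" "dist p1 q \<le> 2" | "dist p0 q \<le> 2" "dist p1 q \<ge> 2" by linarith
  then show ?thesis
  proof cases
    case 1
    then show ?thesis using potential_far[OF 1 assms(2)] potential_le_1[of t g q p1] assms(1)
      by (smt (verit) mult_nonneg_nonneg zero_le_dist measure_nonneg)
  next
    case 2
    have "p s \<in> cball q 2" if "s \<in> {0..1}" for s
      unfolding p_conv using 2 that by (intro convexD[OF convex_cball]) (auto simp: dist_commute)
    then have "{0..1} \<subseteq> T" by (auto simp: T dist_commute)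
    from mT[OF this] have "1 \<le> measure lborel T" by simp
    then have "dist p0 p1 \<le> dist p0 p1 * measure lborel T" using zero_le_dist[of p0 p1]
      by (simp add: mult_le_cancel_left1)
    then show ?thesis using potential_diff_le[OF assms(1) J] by linarith
  next
    case 3
    have "\<exists>b\<ge>0. b \<le> 1 \<and> dist (p b) q = 2"
      by (rule IVT') (use 3 in \<open>auto simp: p_def intro!: continuous_intros\<close>)
    then obtain b where b: "0 \<le> b" "b \<le> 1" "dist (p b) q = 2" by blast
    have "p s \<in> cball q 2" if "s \<in> {0..b}" for s
    proof (cases "b = 0")
      case False
      have "p s = (1 - s / b) *\<^sub>R p0 + (s / b) *\<^sub>R p b" using False by (simp add: p_def algebra_simps)
      moreover have "(1 - s / b) *\<^sub>R p0 + (s / b) *\<^sub>R p b \<in> cball q 2"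
        using 3 that b False by (intro convexD[OF convex_cball]) (auto simp: dist_commute field_simps)
      ultimately show ?thesis by simp
    qed (use that 3 in \<open>auto simp: p_def dist_commute\<close>)
    then have "{0..b} \<subseteq> T" using b by (auto simp: T dist_commute)
    from mT[OF this] have mb: "b \<le> measure lborel T" using b by simp
    have "potential t g q (p b) - potential t g q p0 \<le> dist p0 (p b) + J"
    proof (rule potential_diff_le[OF assms(1)])
      assume up: "p0 $ 2 \<le> t" "t < p b $ 2"
      have h: "p b $ 2 - p0 $ 2 = b * (p1 $ 2 - p0 $ 2)" by (simp add: p_def)
      have "b > 0" "p1 $ 2 - p0 $ 2 > 0"
        using up h b zero_less_mult_iff[of b "p1 $ 2 - p0 $ 2"] by linarith+
      then have "t < p1 $ 2" using up h b mult_left_le_one_le[of "p1 $ 2 - p0 $ 2" b] by linarith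
      moreover have "crossing t p0 (p b) = crossing t p0 p1"
        using \<open>b > 0\<close> unfolding crossing_def h by (simp add: p_def)
      ultimately show "dist (crossing t p0 (p b)) q + q $ 2 - g \<ge> t - J" using J up by simp
    qed
    also have "dist p0 (p b) = b * dist p0 p1" using b dist_scale_from[of p0 b p1] by (simp add: p_def)
    also have "\<dots> \<le> dist p0 p1 * measure lborel T" using mult_left_mono[OF mb zero_le_dist[of p0 p1]] by (simp only: mult.commute)
    finally show ?thesis using potential_far[of "p b" q g t] b assms(2) potential_le_1[of t g q p1] by simp
  qed
qed

text \<open>
  The left-hand side is the integral over \<open>s\<close> of the sum of those \<open>c q\<close> with \<open>s \<in> T q\<close>.
\<close>

lemma sum_measure_le_overlap:
  fixes T :: "'b \<Rightarrow> real set"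
  assumes "finite A" "\<And>q. q \<in> A \<Longrightarrow> T q \<in> sets lborel" "\<And>q. q \<in> A \<Longrightarrow> T q \<subseteq> {0..1}"
    and K: "\<And>s. s \<in> {0..1} \<Longrightarrow> (\<Sum>q\<in>{q\<in>A. s \<in> T q}. c q) \<le> K"
  shows "(\<Sum>q\<in>A. c q * measure lborel (T q)) \<le> K"
proof -
  have Tint: "integrable lborel (indicat_real (T q))" if "q \<in> A" for q
  proof -
    have "emeasure lborel (T q) \<le> emeasure lborel {0..1::real}"
      by (rule emeasure_mono) (use assms that in auto)
    also have "\<dots> < \<infinity>" by simp
    finally show ?thesis using assms(2)[OF that] by (simp add: integrable_indicator_iff)
  qed
  have "(\<Sum>q\<in>A. c q * measure lborel (T q)) = (\<Sum>q\<in>A. LINT s|lborel. c q * indicat_real (T q) s)"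
    using assms by (intro sum.cong) (auto simp: sets.Int_space_eq2)
  also have "\<dots> = (LINT s|lborel. (\<Sum>q\<in>A. c q * indicat_real (T q) s))"
    using Tint by (subst Bochner_Integration.integral_sum) auto
  also have "\<dots> \<le> (LINT s|lborel. K * indicat_real {0..1::real} s)"
  proof (rule integral_mono)
    show "integrable lborel (\<lambda>s. \<Sum>q\<in>A. c q * indicat_real (T q) s)" using Tint by auto
    show "integrable lborel (\<lambda>s. K * indicat_real {0..1::real} s)" by (auto simp: integrable_indicator_iff)
    fix s :: real
    show "(\<Sum>q\<in>A. c q * indicat_real (T q) s) \<le> K * indicat_real {0..1} s"
    proof (cases "s \<in> {0..1}")
      case True
      have "(\<Sum>q\<in>A. c q * indicat_real (T q) s) = (\<Sum>q\<in>{q\<in>A. s \<in> T q}. c q)"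
        using assms(1) by (intro sum.mono_neutral_cong_right) (auto simp: indicator_def)
      then show ?thesis using K[OF True] True by simp
    next
      case False
      then have "(\<Sum>q\<in>A. c q * indicat_real (T q) s) = 0" using assms(3) by (intro sum.neutral) (force simp: indicator_def)
      then show ?thesis using False by simp
    qed
  qed
  also have "\<dots> = K" by simp
  finally show ?thesis .
qed

text \<open>
  Calibration: for each source in \<open>A\<close> the increase of its potential from source to sinks is compared with
  the increase along the edges. An edge contributes at most the time that it spends near the source, plus
  \<open>gm\<close> if it is an upward crossing outside the set \<open>H\<close> of edges without jump. At a fixed point of an edge
  only sources within distance 2 are active; this produces the truncation of the weight at \<open>W0\<close>.
  The function \<open>\<psi>\<close> is a common bound for the amount by which the potentials fail to reach 1.
\<close>

lemma flow_cost_ge: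
  fixes E :: "((real^2) \<times> (real^2)) set" and V A :: "(real^2) set"
  assumes fin: "finite E" "finite V" and bal: "balanced E w V \<alpha> \<beta>"
    and w0: "\<And>e. e \<in> E \<Longrightarrow> w e \<ge> 0" and a0: "\<And>v. v \<in> V \<Longrightarrow> \<alpha> v \<ge> 0" and b0: "\<And>v. v \<in> V \<Longrightarrow> \<beta> v \<ge> 0"
    and A: "A \<subseteq> V" "\<And>q. q \<in> A \<Longrightarrow> \<bar>q $ 2\<bar> \<le> 1/8" and t: "1/8 \<le> t"
    and g: "\<And>q. q \<in> A \<Longrightarrow> 0 \<le> g q" "\<And>q. q \<in> A \<Longrightarrow> g q \<le> gm" "0 \<le> gm" "gm \<le> 1/8"
    and loc: "\<And>p. (\<Sum>q\<in>{q\<in>A. dist p q \<le> 2}. \<alpha> q) \<le> W0"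
    and H: "\<And>e q. e \<in> E \<Longrightarrow> e \<in> H \<Longrightarrow> upward t e \<Longrightarrow> q \<in> A \<Longrightarrow>
        dist (crossing t (fst e) (snd e)) q + q $ 2 \<ge> t + g q"
    and psi: "\<And>v. v \<in> V \<Longrightarrow> \<psi> v \<ge> 0" "\<And>v q. v \<in> V \<Longrightarrow> q \<in> A \<Longrightarrow> 1 - potential t (g q) q v \<le> \<psi> v"
  shows "(\<Sum>q\<in>A. \<alpha> q * (1 - q $ 2 + g q)) - (\<Sum>v\<in>V. \<beta> v * \<psi> v)
    \<le> (\<Sum>e\<in>E. edge_length e * min (w e) W0) + gm * (\<Sum>e\<in>{e\<in>E - H. upward t e}. w e)"
proof -
  obtain W B where W0: "\<And>q e. W q e \<ge> 0" and Wa: "\<And>q e. q \<in> V \<Longrightarrow> W q e \<le> \<alpha> q" and B0: "\<And>q v. B q v \<ge> 0"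
    and Ww: "\<And>e. e \<in> E \<Longrightarrow> (\<Sum>q\<in>V. W q e) \<le> w e" and Bb: "\<And>v. v \<in> V \<Longrightarrow> (\<Sum>q\<in>V. B q v) \<le> \<beta> v"
    and WB: "\<And>q (f :: real^2 \<Rightarrow> real). q \<in> V \<Longrightarrow>
         flow_gain E (W q) f = (\<Sum>v\<in>V. B q v * f v) - \<alpha> q * f q"
    using flow_decomposition[OF fin bal w0 a0 b0] by blast
  have finA: "finite A" using A fin finite_subset by blast
  define F where "F q = potential t (g q) q" for q
  define T where "T e q = {s \<in> {0..1::real}. dist (fst e + s *\<^sub>R (snd e - fst e)) q \<le> 2}" for e and q :: "real^2"
  define J where "J e = (if e \<notin> H \<and> upward t e then gm else 0)" for e
  have Wsub: "(\<Sum>q\<in>A. W q e) \<le> w e" if "e \<in> E" for e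
    using sum_mono2[OF fin(2) A(1), of "\<lambda>q. W q e"] W0 Ww[OF that] by auto
  have edge: "F q (snd e) - F q (fst e) \<le> edge_length e * measure lborel (T e q) + J e"
    if q: "q \<in> A" and e: "e \<in> E" for q e
  proof -
    have "potential t (g q) q (snd e) - potential t (g q) q (fst e)
        \<le> dist (fst e) (snd e) * measure lborel (T e q) + J e"
      unfolding T_def
    proof (rule potential_edge)
      show "J e \<ge> 0" using g by (simp add: J_def)
      show "g q - q $ 2 \<le> 1" using A(2)[OF q] g(2)[OF q] g(4) by linarith
      assume up: "fst e $ 2 \<le> t" "t < snd e $ 2"
      define c where "c = crossing t (fst e) (snd e)"
      have "t - q $ 2 \<le> dist c q" using component_le_dist[of c 2 q] crossing(1)[OF up] by (simp add: c_def)
      moreover have "upward t e" using up by (simp add: upward_def)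
      ultimately show "t - J e \<le> dist (crossing t (fst e) (snd e)) q + q $ 2 - g q"
        using H[OF e _ _ q] g(2)[OF q] by (auto simp: J_def c_def)
    qed
    then show ?thesis by (simp add: F_def edge_length_def dist_norm norm_minus_commute)
  qed
  \<comment> \<open>The potential rises from \<open>q $ 2 - g q\<close> at the source to at least \<open>1 - \<psi> v\<close> at the sink \<open>v\<close>.\<close>
  have lower: "\<alpha> q * (1 - q $ 2 + g q) - (\<Sum>v\<in>V. B q v * \<psi> v) \<le> flow_gain E (W q) (F q)"
    if q: "q \<in> A" for q
  proof -
    have qV: "q \<in> V" using q A by blast
    have "F q q = q $ 2 - g q"
      using A(2)[OF q] t g(1)[OF q] by (auto simp: F_def potential_def)
    moreover have "(\<Sum>v\<in>V. B q v * F q v) \<ge> (\<Sum>v\<in>V. B q v * 1 - B q v * \<psi> v)"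
    proof (rule sum_mono)
      fix v assume v: "v \<in> V"
      have "1 - \<psi> v \<le> F q v" using psi(2)[OF v q] by (simp add: F_def)
      then show "B q v * 1 - B q v * \<psi> v \<le> B q v * F q v"
        using mult_left_mono[OF _ B0[of q v]] by (fastforce simp: algebra_simps)
    qed
    moreover have "(\<Sum>v\<in>V. B q v) = \<alpha> q" using WB[OF qV, of "\<lambda>_. 1"] by simp
    moreover have "\<alpha> q * (1 - q $ 2 + g q) = \<alpha> q - \<alpha> q * (q $ 2 - g q)" by (simp add: algebra_simps)
    ultimately show ?thesis
      unfolding WB[OF qV, of "F q"] by (simp add: sum_subtractf)
  qed
  have "(\<Sum>q\<in>A. \<Sum>v\<in>V. B q v * \<psi> v) = (\<Sum>v\<in>V. (\<Sum>q\<in>A. B q v) * \<psi> v)"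
    by (subst sum.swap) (simp add: sum_distrib_right)
  also have "\<dots> \<le> (\<Sum>v\<in>V. \<beta> v * \<psi> v)"
  proof (rule sum_mono)
    fix v assume v: "v \<in> V"
    have "(\<Sum>q\<in>A. B q v) \<le> \<beta> v" using sum_mono2[OF fin(2) A(1), of "\<lambda>q. B q v"] B0 Bb[OF v] by auto
    then show "(\<Sum>q\<in>A. B q v) * \<psi> v \<le> \<beta> v * \<psi> v" using psi(1)[OF v] by (rule mult_right_mono)
  qed
  finally have "(\<Sum>q\<in>A. \<alpha> q * (1 - q $ 2 + g q)) - (\<Sum>v\<in>V. \<beta> v * \<psi> v)
      \<le> (\<Sum>q\<in>A. \<alpha> q * (1 - q $ 2 + g q) - (\<Sum>v\<in>V. B q v * \<psi> v))"
    by (simp add: sum_subtractf)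
  also have "\<dots> \<le> (\<Sum>q\<in>A. \<Sum>e\<in>E. W q e * (F q (snd e) - F q (fst e)))"
    using lower by (rule sum_mono)
  also have "\<dots> \<le> (\<Sum>q\<in>A. \<Sum>e\<in>E. W q e * (edge_length e * measure lborel (T e q) + J e))"
    using edge W0 by (intro sum_mono mult_left_mono) auto
  also have "\<dots> = (\<Sum>e\<in>E. edge_length e * (\<Sum>q\<in>A. W q e * measure lborel (T e q)) + J e * (\<Sum>q\<in>A. W q e))"
    by (subst sum.swap) (simp add: sum_distrib_left sum.distrib algebra_simps)
  also have "\<dots> \<le> (\<Sum>e\<in>E. edge_length e * min (w e) W0 + J e * w e)"
  proof (intro sum_mono add_mono mult_left_mono)
    fix e assume e: "e \<in> E"
    show "(\<Sum>q\<in>A. W q e) \<le> w e" by (rule Wsub[OF e])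
    show "0 \<le> J e" using g by (simp add: J_def)
    show "0 \<le> edge_length e" by (simp add: edge_length_def)
    show "(\<Sum>q\<in>A. W q e * measure lborel (T e q)) \<le> min (w e) W0"
    proof (rule sum_measure_le_overlap[OF finA])
      fix q assume "q \<in> A"
      have "T e q = {0..1} \<inter> (\<lambda>s. dist (fst e + s *\<^sub>R (snd e - fst e)) q) -` {..2}" by (auto simp: T_def)
      moreover have "closed \<dots>" by (intro continuous_closed_preimage continuous_intros)
      ultimately show "T e q \<in> sets lborel" by simp
      show "T e q \<subseteq> {0..1}" by (auto simp: T_def)
    next
      fix s :: real assume s: "s \<in> {0..1}"
      define p where "p = fst e + s *\<^sub>R (snd e - fst e)"
      have eq: "{q \<in> A. s \<in> T e q} = {q \<in> A. dist p q \<le> 2}" using s by (auto simp: T_def p_def)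
      have "(\<Sum>q\<in>{q \<in> A. s \<in> T e q}. W q e) \<le> (\<Sum>q\<in>A. W q e)"
        using finA W0 by (intro sum_mono2) auto
      moreover have "(\<Sum>q\<in>{q \<in> A. s \<in> T e q}. W q e) \<le> (\<Sum>q\<in>{q \<in> A. dist p q \<le> 2}. \<alpha> q)"
        unfolding eq using A(1) by (intro sum_mono Wa) auto
      ultimately show "(\<Sum>q\<in>{q \<in> A. s \<in> T e q}. W q e) \<le> min (w e) W0"
        using Wsub[OF e] loc[of p] by linarith
    qed
  qed
  also have "\<dots> = (\<Sum>e\<in>E. edge_length e * min (w e) W0) + gm * (\<Sum>e\<in>{e\<in>E - H. upward t e}. w e)"
  proof -
    have "(\<Sum>e\<in>E. J e * w e) = (\<Sum>e\<in>{e\<in>E - H. upward t e}. gm * w e)"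
      using fin by (intro sum.mono_neutral_cong_right) (auto simp: J_def)
    then show ?thesis by (simp add: sum.distrib sum_distrib_left)
  qed
  finally show ?thesis .
qed

section \<open>Excess cost of a finite flow\<close>

text \<open>
  The integral over \<open>t\<close> of the sum over the upward crossings is at most the sum of the \<open>m e\<close> times the
  lengths, and the interval has length \<open>5/8 > 1/2\<close>.
\<close>

lemma good_level:
  fixes m :: "(real^2) \<times> (real^2) \<Rightarrow> real"
  assumes "finite E" and m: "\<And>e. e \<in> E \<Longrightarrow> m e \<ge> 0"
  shows "\<exists>t\<in>{1/8..3/4}. (\<Sum>e\<in>{e\<in>E. upward t e}. m e) \<le> 2 * (\<Sum>e\<in>E. edge_length e * m e)"
proof (rule ccontr)
  assume neg: "\<not> ?thesis"
  define X where "X = (\<Sum>e\<in>E. edge_length e * m e)"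
  define I where "I e = {fst e $ 2..<snd e $ 2}" for e :: "(real^2) \<times> (real^2)"
  have Iint: "integrable lborel (indicat_real (I e))" for e
    by (cases "fst e $ 2 \<le> snd e $ 2") (auto simp: I_def integrable_indicator_iff)
  have Imeas: "m e * (LINT t|lborel. indicat_real (I e) t) \<le> edge_length e * m e" if "e \<in> E" for e
  proof -
    have "(LINT t|lborel. indicat_real (I e) t) \<le> edge_length e"
      using component_le_dist[of "fst e" 2 "snd e"]
      by (cases "fst e $ 2 \<le> snd e $ 2") (auto simp: I_def edge_length_def dist_norm norm_minus_commute)
    from mult_left_mono[OF this m[OF that]] show ?thesis by (simp add: mult.commute)
  qed
  have sum_eq: "(\<Sum>e\<in>{e\<in>E. upward t e}. m e) = (\<Sum>e\<in>E. m e * indicat_real (I e) t)" for t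
    using assms(1) by (intro sum.mono_neutral_cong_left) (auto simp: I_def upward_def)
  have "5/8 * (2 * X) = (LINT t|lborel. 2 * X * indicat_real {1/8..3/4::real} t)" by simp
  also have "\<dots> \<le> (LINT t|lborel. (\<Sum>e\<in>E. m e * indicat_real (I e) t))"
  proof (rule integral_mono)
    show "integrable lborel (\<lambda>t. 2 * X * indicat_real {1/8..3/4::real} t)"
      by (auto simp: integrable_indicator_iff)
    show "integrable lborel (\<lambda>t. \<Sum>e\<in>E. m e * indicat_real (I e) t)" using Iint by auto
    fix t :: real
    show "2 * X * indicat_real {1/8..3/4} t \<le> (\<Sum>e\<in>E. m e * indicat_real (I e) t)"
    proof (cases "t \<in> {1/8..3/4}")
      case True
      then have "2 * X < (\<Sum>e\<in>{e\<in>E. upward t e}. m e)" using neg by (auto simp: X_def not_le)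
      then show ?thesis using True sum_eq by simp
    qed (use m in \<open>auto intro!: sum_nonneg mult_nonneg_nonneg\<close>)
  qed
  also have "\<dots> = (\<Sum>e\<in>E. m e * (LINT t|lborel. indicat_real (I e) t))"
    using Iint by (subst Bochner_Integration.integral_sum) auto
  also have "\<dots> \<le> X" unfolding X_def using Imeas by (rule sum_mono)
  finally have "X \<le> 0" by simp
  \<comment> \<open>With \<open>X = 0\<close> the integral estimate is not strict, but then no edge with positive \<open>m e\<close> has positive
    length, and an edge that crosses a level has.\<close>
  have nonneg: "edge_length e * m e \<ge> 0" if "e \<in> E" for e using m[OF that] by (simp add: edge_length_def)
  have "X \<ge> 0" unfolding X_def using nonneg by (rule sum_nonneg)
  with \<open>X \<le> 0\<close> have "X = 0" by simp
  then have zero: "edge_length e * m e = 0" if "e \<in> E" for e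
    using sum_nonneg_eq_0_iff[OF assms(1), of "\<lambda>e. edge_length e * m e"] nonneg that by (simp add: X_def)
  have "(\<Sum>e\<in>{e\<in>E. upward (1/8) e}. m e) = 0"
  proof (rule sum.neutral, clarify)
    fix p0 p1 :: "real^2" assume e: "(p0, p1) \<in> E" "upward (1/8) (p0, p1)"
    then have "p0 \<noteq> p1" by (auto simp: upward_def)
    then show "m (p0, p1) = 0" using zero[OF e(1)] by (simp add: edge_length_def)
  qed
  moreover have "(1/8::real) \<in> {1/8..3/4}" by simp
  ultimately have "\<exists>t\<in>{1/8..3/4}. (\<Sum>e\<in>{e\<in>E. upward t e}. m e) \<le> 2 * X"
    using \<open>X = 0\<close> by (intro bexI[of _ "1/8"]) simp_all
  then show False using neg by (simp add: X_def)
qed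

definition cell_center :: "real \<Rightarrow> nat \<Rightarrow> nat \<Rightarrow> real" where
  "cell_center l M j = (real j + 1/2) * (l / real M)"

text \<open>
  The reward for starting at \<open>x\<close>: a quarter of the squared distance from \<open>x\<close> to the complement of the
  \<open>j\<close>-th cell. A sideways displacement \<open>r\<close> on a way of height at most 1 lengthens it by at least \<open>r\<^sup>2 / 4\<close>
  (for \<open>r\<close> bounded). The number of cells is \<open>M\<close>; their centres have distance \<open>l / M\<close> and their width is
  \<open>h\<close>, which is larger than \<open>l\<close> if \<open>l\<close> is small and \<open>M = 1\<close>.
\<close>

definition tent :: "real \<Rightarrow> real \<Rightarrow> nat \<Rightarrow> nat \<Rightarrow> real \<Rightarrow> real" where
  "tent l h M j x = (max 0 (h / 2 - \<bar>x - cell_center l M j\<bar>))\<^sup>2 / 4"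

lemma cell_center_separated:
  assumes "j \<noteq> j'" "j < M" "j' < M" "0 < l" "M = 1 \<or> h = l / real M"
  shows "\<bar>cell_center l M j - cell_center l M j'\<bar> \<ge> h"
proof -
  have h: "h = l / real M" and "h > 0" using assms by auto
  have "\<bar>real j - real j'\<bar> \<ge> 1" using assms(1) by linarith
  moreover have "cell_center l M j - cell_center l M j' = (real j - real j') * h"
    by (simp add: cell_center_def h algebra_simps)
  ultimately show ?thesis using \<open>h > 0\<close> by (simp add: abs_mult)
qed

text \<open>
  The cells are disjoint, so at most one summand is nonzero.
\<close>

lemma sum_tents_cases:
  assumes "S \<subseteq> {..<M}" "0 < l" "M = 1 \<or> h = l / real M"
  obtains "(\<Sum>j\<in>S. tent l h M j x) = 0"
  | j where "j \<in> S" "\<bar>x - cell_center l M j\<bar> < h / 2" "(\<Sum>j\<in>S. tent l h M j x) = tent l h M j x"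
proof (cases "\<exists>j\<in>S. \<bar>x - cell_center l M j\<bar> < h / 2")
  case False
  then have "(\<Sum>j\<in>S. tent l h M j x) = 0" by (intro sum.neutral) (auto simp: tent_def)
  then show ?thesis using that by blast
next
  case True
  then obtain j where j: "j \<in> S" "\<bar>x - cell_center l M j\<bar> < h / 2" by blast
  have "tent l h M i x = 0" if "i \<in> S - {j}" for i
  proof -
    have "\<bar>cell_center l M i - cell_center l M j\<bar> \<ge> h"
      using that j assms by (intro cell_center_separated) auto
    then have "h / 2 - \<bar>x - cell_center l M i\<bar> \<le> 0" using j by linarith
    then show ?thesis by (simp add: tent_def)
  qed
  moreover have "finite S" using assms(1) finite_subset by blast
  ultimately have "(\<Sum>j\<in>S. tent l h M j x) = tent l h M j x"
    using j by (simp add: sum.remove[of S j])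
  then show ?thesis using that j by blast
qed

lemma sum_tents_bounds:
  assumes "S \<subseteq> {..<M}" "0 < l" "M = 1 \<or> h = l / real M"
  shows "0 \<le> (\<Sum>j\<in>S. tent l h M j x)" "(\<Sum>j\<in>S. tent l h M j x) \<le> h\<^sup>2 / 16"
    and "(\<And>j. j \<in> S \<Longrightarrow> \<bar>y - cell_center l M j\<bar> \<ge> h / 2) \<Longrightarrow> (\<Sum>j\<in>S. tent l h M j x) \<le> (x - y)\<^sup>2 / 4"
proof -
  show "0 \<le> (\<Sum>j\<in>S. tent l h M j x)" by (intro sum_nonneg) (simp add: tent_def)
  show "(\<Sum>j\<in>S. tent l h M j x) \<le> h\<^sup>2 / 16"
  proof (rule sum_tents_cases[OF assms, of x])
    fix j assume j: "\<bar>x - cell_center l M j\<bar> < h / 2" "(\<Sum>j\<in>S. tent l h M j x) = tent l h M j x"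
    have "(max 0 (h / 2 - \<bar>x - cell_center l M j\<bar>))\<^sup>2 \<le> (h / 2)\<^sup>2" using j(1) by (intro power_mono) auto
    then show ?thesis using j(2) by (simp add: tent_def power_divide)
  qed auto
  assume y: "\<And>j. j \<in> S \<Longrightarrow> \<bar>y - cell_center l M j\<bar> \<ge> h / 2"
  show "(\<Sum>j\<in>S. tent l h M j x) \<le> (x - y)\<^sup>2 / 4"
  proof (rule sum_tents_cases[OF assms, of x])
    fix j assume j: "j \<in> S" "\<bar>x - cell_center l M j\<bar> < h / 2" "(\<Sum>j\<in>S. tent l h M j x) = tent l h M j x"
    have "h / 2 - \<bar>x - cell_center l M j\<bar> \<le> \<bar>x - y\<bar>" using y[OF j(1)] by linarith
    then have "(max 0 (h / 2 - \<bar>x - cell_center l M j\<bar>))\<^sup>2 \<le> \<bar>x - y\<bar>\<^sup>2"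
      by (intro power_mono) auto
    then show ?thesis using j(3) by (simp add: tent_def)
  qed auto
qed

lemma dist_ge_of_horizontal_gap:
  fixes p q :: "real^2"
  assumes "p $ 2 = t" "0 \<le> t - q $ 2" "t - q $ 2 \<le> 1" "0 \<le> g" "g \<le> 1" "g \<le> (q $ 1 - p $ 1)\<^sup>2 / 4"
  shows "dist p q + q $ 2 \<ge> t + g"
proof -
  define T where "T = t - q $ 2"
  have "(T + g)\<^sup>2 = T\<^sup>2 + (2 * T + g) * g" by (simp add: power2_eq_square algebra_simps)
  also have "\<dots> \<le> T\<^sup>2 + 4 * g" using assms by (auto simp: T_def intro!: mult_right_mono)
  also have "\<dots> \<le> (p $ 2 - q $ 2)\<^sup>2 + (p $ 1 - q $ 1)\<^sup>2"
    using assms by (simp add: T_def power2_commute)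
  also have "\<dots> = (dist p q)\<^sup>2"
    by (simp add: dist_vec_def L2_set_def sum_2 dist_real_def)
  finally have "T + g \<le> dist p q" by (rule power2_le_imp_le) simp
  then show ?thesis by (simp add: T_def)
qed

text \<open>
  Weights up to \<open>\<theta>\<close> are light, larger ones are heavy. Both cost models charge this surcharge per unit
  length, with different parameters.
\<close>

definition excess_weight :: "real \<Rightarrow> real \<Rightarrow> real \<Rightarrow> real \<Rightarrow> real" where
  "excess_weight \<theta> a m0 x = (if x \<le> \<theta> then a * x else m0)"

abbreviation surcharged_cost ::
    "real \<Rightarrow> real \<Rightarrow> real \<Rightarrow> real \<Rightarrow> ((real^2) \<times> (real^2)) set \<Rightarrow> ((real^2) \<times> (real^2) \<Rightarrow> real) \<Rightarrow> real" where
  "surcharged_cost \<theta> a m0 W0 E w \<equiv> (\<Sum>e\<in>E. edge_length e * (min (w e) W0 + excess_weight \<theta> a m0 (w e)))"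

text \<open>
  The reward is given in those cells that contain no upward crossing of a heavy edge at the level \<open>t\<close> of
  \<open>good_level\<close>. Each heavy crossing spoils at most one cell, which costs \<open>h ^ 3 / 128\<close>, and light
  crossings cost a jump of at most \<open>h\<^sup>2 / 16\<close> per unit of mass. The conditions on \<open>m0\<close> and \<open>a\<close> are such
  that each of the two losses is at most half of the total surcharge \<open>X\<close>.
\<close>

lemma discrete_excess:
  fixes E :: "((real^2) \<times> (real^2)) set" and V A :: "(real^2) set"
  assumes fin: "finite E" "finite V" and bal: "balanced E w V \<alpha> \<beta>"
    and w0: "\<And>e. e \<in> E \<Longrightarrow> w e \<ge> 0" and a0: "\<And>v. v \<in> V \<Longrightarrow> \<alpha> v \<ge> 0" and b0: "\<And>v. v \<in> V \<Longrightarrow> \<beta> v \<ge> 0"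
    and A: "A \<subseteq> V" "\<And>q. q \<in> A \<Longrightarrow> \<bar>q $ 2\<bar> \<le> 1/8"
    and loc: "\<And>p. (\<Sum>q\<in>{q\<in>A. dist p q \<le> 2}. \<alpha> q) \<le> W0"
    and psi: "\<And>v. v \<in> V \<Longrightarrow> \<psi> v \<ge> 0"
      "\<And>t g v q. 1/8 \<le> t \<Longrightarrow> t \<le> 3/4 \<Longrightarrow> 0 \<le> g \<Longrightarrow> g \<le> 1/16 \<Longrightarrow> v \<in> V \<Longrightarrow> q \<in> A \<Longrightarrow>
        1 - potential t g q v \<le> \<psi> v"
    and l: "0 < l" and h: "0 < h" "h \<le> 1" "l / real M \<le> h" "M = 1 \<or> h = l / real M" "M \<ge> 1"
    and par: "h ^ 3 \<le> 32 * m0" "h\<^sup>2 \<le> 4 * a"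
    and src: "(\<Sum>q\<in>A. \<alpha> q * (1 - q $ 2)) \<ge> l - \<delta>"
      "\<And>j. j < M \<Longrightarrow> (\<Sum>q\<in>A. \<alpha> q * tent l h M j (q $ 1)) \<ge> l / real M * h\<^sup>2 / 128 - \<delta> / real M"
    and snk: "(\<Sum>v\<in>V. \<beta> v * \<psi> v) \<le> \<delta>" and "\<delta> \<ge> 0"
  shows "surcharged_cost \<theta> a m0 W0 E w \<ge> l + l * h\<^sup>2 / 128 - 3 * \<delta>"
proof -
  define m where "m e = excess_weight \<theta> a m0 (w e)" for e
  define X where "X = (\<Sum>e\<in>E. edge_length e * m e)"
  have "h ^ 3 > 0" "h\<^sup>2 > 0" using h(1) by simp_all
  then have "m0 > 0" "a > 0" using par by linarith+
  then have m: "m e \<ge> 0" if "e \<in> E" for e using w0[OF that] by (simp add: m_def excess_weight_def)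
  obtain t where t: "t \<in> {1/8..3/4}" "(\<Sum>e\<in>{e\<in>E. upward t e}. m e) \<le> 2 * X"
    using good_level[OF fin(1), of m] m unfolding X_def by blast
  define H where "H = {e. w e > \<theta>}"
  define C where "C = {e \<in> E \<inter> H. upward t e}"
  define x where "x e = crossing t (fst e) (snd e) $ 1" for e
  define S where "S = {j. j < M \<and> (\<forall>e\<in>C. \<bar>x e - cell_center l M j\<bar> \<ge> h / 2)}"
  \<comment> \<open>\<open>C\<close> consists of the heavy upward crossings and \<open>S\<close> of the cells without such a crossing.\<close>
  define g where "g q = (\<Sum>j\<in>S. tent l h M j (q $ 1))" for q :: "real^2"
  have finC: "finite C" using fin by (simp add: C_def)
  have split: "(\<Sum>e\<in>{e\<in>E. upward t e}. m e) = real (card C) * m0 + a * (\<Sum>e\<in>{e\<in>E - H. upward t e}. w e)"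
  proof -
    have "{e\<in>E. upward t e} = C \<union> {e\<in>E - H. upward t e}" "C \<inter> {e\<in>E - H. upward t e} = {}"
      by (auto simp: C_def)
    then have "(\<Sum>e\<in>{e\<in>E. upward t e}. m e) = (\<Sum>e\<in>C. m e) + (\<Sum>e\<in>{e\<in>E - H. upward t e}. m e)"
      using fin finC by (simp add: sum.union_disjoint)
    moreover have "(\<Sum>e\<in>C. m e) = (\<Sum>e\<in>C. m0)"
      by (rule sum.cong) (auto simp: C_def H_def m_def excess_weight_def)
    moreover have "(\<Sum>e\<in>{e\<in>E - H. upward t e}. m e) = (\<Sum>e\<in>{e\<in>E - H. upward t e}. a * w e)"
      by (rule sum.cong) (auto simp: H_def m_def excess_weight_def)
    ultimately show ?thesis by (simp add: sum_distrib_left)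
  qed
  define Lw where "Lw = (\<Sum>e\<in>{e\<in>E - H. upward t e}. w e)"
  have Lw0: "Lw \<ge> 0" unfolding Lw_def using w0 by (intro sum_nonneg) auto
  have heavy: "real (card C) * m0 + a * Lw \<le> 2 * X" using split t by (simp add: Lw_def)
  have SM: "S \<subseteq> {..<M}" by (auto simp: S_def)
  have cardS: "real M - real (card C) \<le> real (card S)"
  proof -
    have "\<forall>j\<in>{..<M} - S. \<exists>e\<in>C. \<bar>x e - cell_center l M j\<bar> < h / 2" by (auto simp: S_def not_le)
    then obtain f where f: "\<And>j. j \<in> {..<M} - S \<Longrightarrow> f j \<in> C \<and> \<bar>x (f j) - cell_center l M j\<bar> < h / 2" by metis
    have "inj_on f ({..<M} - S)"
    proof
      fix i j assume ij: "i \<in> {..<M} - S" "j \<in> {..<M} - S" "f i = f j"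
      show "i = j"
      proof (rule ccontr)
        assume "i \<noteq> j"
        then have "\<bar>cell_center l M i - cell_center l M j\<bar> \<ge> h"
          using ij l h by (intro cell_center_separated) auto
        moreover have "\<bar>x (f j) - cell_center l M i\<bar> < h / 2" "\<bar>x (f j) - cell_center l M j\<bar> < h / 2"
            using f[OF ij(1)] f[OF ij(2)] ij(3) by auto
          ultimately show False by linarith
      qed
    qed
    then have "card ({..<M} - S) \<le> card C" using f finC by (intro card_inj_on_le) auto
    moreover have "card ({..<M} - S) = M - card S"
      using SM by (subst card_Diff_subset) (auto intro: finite_subset)
    ultimately show ?thesis by linarith
  qed
  have h16: "h\<^sup>2 / 16 \<le> 1/16" using h by (simp add: power_le_one)
  note gb = sum_tents_bounds[OF SM l h(4), folded g_def]
  have g01: "0 \<le> g q" "g q \<le> h\<^sup>2 / 16" for q using gb(1,2)[of "q $ 1"] by (auto simp: g_def)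
  have main: "(\<Sum>q\<in>A. \<alpha> q * (1 - q $ 2 + g q)) - (\<Sum>v\<in>V. \<beta> v * \<psi> v)
    \<le> (\<Sum>e\<in>E. edge_length e * min (w e) W0) + h\<^sup>2 / 16 * Lw"
    unfolding Lw_def
  proof (rule flow_cost_ge[OF fin bal w0 a0 b0 A])
    show "1/8 \<le> t" using t by simp
    show "0 \<le> g q" "g q \<le> h\<^sup>2 / 16" for q using g01 by auto
    show "0 \<le> h\<^sup>2 / 16" "h\<^sup>2 / 16 \<le> 1/8" using h16 by auto
    show "(\<Sum>q\<in>{q\<in>A. dist p q \<le> 2}. \<alpha> q) \<le> W0" for p by (rule loc)
    show "\<psi> v \<ge> 0" if "v \<in> V" for v by (rule psi(1)[OF that])
    show "1 - potential t (g q) q v \<le> \<psi> v" if "v \<in> V" "q \<in> A" for v q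
      using that t g01[of q] h16 by (intro psi(2)) auto
    fix e q assume e: "e \<in> E" "e \<in> H" "upward t e" and q: "q \<in> A"
    have up: "fst e $ 2 \<le> t" "t < snd e $ 2" using e by (auto simp: upward_def)
    show "dist (crossing t (fst e) (snd e)) q + q $ 2 \<ge> t + g q"
    proof (rule dist_ge_of_horizontal_gap)
      show "crossing t (fst e) (snd e) $ 2 = t" by (rule crossing(1)[OF up])
      show "0 \<le> t - q $ 2" "t - q $ 2 \<le> 1" using A(2)[OF q] t by auto
      show "0 \<le> g q" "g q \<le> 1" using g01[of q] h16 by auto
      have "e \<in> C" using e by (auto simp: C_def)
      then show "g q \<le> (q $ 1 - crossing t (fst e) (snd e) $ 1)\<^sup>2 / 4"
        unfolding g_def x_def[symmetric] by (intro sum_tents_bounds(3)[OF SM l h(4)]) (auto simp: S_def)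
    qed
  qed
  have "(\<Sum>q\<in>A. \<alpha> q * (1 - q $ 2 + g q)) = (\<Sum>q\<in>A. \<alpha> q * (1 - q $ 2)) + (\<Sum>j\<in>S. \<Sum>q\<in>A. \<alpha> q * tent l h M j (q $ 1))"
    unfolding g_def by (subst sum.swap) (simp only: sum.distrib[symmetric] sum_distrib_left[symmetric] distrib_left[symmetric])
  also have "\<dots> \<ge> (l - \<delta>) + (\<Sum>j\<in>S. l / real M * h\<^sup>2 / 128 - \<delta> / real M)"
    using src SM by (intro add_mono sum_mono) auto
  also have "(\<Sum>j\<in>S. l / real M * h\<^sup>2 / 128 - \<delta> / real M)
      = real (card S) * (l / real M * h\<^sup>2 / 128) - real (card S) / real M * \<delta>"
    by (simp add: algebra_simps)
  finally have lower: "(\<Sum>q\<in>A. \<alpha> q * (1 - q $ 2 + g q))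
    \<ge> (l - \<delta>) + real (card S) * (l / real M * h\<^sup>2 / 128) - real (card S) / real M * \<delta>" by simp
  have "card S \<le> M" using card_mono[OF _ SM] by simp
  then have "real (card S) / real M * \<delta> \<le> 1 * \<delta>"
    using h(5) \<open>\<delta> \<ge> 0\<close> by (intro mult_right_mono) auto
  moreover have "real (card S) * (l / real M * h\<^sup>2 / 128) \<ge> l * h\<^sup>2 / 128 - X / 2"
  proof -
    have "(real M - real (card C)) * (l / real M * h\<^sup>2 / 128) \<le> real (card S) * (l / real M * h\<^sup>2 / 128)"
      using cardS l by (intro mult_right_mono) auto
    moreover have "(real M - real (card C)) * (l / real M * h\<^sup>2 / 128)
        = l * h\<^sup>2 / 128 - real (card C) * (l / real M * h\<^sup>2 / 128)"
      using h(5) by (simp add: field_simps)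
    moreover have "real (card C) * (l / real M * h\<^sup>2 / 128) \<le> real (card C) * (h ^ 3 / 128)"
    proof (rule mult_left_mono)
      have "l / real M * h\<^sup>2 \<le> h * h\<^sup>2" using h by (intro mult_right_mono) auto
      then show "l / real M * h\<^sup>2 / 128 \<le> h ^ 3 / 128" by (simp add: power3_eq_cube power2_eq_square)
    qed simp
    moreover have "real (card C) * (h ^ 3 / 128) \<le> real (card C) * (m0 / 4)"
      using par by (intro mult_left_mono) auto
    moreover have "real (card C) * (m0 / 4) \<le> X / 2"
    proof -
      have "a * Lw \<ge> 0" using Lw0 \<open>a > 0\<close> by simp
      moreover have "real (card C) * (m0 / 4) = real (card C) * m0 / 4" by simp
      ultimately show ?thesis using heavy by linarith
    qed
    ultimately show ?thesis by linarith
  qed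
  moreover have "h\<^sup>2 / 16 * Lw \<le> X / 2"
  proof -
    have "h\<^sup>2 / 16 * Lw \<le> a / 4 * Lw" using par Lw0 by (intro mult_right_mono) auto
    also have "a / 4 * Lw \<le> X / 2"
    proof -
      have "real (card C) * m0 \<ge> 0" using \<open>m0 > 0\<close> by simp
      moreover have "a / 4 * Lw = a * Lw / 4" by simp
      ultimately show ?thesis using heavy by linarith
    qed
    finally show ?thesis .
  qed
  moreover have "surcharged_cost \<theta> a m0 W0 E w
     = (\<Sum>e\<in>E. edge_length e * min (w e) W0) + X"
    by (simp add: X_def m_def sum.distrib distrib_left)
  ultimately show ?thesis using main lower snk by linarith
qed

section \<open>Integration against combinations of measures\<close>

text \<open>
  The identity between the measures of sets extends to nonnegative functions by approximation with simple
  functions.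
\<close>

lemma nn_integral_finite_combination:
  assumes "finite I" and M: "sets M = sets borel" and N: "\<And>i. i \<in> I \<Longrightarrow> sets (N i) = sets borel"
    and eq: "\<And>A. A \<in> sets borel \<Longrightarrow> emeasure M A = (\<Sum>i\<in>I. c i * emeasure (N i) A)"
    and f: "f \<in> borel_measurable borel"
  shows "(\<integral>\<^sup>+x. f x \<partial>M) = (\<Sum>i\<in>I. c i * (\<integral>\<^sup>+x. f x \<partial>N i))"
  using f
proof (induction rule: borel_measurable_induct)
  case (cong f g)
  then show ?case by (simp cong: nn_integral_cong)
next
  case (set A)
  have "A \<in> sets (N i)" if "i \<in> I" for i using set N[OF that] by simp
  then show ?case using eq[OF set] set M by (simp add: nn_integral_indicator)
next
  case (mult u d)
  have mM: "u \<in> borel_measurable M" using mult M by (simp cong: measurable_cong_sets)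
  have mN: "u \<in> borel_measurable (N i)" if "i \<in> I" for i
    using mult measurable_cong_sets[OF N[OF that] refl] by blast
  show ?case using mult.IH mM mN by (simp add: nn_integral_cmult sum_distrib_left mult.left_commute)
next
  case (add u v)
  have mM: "u \<in> borel_measurable M" "v \<in> borel_measurable M" using add M by (simp_all cong: measurable_cong_sets)
  have mN: "u \<in> borel_measurable (N i)" "v \<in> borel_measurable (N i)" if "i \<in> I" for i
    using add measurable_cong_sets[OF N[OF that] refl] by blast+
  show ?case using add.IH mM mN by (simp add: nn_integral_add sum.distrib distrib_left)
next
  case (seq U)
  have mM: "U k \<in> borel_measurable M" for k using seq M by (simp cong: measurable_cong_sets)
  have mN: "U k \<in> borel_measurable (N i)" if "i \<in> I" for i k
    using seq measurable_cong_sets[OF N[OF that] refl] by blast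
  have inc: "incseq (\<lambda>k. \<integral>\<^sup>+x. U k x \<partial>L)" for L
    using seq(3) by (auto simp: incseq_def le_fun_def intro!: nn_integral_mono)
  have sup: "Sup (range U) = (\<lambda>x. SUP k. U k x)" by (simp add: fun_eq_iff Sup_fun_def image_image)
  have incc: "incseq (\<lambda>k. c i * \<integral>\<^sup>+x. U k x \<partial>N i)" for i
    using inc[of "N i"] by (auto simp: incseq_def intro!: mult_left_mono)
  have "(\<integral>\<^sup>+x. Sup (range U) x \<partial>M) = (SUP k. \<integral>\<^sup>+x. U k x \<partial>M)"
    using seq(3) mM by (simp add: sup image_image nn_integral_monotone_convergence_SUP)
  also have "\<dots> = (SUP k. \<Sum>i\<in>I. c i * (\<integral>\<^sup>+x. U k x \<partial>N i))" using seq.IH by simp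
  also have "\<dots> = (\<Sum>i\<in>I. SUP k. c i * (\<integral>\<^sup>+x. U k x \<partial>N i))"
    using incc by (intro ennreal_SUP_sum) auto
  also have "\<dots> = (\<Sum>i\<in>I. c i * (\<integral>\<^sup>+x. Sup (range U) x \<partial>N i))"
    using seq(3) mN by (intro sum.cong) (simp_all add: sup image_image nn_integral_monotone_convergence_SUP SUP_mult_left_ennreal)
  finally show ?case .
qed

lemma bounded_integrable_borel:
  fixes f :: "'a::euclidean_space \<Rightarrow> real"
  assumes "finite_measure M" "sets M = sets borel" "f \<in> borel_measurable borel" "\<And>x. \<bar>f x\<bar> \<le> K"
  shows "integrable M f"
proof -
  have "f \<in> borel_measurable M" using assms(3) measurable_cong_sets[OF assms(2) refl] by blast
  then show ?thesis using assms by (intro finite_measure.integrable_const_bound[where B=K]) auto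
qed

text \<open>
  Nonnegative functions are reduced to \<open>nn_integral_finite_combination\<close>, and a bounded function is the
  difference of a nonnegative function and a constant.
\<close>

lemma integral_finite_combination:
  fixes f :: "'a::euclidean_space \<Rightarrow> real"
  assumes "finite I" and M: "sets M = sets borel" and N: "\<And>i. i \<in> I \<Longrightarrow> sets (N i) = sets borel"
    and finM: "finite_measure M" and finN: "\<And>i. i \<in> I \<Longrightarrow> finite_measure (N i)"
    and c: "\<And>i. i \<in> I \<Longrightarrow> c i \<ge> 0"
    and eq: "\<And>A. A \<in> sets borel \<Longrightarrow> emeasure M A = (\<Sum>i\<in>I. ennreal (c i) * emeasure (N i) A)"
    and f: "f \<in> borel_measurable borel" "\<And>x. \<bar>f x\<bar> \<le> K"
  shows "(LINT x|M. f x) = (\<Sum>i\<in>I. c i * (LINT x|N i. f x))"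
proof -
  have nonneg: "(LINT x|M. u x) = (\<Sum>i\<in>I. c i * (LINT x|N i. u x))"
    if u: "u \<in> borel_measurable borel" "\<And>x. 0 \<le> u x" "\<And>x. u x \<le> B" for u :: "'a \<Rightarrow> real" and B
  proof -
    have iM: "integrable M u" by (rule bounded_integrable_borel[OF finM M u(1), of B]) (use u in auto)
    have iN: "integrable (N i) u" if "i \<in> I" for i
      by (rule bounded_integrable_borel[OF finN[OF that] N[OF that] u(1), of B]) (use u in auto)
    have "ennreal (LINT x|M. u x) = (\<integral>\<^sup>+x. ennreal (u x) \<partial>M)"
      using u iM by (subst nn_integral_eq_integral) auto
    also have "\<dots> = (\<Sum>i\<in>I. ennreal (c i) * (\<integral>\<^sup>+x. ennreal (u x) \<partial>N i))"
      using u by (intro nn_integral_finite_combination[OF assms(1) M N eq]) auto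
    also have "\<dots> = (\<Sum>i\<in>I. ennreal (c i * (LINT x|N i. u x)))"
      using u iN c by (intro sum.cong) (simp_all add: nn_integral_eq_integral ennreal_mult)
    also have "\<dots> = ennreal (\<Sum>i\<in>I. c i * (LINT x|N i. u x))"
      using c u by (intro sum_ennreal) (auto intro!: mult_nonneg_nonneg integral_nonneg)
    finally show ?thesis
      using c u by (subst (asm) ennreal_inj) (auto intro!: sum_nonneg mult_nonneg_nonneg integral_nonneg)
  qed
  have K: "K \<ge> 0" using f(2)[of undefined] by linarith
  have shift: "(LINT x|L. f x) = (LINT x|L. f x + K) - (LINT x|L. K)"
    if "finite_measure L" "sets L = sets borel" for L :: "'a measure"
    using bounded_integrable_borel[OF that f] that(1)
    by (subst Bochner_Integration.integral_add) (auto simp: finite_measure.integrable_const)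
  have "(LINT x|M. f x) = (LINT x|M. f x + K) - (LINT x|M. K)" by (rule shift[OF finM M])
  also have "(LINT x|M. f x + K) = (\<Sum>i\<in>I. c i * (LINT x|N i. f x + K))"
    by (rule nonneg[of _ "2 * K"]) (use f in \<open>auto simp: abs_le_iff, smt (verit) f(2)\<close>)
  also have "(LINT x|M. K) = (\<Sum>i\<in>I. c i * (LINT x|N i. K))"
    by (rule nonneg[of "\<lambda>_. K" K]) (use K in auto)
  also have "(\<Sum>i\<in>I. c i * (LINT x|N i. f x + K)) - (\<Sum>i\<in>I. c i * (LINT x|N i. K))
     = (\<Sum>i\<in>I. c i * (LINT x|N i. f x))"
    unfolding sum_subtractf[symmetric]
    by (rule sum.cong) (simp_all only: shift[OF finN N] right_diff_distrib)
  finally show ?thesis .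
qed

lemma finite_combination_exists:
  fixes N :: "'i \<Rightarrow> 'a::euclidean_space measure"
  assumes "finite I" and N: "\<And>i. i \<in> I \<Longrightarrow> sets (N i) = sets borel" and finN: "\<And>i. i \<in> I \<Longrightarrow> finite_measure (N i)"
    and c: "\<And>i. i \<in> I \<Longrightarrow> c i \<ge> 0"
  obtains M where "sets M = sets borel" "finite_measure M"
    "\<And>A. A \<in> sets borel \<Longrightarrow> emeasure M A = (\<Sum>i\<in>I. ennreal (c i) * emeasure (N i) A)"
proof -
  define M where "M = measure_of UNIV (sets (borel :: 'a measure)) (\<lambda>A. \<Sum>i\<in>I. ennreal (c i) * emeasure (N i) A)"
  have sa: "sigma_algebra UNIV (sets (borel :: 'a measure))"
    using sets.sigma_algebra_axioms[of "borel :: 'a measure"] by simp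
  have M: "sets M = sets borel" unfolding M_def
    using sigma_algebra.sets_measure_of_eq[OF sa] by simp
  have eq: "emeasure M A = (\<Sum>i\<in>I. ennreal (c i) * emeasure (N i) A)" if A: "A \<in> sets borel" for A
    unfolding M_def
  proof (rule emeasure_measure_of_sigma[OF sa])
    show "positive (sets borel) (\<lambda>A. \<Sum>i\<in>I. ennreal (c i) * emeasure (N i) A)" by (simp add: positive_def)
    show "countably_additive (sets borel) (\<lambda>A. \<Sum>i\<in>I. ennreal (c i) * emeasure (N i) A)"
    proof (rule countably_additiveI)
      fix B :: "nat \<Rightarrow> 'a set" assume B: "range B \<subseteq> sets borel" "disjoint_family B"
      have "(\<Sum>n. \<Sum>i\<in>I. ennreal (c i) * emeasure (N i) (B n)) = (\<Sum>i\<in>I. \<Sum>n. ennreal (c i) * emeasure (N i) (B n))"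
        by (rule suminf_sum) simp
      also have "\<dots> = (\<Sum>i\<in>I. ennreal (c i) * emeasure (N i) (\<Union>n. B n))"
        using B N by (intro sum.cong) (simp_all add: suminf_emeasure)
      finally show "(\<Sum>n. \<Sum>i\<in>I. ennreal (c i) * emeasure (N i) (B n)) = (\<Sum>i\<in>I. ennreal (c i) * emeasure (N i) (\<Union>n. B n))" .
    qed
  qed (rule A)
  have "space M = UNIV" using M sets_eq_imp_space_eq by fastforce
  moreover have "emeasure M UNIV = (\<Sum>i\<in>I. ennreal (c i * measure (N i) UNIV))"
    unfolding eq[OF sets.top[of borel, unfolded space_borel]] using finN c
    by (intro sum.cong) (auto simp: finite_measure.emeasure_eq_measure ennreal_mult)
  moreover have "\<dots> = ennreal (\<Sum>i\<in>I. c i * measure (N i) UNIV)" using c by (intro sum_ennreal) auto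
  ultimately have "finite_measure M" by (intro finite_measureI) auto
  with M eq show ?thesis by (intro that)
qed

lemma measure_split:
  fixes M :: "'a::euclidean_space measure"
  assumes "sets M = sets borel" "finite_measure M" "A \<in> sets borel" "Y \<in> sets borel"
  shows "measure M A = measure M (A \<inter> Y) + measure M (A \<inter> - Y)"
proof -
  have "(A \<inter> Y) \<union> (A \<inter> - Y) = A" "(A \<inter> Y) \<inter> (A \<inter> - Y) = {}" by auto
  then show ?thesis
    using assms finite_measure.finite_measure_Union[OF assms(2), of "A \<inter> Y" "A \<inter> - Y"] by auto
qed

text \<open>
  The supremum in the definition of the positive variation is attained on the positive set \<open>Y\<close> of a Hahn
  decomposition, which makes the variation an explicit measure.
\<close>

lemma Jordan_pos_variation:
  fixes M N :: "'a::euclidean_space measure"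
  assumes M: "sets M = sets borel" "finite_measure M" and N: "sets N = sets borel" "finite_measure N"
    and \<nu>: "\<And>A. A \<in> sets borel \<Longrightarrow> \<nu> A = measure M A - measure N A"
    and Y: "Y \<in> sets borel" "\<And>X. X \<in> sets borel \<Longrightarrow> X \<subseteq> Y \<Longrightarrow> measure N X \<le> measure M X"
      "\<And>X. X \<in> sets borel \<Longrightarrow> X \<inter> Y = {} \<Longrightarrow> measure M X \<le> measure N X"
  shows "sets (pos_variation \<nu>) = sets borel" "finite_measure (pos_variation \<nu>)"
    "\<And>A. A \<in> sets borel \<Longrightarrow> emeasure (pos_variation \<nu>) A = ennreal (measure M (A \<inter> Y) - measure N (A \<inter> Y))"
proof -
  interpret M: finite_measure M by fact
  interpret N: finite_measure N by fact
  have split: "\<nu> X = \<nu> (X \<inter> Z) + \<nu> (X \<inter> - Z)" if "X \<in> sets borel" "Z \<in> sets borel" for X Z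
    using measure_split[OF M that] measure_split[OF N that] that by (simp add: \<nu>)
  have sup: "(SUP B\<in>{B\<in>sets borel. B \<subseteq> A}. ennreal (\<nu> B)) = ennreal (\<nu> (A \<inter> Y))"
    if A: "A \<in> sets borel" for A
  proof (rule antisym)
    show "(SUP B\<in>{B\<in>sets borel. B \<subseteq> A}. ennreal (\<nu> B)) \<le> ennreal (\<nu> (A \<inter> Y))"
    proof (rule SUP_least, clarify)
      fix B assume B: "B \<in> sets borel" "B \<subseteq> A"
      have "\<nu> (B \<inter> - Y) \<le> 0" "0 \<le> \<nu> (A \<inter> Y \<inter> - B)"
        using Y(2)[of "A \<inter> Y \<inter> - B"] Y(3)[of "B \<inter> - Y"] A B(1) Y(1) by (auto simp: \<nu>)
      moreover have "A \<inter> Y \<inter> B = B \<inter> Y" using B(2) by blast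
      ultimately show "ennreal (\<nu> B) \<le> ennreal (\<nu> (A \<inter> Y))"
        using split[OF B(1) Y(1)] split[of "A \<inter> Y" B] A B(1) Y(1) by (intro ennreal_leI) simp
    qed
    show "ennreal (\<nu> (A \<inter> Y)) \<le> (SUP B\<in>{B\<in>sets borel. B \<subseteq> A}. ennreal (\<nu> B))"
      by (rule SUP_upper) (use A Y(1) in auto)
  qed
  define P where "P = diff_measure (density M (indicator Y)) (density N (indicator Y))"
  have restr: "emeasure (density M (indicator Y)) A = ennreal (measure M (A \<inter> Y))"
    "emeasure (density N (indicator Y)) A = ennreal (measure N (A \<inter> Y))" if "A \<in> sets borel" for A
    using that Y(1) M(1) N(1)
    by (simp_all add: emeasure_restricted M.emeasure_eq_measure N.emeasure_eq_measure Int_commute)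
  have sp: "space M = UNIV" "space N = UNIV" using sets_eq_imp_space_eq[OF M(1)] sets_eq_imp_space_eq[OF N(1)] by simp_all
  have P: "emeasure P A = ennreal (measure M (A \<inter> Y) - measure N (A \<inter> Y))" if A: "A \<in> sets borel" for A
    unfolding P_def
  proof (subst emeasure_diff_measure)
    show "finite_measure (density M (indicator Y))" "finite_measure (density N (indicator Y))"
      using restr[of UNIV] sp by (auto intro!: finite_measureI)
    show "emeasure (density N (indicator Y)) B \<le> emeasure (density M (indicator Y)) B"
      if "B \<in> sets (density M (indicator Y))" for B
      using that restr[of B] M(1) Y(1) Y(2)[of "B \<inter> Y"] by (simp add: ennreal_leI)
  qed (use A M(1) N(1) restr[OF A] in \<open>simp_all add: ennreal_minus\<close>)
  have setsP: "sets P = sets borel" "space P = UNIV" using M(1) sp by (simp_all add: P_def)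
  have "pos_variation \<nu> = measure_of UNIV (sets borel) (emeasure P)"
    unfolding pos_variation_def
    using sup P Y(1) sets.sigma_sets_eq[of "borel :: 'a measure"] by (intro measure_of_eq) (auto simp: \<nu>)
  then have eq: "pos_variation \<nu> = P" using measure_of_of_measure[of P] setsP by simp
  show "sets (pos_variation \<nu>) = sets borel" using setsP eq by simp
  show "finite_measure (pos_variation \<nu>)" unfolding eq using P[of UNIV] setsP by (intro finite_measureI) auto
  show "emeasure (pos_variation \<nu>) A = ennreal (measure M (A \<inter> Y) - measure N (A \<inter> Y))" if "A \<in> sets borel" for A
    using P[OF that] eq by simp
qed

text \<open>
  With \<open>P\<close> and \<open>Q\<close> the positive and negative variations of \<open>M - N\<close>, the measures \<open>P + N\<close> and \<open>M + Q\<close>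
  coincide; integrate against both.
\<close>

lemma signed_integral_diff:
  fixes M N :: "'a::euclidean_space measure"
  assumes M: "sets M = sets borel" "finite_measure M" and N: "sets N = sets borel" "finite_measure N"
    and \<nu>: "\<And>A. A \<in> sets borel \<Longrightarrow> \<nu> A = measure M A - measure N A"
    and f: "f \<in> borel_measurable borel" "\<And>x. \<bar>f x\<bar> \<le> K"
  shows "signed_integral \<nu> f = (LINT x|M. f x) - (LINT x|N. f x)"
proof -
  interpret M: finite_measure M by fact
  interpret N: finite_measure N by fact
  have "sets M = sets N" using M N by simp
  then obtain Y where Y: "Y \<in> sets M"
    "\<forall>X\<in>sets M. X \<subseteq> Y \<longrightarrow> emeasure N X \<le> emeasure M X"
    "\<forall>X\<in>sets M. X \<inter> Y = {} \<longrightarrow> emeasure M X \<le> emeasure N X"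
    using finite_unsigned_Hahn_decomposition[OF M(2) N(2)] by auto
  have Y': "Y \<in> sets borel" "\<And>X. X \<in> sets borel \<Longrightarrow> X \<subseteq> Y \<Longrightarrow> measure N X \<le> measure M X"
      "\<And>X. X \<in> sets borel \<Longrightarrow> X \<inter> Y = {} \<Longrightarrow> measure M X \<le> measure N X"
    using Y M(1) by (auto simp: M.emeasure_eq_measure N.emeasure_eq_measure)
  have P: "sets (pos_variation \<nu>) = sets borel" "finite_measure (pos_variation \<nu>)"
    by (rule Jordan_pos_variation[OF M N \<nu> Y'(1)]; use Y' in blast)+
  have P3: "emeasure (pos_variation \<nu>) A = ennreal (measure M (A \<inter> Y) - measure N (A \<inter> Y))"
    if "A \<in> sets borel" for A
    by (rule Jordan_pos_variation(3)[OF M N \<nu> Y'(1) _ _ that]; use Y' in blast)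
  have cY: "- Y \<in> sets borel" using Y'(1) by auto
  have "X \<subseteq> - Y \<longleftrightarrow> X \<inter> Y = {}" "X \<inter> - Y = {} \<longleftrightarrow> X \<subseteq> Y" for X by auto
  then have cY': "\<And>X. X \<in> sets borel \<Longrightarrow> X \<subseteq> - Y \<Longrightarrow> measure M X \<le> measure N X"
      "\<And>X. X \<in> sets borel \<Longrightarrow> X \<inter> - Y = {} \<Longrightarrow> measure N X \<le> measure M X"
    using Y' by auto
  define \<nu>2 where "\<nu>2 = (\<lambda>A. - \<nu> A)"
  have \<nu>2: "\<nu>2 A = measure N A - measure M A" if "A \<in> sets borel" for A
    using \<nu>[OF that] by (simp add: \<nu>2_def)
  have Q: "sets (pos_variation \<nu>2) = sets borel" "finite_measure (pos_variation \<nu>2)"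
    by (rule Jordan_pos_variation[OF N M \<nu>2 cY]; use cY' in blast)+
  have Q3: "emeasure (pos_variation \<nu>2) A = ennreal (measure N (A \<inter> - Y) - measure M (A \<inter> - Y))"
    if "A \<in> sets borel" for A
    by (rule Jordan_pos_variation(3)[OF N M \<nu>2 cY _ _ that]; use cY' in blast)
  define P' where "P' = pos_variation \<nu>"
  define Q' where "Q' = pos_variation \<nu>2"
  define R where "R = (\<lambda>b. if b then P' else N)"
  define S where "S = (\<lambda>b. if b then M else Q')"
  have RS: "R True = P'" "R False = N" "S True = M" "S False = Q'" by (simp_all only: R_def S_def if_True if_False)
  have P': "sets P' = sets borel" "finite_measure P'" by (simp_all only: P'_def P)
  have Q': "sets Q' = sets borel" "finite_measure Q'" by (simp_all only: Q'_def Q)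
  have R: "sets (R b) = sets borel" "finite_measure (R b)" for b
    by (cases b; simp only: RS P' N)+
  have S: "sets (S b) = sets borel" "finite_measure (S b)" for b
    by (cases b; simp only: RS Q' M)+
  \<comment> \<open>The measure \<open>P' + N\<close>, which by \<open>T2\<close> is also \<open>M + Q'\<close>.\<close>
  obtain T where T: "sets T = sets borel" "finite_measure T"
    "\<And>A. A \<in> sets borel \<Longrightarrow> emeasure T A = (\<Sum>b\<in>UNIV. ennreal 1 * emeasure (R b) A)"
    by (rule finite_combination_exists[of UNIV R "\<lambda>_. 1"]) (simp_all add: R)
  have T2: "emeasure T A = (\<Sum>b\<in>UNIV. ennreal 1 * emeasure (S b) A)" if A: "A \<in> sets borel" for A
  proof -
    have MA: "measure M A = measure M (A \<inter> Y) + measure M (A \<inter> - Y)"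
      using measure_split[OF M A Y'(1)] .
    have NA: "measure N A = measure N (A \<inter> Y) + measure N (A \<inter> - Y)"
      using measure_split[OF N A Y'(1)] .
    have "measure N (A \<inter> Y) \<le> measure M (A \<inter> Y)" "measure M (A \<inter> - Y) \<le> measure N (A \<inter> - Y)"
      using A Y'(1) by (auto intro: Y'(2) cY'(1))
    then have "ennreal (measure M (A \<inter> Y) - measure N (A \<inter> Y)) + ennreal (measure N A)
        = ennreal (measure M A) + ennreal (measure N (A \<inter> - Y) - measure M (A \<inter> - Y))"
      using MA NA by (subst (1 2) ennreal_plus[symmetric]) auto
    then show ?thesis
      unfolding T(3)[OF A] using P3[OF A] Q3[OF A]
      by (simp add: RS P'_def Q'_def UNIV_bool M.emeasure_eq_measure N.emeasure_eq_measure add.commute)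
  qed
  have "(LINT x|T. f x) = (\<Sum>b\<in>UNIV. 1 * (LINT x|R b. f x))"
    by (rule integral_finite_combination[OF _ T(1) R(1) T(2) R(2) _ T(3) f]) auto
  moreover have "(LINT x|T. f x) = (\<Sum>b\<in>UNIV. 1 * (LINT x|S b. f x))"
    by (rule integral_finite_combination[OF _ T(1) S(1) T(2) S(2) _ T2 f]) auto
  ultimately show ?thesis
    by (simp add: signed_integral_def RS P'_def Q'_def \<nu>2_def UNIV_bool)
qed

lemma signed_integral_combination:
  fixes N :: "'i \<Rightarrow> 'a::euclidean_space measure"
  assumes I: "finite I" and N: "\<And>i. i \<in> I \<Longrightarrow> sets (N i) = sets borel" "\<And>i. i \<in> I \<Longrightarrow> finite_measure (N i)"
    and \<nu>: "\<And>A. A \<in> sets borel \<Longrightarrow> \<nu> A = (\<Sum>i\<in>I. c i * measure (N i) A)"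
    and f: "f \<in> borel_measurable borel" "\<And>x. \<bar>f x\<bar> \<le> K"
  shows "signed_integral \<nu> f = (\<Sum>i\<in>I. c i * (LINT x|N i. f x))"
proof -
  obtain P where P: "sets P = sets borel" "finite_measure P"
    "\<And>A. A \<in> sets borel \<Longrightarrow> emeasure P A = (\<Sum>i\<in>I. ennreal (max 0 (c i)) * emeasure (N i) A)"
    by (rule finite_combination_exists[OF I N, where c="\<lambda>i. max 0 (c i)"]) auto
  obtain Q where Q: "sets Q = sets borel" "finite_measure Q"
    "\<And>A. A \<in> sets borel \<Longrightarrow> emeasure Q A = (\<Sum>i\<in>I. ennreal (max 0 (- c i)) * emeasure (N i) A)"
    by (rule finite_combination_exists[OF I N, where c="\<lambda>i. max 0 (- c i)"]) auto
  have meas: "measure M A = (\<Sum>i\<in>I. d i * measure (N i) A)"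
    if "A \<in> sets borel" "\<And>i. d i \<ge> 0" "emeasure M A = (\<Sum>i\<in>I. ennreal (d i) * emeasure (N i) A)" for M A and d :: "'i \<Rightarrow> real"
  proof -
    have "emeasure M A = (\<Sum>i\<in>I. ennreal (d i * measure (N i) A))"
      unfolding that(3) using N(2) that(2)
      by (intro sum.cong) (auto simp: finite_measure.emeasure_eq_measure ennreal_mult)
    also have "\<dots> = ennreal (\<Sum>i\<in>I. d i * measure (N i) A)" using that(2) by (intro sum_ennreal) auto
    finally show ?thesis using that(2) by (simp add: measure_def sum_nonneg)
  qed
  have "signed_integral \<nu> f = (LINT x|P. f x) - (LINT x|Q. f x)"
  proof (rule signed_integral_diff[OF P(1,2) Q(1,2) _ f])
    fix A :: "'a set" assume A: "A \<in> sets borel"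
    have "measure P A - measure Q A = (\<Sum>i\<in>I. max 0 (c i) * measure (N i) A - max 0 (- c i) * measure (N i) A)"
      using meas[OF A _ P(3)[OF A]] meas[OF A _ Q(3)[OF A]] by (simp add: sum_subtractf)
    also have "\<dots> = \<nu> A" unfolding \<nu>[OF A] by (rule sum.cong) (auto simp: max_def)
    finally show "\<nu> A = measure P A - measure Q A" by simp
  qed
  also have "(LINT x|P. f x) = (\<Sum>i\<in>I. max 0 (c i) * (LINT x|N i. f x))"
    by (rule integral_finite_combination[OF I P(1) N(1) P(2) N(2) _ P(3) f]) auto
  also have "(LINT x|Q. f x) = (\<Sum>i\<in>I. max 0 (- c i) * (LINT x|N i. f x))"
    by (rule integral_finite_combination[OF I Q(1) N(1) Q(2) N(2) _ Q(3) f]) auto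
  finally show ?thesis unfolding sum_subtractf[symmetric]
    by (simp, intro sum.cong) (auto simp: max_def)
qed

text \<open>
  This evaluates the vector integral for discrete fluxes, where the \<open>N i\<close> are the length measures of the
  edges, and for the flux with constant density on a rectangle.
\<close>

lemma vector_integral_combination:
  fixes N :: "'i \<Rightarrow> 'a::euclidean_space measure" and c :: "'i \<Rightarrow> 'b::euclidean_space"
  assumes I: "finite I" and N: "\<And>i. i \<in> I \<Longrightarrow> sets (N i) = sets borel" "\<And>i. i \<in> I \<Longrightarrow> finite_measure (N i)"
    and F: "\<And>A. A \<in> sets borel \<Longrightarrow> F A = (\<Sum>i\<in>I. measure (N i) A *\<^sub>R c i)"
    and f: "f \<in> borel_measurable borel" "\<And>x. norm (f x) \<le> K"
  shows "vector_integral F f = (\<Sum>i\<in>I. LINT x|N i. f x \<bullet> c i)"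
proof -
  have fb: "(\<lambda>x. f x \<bullet> b) \<in> borel_measurable borel" for b using f(1) by simp
  have fK: "\<bar>f x \<bullet> b\<bar> \<le> K" if "b \<in> Basis" for x b
    using Basis_le_norm[OF that, of "f x"] f(2)[of x] by linarith
  have int: "integrable (N i) (\<lambda>x. f x \<bullet> b)" if "i \<in> I" "b \<in> Basis" for i b
    by (rule bounded_integrable_borel[OF N(2)[OF that(1)] N(1)[OF that(1)] fb fK[OF that(2)]])
  have "vector_integral F f = (\<Sum>b\<in>Basis. \<Sum>i\<in>I. (c i \<bullet> b) * (LINT x|N i. f x \<bullet> b))"
    unfolding vector_integral_def
  proof (rule sum.cong[OF refl])
    fix b :: 'b assume b: "b \<in> Basis"
    show "signed_integral (\<lambda>A. F A \<bullet> b) (\<lambda>x. f x \<bullet> b) = (\<Sum>i\<in>I. (c i \<bullet> b) * (LINT x|N i. f x \<bullet> b))"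
      by (rule signed_integral_combination[OF I N _ fb fK[OF b]])
        (simp_all add: F inner_sum_left mult.commute)
  qed
  also have "\<dots> = (\<Sum>i\<in>I. \<Sum>b\<in>Basis. (c i \<bullet> b) * (LINT x|N i. f x \<bullet> b))" by (rule sum.swap)
  also have "\<dots> = (\<Sum>i\<in>I. LINT x|N i. f x \<bullet> c i)"
  proof (rule sum.cong[OF refl])
    fix i assume i: "i \<in> I"
    have "(LINT x|N i. f x \<bullet> c i) = (LINT x|N i. (\<Sum>b\<in>Basis. (c i \<bullet> b) * (f x \<bullet> b)))"
      by (subst euclidean_inner) (simp add: mult.commute)
    also have "\<dots> = (\<Sum>b\<in>Basis. LINT x|N i. (c i \<bullet> b) * (f x \<bullet> b))"
      using int[OF i] by (intro Bochner_Integration.integral_sum) auto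
    finally show "(\<Sum>b\<in>Basis. (c i \<bullet> b) * (LINT x|N i. f x \<bullet> b)) = (LINT x|N i. f x \<bullet> c i)"
      by simp
  qed
  finally show ?thesis .
qed

section \<open>Hausdorff measure on an edge\<close>

text \<open>
  The index set is embedded into the natural numbers, and the remaining indices get the empty set.
\<close>

lemma hausdorff1_pre_le_countable:
  fixes C :: "'i \<Rightarrow> 'a::metric_space set"
  assumes I: "countable I" and A: "A \<subseteq> (\<Union>i\<in>I. C i)" and "0 \<le> \<delta>"
    and C: "\<And>i. i \<in> I \<Longrightarrow> bounded (C i) \<and> diameter (C i) \<le> \<delta>"
  shows "hausdorff1_pre \<delta> A \<le> (\<integral>\<^sup>+i. ennreal (diameter (C i)) \<partial>count_space I)"
proof -
  define J where "J = to_nat_on I ` I"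
  define g where "g = the_inv_into I (to_nat_on I)"
  have bij: "bij_betw g J I"
    unfolding g_def J_def using inj_on_to_nat_on[OF I] by (intro bij_betw_the_inv_into bij_betw_imageI) auto
  define C' where "C' n = (if n \<in> J then C (g n) else {})" for n
  have gI: "g n \<in> I" if "n \<in> J" for n using bij that by (auto simp: bij_betw_def)
  have "A \<subseteq> (\<Union>n. C' n)"
  proof
    fix x assume "x \<in> A"
    then obtain i where i: "i \<in> I" "x \<in> C i" using A by blast
    then obtain n where "n \<in> J" "g n = i" using bij by (auto simp: bij_betw_def image_iff)
    then show "x \<in> (\<Union>n. C' n)" using i by (auto simp: C'_def intro!: exI[of _ n])
  qed
  moreover have "\<forall>n. bounded (C' n) \<and> diameter (C' n) \<le> \<delta>"
    using C gI \<open>0 \<le> \<delta>\<close> by (auto simp: C'_def)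
  ultimately have "hausdorff1_pre \<delta> A \<le> (\<Sum>n. ennreal (diameter (C' n)))"
    unfolding hausdorff1_pre_def by (intro Inf_lower) auto
  also have "\<dots> = (\<integral>\<^sup>+n. ennreal (diameter (C' n)) \<partial>count_space UNIV)"
    by (simp add: nn_integral_count_space_nat)
  also have "\<dots> = (\<integral>\<^sup>+n. ennreal (diameter (C (g n))) * indicator J n \<partial>count_space UNIV)"
    by (intro nn_integral_cong) (auto simp: C'_def)
  also have "\<dots> = (\<integral>\<^sup>+n. ennreal (diameter (C (g n))) \<partial>count_space J)"
    by (simp add: nn_integral_count_space_indicator)
  also have "\<dots> = (\<integral>\<^sup>+i. ennreal (diameter (C i)) \<partial>count_space I)"
    by (rule nn_integral_bij_count_space[OF bij])
  finally show ?thesis .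
qed

text \<open>
  The preimage of a set of diameter \<open>d\<close> under an isometric curve lies in an interval of length \<open>d\<close>.
\<close>

lemma lebesgue_le_hausdorff1:
  fixes g :: "real \<Rightarrow> 'a::metric_space"
  assumes g: "\<And>s t. dist (g s) (g t) = \<bar>s - t\<bar>" and S: "S \<in> sets borel"
  shows "emeasure lborel S \<le> hausdorff1 (g ` S)"
proof -
  have "emeasure lborel S \<le> hausdorff1_pre 1 (g ` S)"
    unfolding hausdorff1_pre_def
  proof (rule Inf_greatest, clarify)
    fix C :: "nat \<Rightarrow> 'a set" assume C: "g ` S \<subseteq> (\<Union>i. C i)" "\<forall>i. bounded (C i) \<and> diameter (C i) \<le> 1"
    have "\<exists>a b. g -` C i \<subseteq> {a..b} \<and> a \<le> b \<and> b - a \<le> diameter (C i)" for i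
    proof (cases "g -` C i = {}")
      case True
      then show ?thesis using C(2) diameter_ge_0[of "C i"] by (intro exI[of _ 0]) auto
    next
      case False
      define T where "T = g -` C i"
      have d: "\<bar>s - t\<bar> \<le> diameter (C i)" if "s \<in> T" "t \<in> T" for s t
        using diameter_bounded_bound[of "C i" "g s" "g t"] that C(2) g by (auto simp: T_def)
      obtain t0 where t0: "t0 \<in> T" using False by (auto simp: T_def)
      have bb: "bdd_below T" "bdd_above T"
        using d[OF _ t0] by (auto intro!: bdd_belowI[of _ "t0 - diameter (C i)"] bdd_aboveI[of _ "t0 + diameter (C i)"] simp: abs_le_iff algebra_simps)
      have "Sup T \<le> Inf T + diameter (C i)"
      proof (rule cSup_least)
        fix x assume x: "x \<in> T"
        have "x - diameter (C i) \<le> Inf T"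
          using t0 d[OF x] by (intro cInf_greatest) (auto simp: abs_le_iff algebra_simps)
        then show "x \<le> Inf T + diameter (C i)" by simp
      qed (use t0 in auto)
      moreover have "T \<subseteq> {Inf T..Sup T}" using bb by (auto intro: cInf_lower cSup_upper)
      moreover have "Inf T \<le> Sup T" using t0 bb cInf_lower[of t0 T] cSup_upper[of t0 T] by linarith
      ultimately show ?thesis unfolding T_def by (intro exI[of _ "Inf (g -` C i)"] exI[of _ "Sup (g -` C i)"]) auto
    qed
    then obtain a b where ab: "\<And>i. g -` C i \<subseteq> {a i..b i}" "\<And>i. a i \<le> b i" "\<And>i. b i - a i \<le> diameter (C i)" by metis
    have "S \<subseteq> (\<Union>i. {a i..b i})"
    proof
      fix s assume "s \<in> S"
      then obtain i where "g s \<in> C i" using C(1) by blast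
      then show "s \<in> (\<Union>i. {a i..b i})" using ab(1)[of i] by blast
    qed
    then have "emeasure lborel S \<le> emeasure lborel (\<Union>i. {a i..b i})" by (intro emeasure_mono) auto
    also have "\<dots> \<le> (\<Sum>i. emeasure lborel {a i..b i})"
      by (rule emeasure_subadditive_countably) auto
    also have "\<dots> \<le> (\<Sum>i. ennreal (diameter (C i)))"
      using ab by (intro suminf_le) (auto simp: ennreal_leI)
    finally show "emeasure lborel S \<le> (\<Sum>i. ennreal (diameter (C i)))" .
  qed
  also have "\<dots> \<le> hausdorff1 (g ` S)" unfolding hausdorff1_def by (rule SUP_upper) simp
  finally show ?thesis .
qed

text \<open>
  Cover \<open>S\<close> by nonoverlapping intervals of total length at most its measure plus \<open>e\<close>, and cut them along
  the multiples of \<open>\<delta>\<close> to make them short. Interiors are used to compute the total length, since they are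
  disjoint.
\<close>

lemma hausdorff1_le_lebesgue:
  fixes g :: "real \<Rightarrow> 'a::real_normed_vector"
  assumes g: "\<And>s t. dist (g s) (g t) = \<bar>s - t\<bar>" and S: "S \<in> sets borel" "S \<subseteq> {0..L}"
  shows "hausdorff1 (g ` S) \<le> emeasure lborel S"
  unfolding hausdorff1_def
proof (rule SUP_least)
  fix \<delta> :: real assume "\<delta> \<in> {0<..}"
  then have \<delta>: "\<delta> > 0" by simp
  have fS: "S \<in> fmeasurable lborel"
  proof (rule fmeasurableI)
    have "emeasure lborel S \<le> emeasure lborel {0..L}" using S by (intro emeasure_mono) auto
    also have "\<dots> < \<infinity>" by (rule emeasure_compact_finite) simp
    finally show "emeasure lborel S < \<infinity>" .
  qed (use S in simp)
  have lS: "S \<in> lmeasurable"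
    using S bounded_subset[OF bounded_closed_interval S(2)] by (intro bounded_set_imp_lmeasurable) auto
  show "hausdorff1_pre \<delta> (g ` S) \<le> emeasure lborel S"
  proof (rule ennreal_le_epsilon)
    fix e :: real assume e: "e > 0"
    obtain \<D> where D: "countable \<D>"
        "\<And>K. K \<in> \<D> \<Longrightarrow> K \<subseteq> cbox 0 L \<and> K \<noteq> {} \<and> (\<exists>c d. K = cbox c d)"
        "pairwise (\<lambda>A B. interior A \<inter> interior B = {}) \<D>"
        "S \<subseteq> \<Union>\<D>" "\<Union>\<D> \<in> lmeasurable" "measure lebesgue (\<Union>\<D>) \<le> measure lebesgue S + e"
      by (rule measurable_outer_intervals_bounded[OF lS _ e, of 0 L]) (use S in auto)
    define P where "P j = {real j * \<delta>..(real j + 1) * \<delta>}" for j :: nat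
    define I where "I = \<D> \<times> (UNIV :: nat set)"
    define Q where "Q i = fst i \<inter> P (snd i)" for i
    have Qint: "\<exists>a b. Q i = {a..b} \<and> b - a \<le> \<delta>" if "i \<in> I" for i
    proof -
      have "fst i \<in> \<D>" using that by (auto simp: I_def)
      from D(2)[OF this] obtain c d where "fst i = {c..d}" by auto
      then show ?thesis using \<delta> by (intro exI[of _ "max c (real (snd i) * \<delta>)"] exI[of _ "min d ((real (snd i) + 1) * \<delta>)"])
        (auto simp: Q_def P_def algebra_simps)
    qed
    have diam: "bounded (g ` Q i) \<and> diameter (g ` Q i) \<le> \<delta> \<and> ennreal (diameter (g ` Q i)) \<le> emeasure lborel (interior (Q i))"
      if i: "i \<in> I" for i
    proof -
      obtain a b where ab: "Q i = {a..b}" "b - a \<le> \<delta>" using Qint[OF i] by blast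
      show ?thesis
      proof (cases "a \<le> b")
        case False
        then show ?thesis using \<delta> ab by simp
      next
        case True
        have dd: "dist x y \<le> b - a" if "x \<in> g ` Q i" "y \<in> g ` Q i" for x y
          using that ab g by auto
        have "bounded (g ` Q i)" using dd by (auto simp: bounded_two_points)
        moreover have "diameter (g ` Q i) \<le> b - a"
          using dd True by (intro diameter_le) (auto simp: dist_norm)
        ultimately show ?thesis using ab True by (auto simp: ennreal_leI)
      qed
    qed
    have cover: "g ` S \<subseteq> (\<Union>i\<in>I. g ` Q i)"
    proof clarify
      fix s assume s: "s \<in> S"
      then obtain K where K: "K \<in> \<D>" "s \<in> K" using D(4) by blast
      have s0: "s \<ge> 0" using s S by auto
      define j where "j = nat \<lfloor>s / \<delta>\<rfloor>"
      have "real j \<le> s / \<delta>" "s / \<delta> \<le> real j + 1" using s0 \<delta> by (auto simp: j_def)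
      then have "s \<in> P j" using \<delta> by (auto simp: P_def field_simps)
      then have "s \<in> Q (K, j)" using K by (simp add: Q_def)
      then show "g s \<in> (\<Union>i\<in>I. g ` Q i)" using K by (auto simp: I_def intro!: bexI[of _ "(K, j)"])
    qed
    have disj: "disjoint_family_on (\<lambda>i. interior (Q i)) I"
      unfolding disjoint_family_on_def
    proof (intro ballI impI)
      fix i i' assume ii: "i \<in> I" "i' \<in> I" "i \<noteq> i'"
      have sub: "interior (Q i) \<subseteq> interior (fst i)" "interior (Q i) \<subseteq> interior (P (snd i))" for i
        unfolding Q_def by (auto simp: interior_Int)
      show "interior (Q i) \<inter> interior (Q i') = {}"
      proof (cases "fst i = fst i'")
        case False
        moreover have "fst i \<in> \<D>" "fst i' \<in> \<D>" using ii by (auto simp: I_def)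
        ultimately have "interior (fst i) \<inter> interior (fst i') = {}" using D(3) unfolding pairwise_def by blast
        then show ?thesis using sub(1)[of i] sub(1)[of i'] by blast
      next
        case True
        then have ne: "snd i \<noteq> snd i'" using ii(3) by (auto simp: prod_eq_iff)
        have "interior (P j) \<inter> interior (P j') = {}" if "j < j'" for j j'
        proof -
          have "(real j + 1) * \<delta> \<le> real j' * \<delta>" using that \<delta> by (intro mult_right_mono) auto
          then show ?thesis by (auto simp: P_def)
        qed
        then have "interior (P (snd i)) \<inter> interior (P (snd i')) = {}" using ne by (metis Int_commute linorder_neqE_nat)
        then show ?thesis using sub(2)[of i] sub(2)[of i'] by blast
      qed
    qed
    have cI: "countable I" using D(1) by (simp add: I_def)
    have "hausdorff1_pre \<delta> (g ` S) \<le> (\<integral>\<^sup>+i. ennreal (diameter (g ` Q i)) \<partial>count_space I)"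
      using cI cover \<delta> diam by (intro hausdorff1_pre_le_countable) auto
    also have "\<dots> \<le> (\<integral>\<^sup>+i. emeasure lborel (interior (Q i)) \<partial>count_space I)"
      using diam by (intro nn_integral_mono) auto
    also have "\<dots> = emeasure lborel (\<Union>i\<in>I. interior (Q i))"
      by (rule emeasure_UN_countable[symmetric, OF _ cI disj]) auto
    also have "\<dots> = emeasure lebesgue (\<Union>i\<in>I. interior (Q i))"
    proof -
      have "(\<Union>i\<in>I. interior (Q i)) \<in> sets lborel" by (simp add: borel_open open_UN)
      then show ?thesis by simp
    qed
    also have "\<dots> \<le> emeasure lebesgue (\<Union>\<D>)"
    proof (rule emeasure_mono)
      show "(\<Union>i\<in>I. interior (Q i)) \<subseteq> \<Union>\<D>" using interior_subset by (fastforce simp: Q_def I_def)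
      show "\<Union>\<D> \<in> sets lebesgue" using D(5) by (rule fmeasurableD)
    qed
    also have "\<dots> \<le> ennreal (measure lebesgue S + e)"
      using D(5,6) by (simp add: emeasure_eq_measure2 ennreal_leI)
    also have "\<dots> = emeasure lborel S + ennreal e"
      using e fS S(1) by (simp add: emeasure_eq_measure2 ennreal_plus)
    finally show "hausdorff1_pre \<delta> (g ` S) \<le> emeasure lborel S + ennreal e" .
  qed
qed

definition edge_point :: "'a::euclidean_space \<times> 'a \<Rightarrow> real \<Rightarrow> 'a" where
  "edge_point e s = fst e + s *\<^sub>R edge_direction e"

definition edge_measure :: "'a::euclidean_space \<times> 'a \<Rightarrow> 'a measure" where
  "edge_measure e = distr (restrict_space lborel {0..edge_length e}) borel (edge_point e)"

lemma continuous_edge_point: "continuous_on X (edge_point e)"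
  unfolding edge_point_def by (intro continuous_intros)

lemma measurable_edge_point: "edge_point e \<in> borel_measurable (restrict_space lborel X)"
  by (intro measurable_restrict_space1) (simp add: borel_measurable_continuous_onI continuous_edge_point)

lemma edge_measure: "sets (edge_measure e) = sets borel" "finite_measure (edge_measure e)"
proof -
  have "finite_measure (restrict_space lborel {0..edge_length e})"
    using emeasure_compact_finite[of "{0..edge_length e}"]
    by (intro finite_measureI) (simp add: emeasure_restrict_space space_restrict_space)
  then show "finite_measure (edge_measure e)"
    unfolding edge_measure_def by (rule finite_measure.finite_measure_distr) (rule measurable_edge_point)
qed (simp add: edge_measure_def)

lemma hausdorff1_edge:
  assumes "fst e \<noteq> snd e" and A: "A \<in> sets borel"
  shows "hausdorff1 (A \<inter> edge_segment e) = emeasure (edge_measure e) A"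
proof -
  define L where "L = edge_length e"
  have L: "L > 0" using assms(1) by (simp add: L_def edge_length_def)
  have nd: "norm (edge_direction e) = 1" using assms(1) by (simp add: edge_direction_def)
  have iso: "dist (edge_point e s) (edge_point e t) = \<bar>s - t\<bar>" for s t
  proof -
    have "edge_point e s - edge_point e t = (s - t) *\<^sub>R edge_direction e"
      by (simp add: edge_point_def algebra_simps)
    then show ?thesis using nd by (simp add: dist_norm)
  qed
  define S where "S = edge_point e -` A \<inter> {0..L}"
  have "edge_point e \<in> borel_measurable borel" by (simp add: borel_measurable_continuous_onI continuous_edge_point)
  then have Sb: "S \<in> sets borel" using A by (auto simp: S_def measurable_def)
  have seg: "edge_segment e = edge_point e ` {0..L}"
  proof -
    have "edge_point e ` {0..L} = (\<lambda>u. fst e + u *\<^sub>R (snd e - fst e)) ` {0..1}"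
    proof (intro set_eqI iffI)
      fix x assume "x \<in> edge_point e ` {0..L}"
      then obtain s where s: "s \<in> {0..L}" "x = edge_point e s" by blast
      have "x = fst e + (s / L) *\<^sub>R (snd e - fst e)" "s / L \<in> {0..1}"
        using s L by (simp_all add: edge_point_def edge_direction_def L_def edge_length_def divide_inverse[symmetric])
      then show "x \<in> (\<lambda>u. fst e + u *\<^sub>R (snd e - fst e)) ` {0..1}" by blast
    next
      fix x assume "x \<in> (\<lambda>u. fst e + u *\<^sub>R (snd e - fst e)) ` {0..1}"
      then obtain u where "u \<in> {0..1}" "x = fst e + u *\<^sub>R (snd e - fst e)" by blast
      then show "x \<in> edge_point e ` {0..L}" using L
        by (intro image_eqI[of _ _ "u * L"]) (auto simp: edge_point_def edge_direction_def L_def edge_length_def)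
    qed
    moreover have "edge_segment e = (\<lambda>u. fst e + u *\<^sub>R (snd e - fst e)) ` {0..1}"
      by (simp add: edge_segment_def closed_segment_image_interval algebra_simps)
    ultimately show ?thesis by simp
  qed
  have "A \<inter> edge_segment e = edge_point e ` S" unfolding seg S_def by auto
  moreover have "hausdorff1 (edge_point e ` S) = emeasure lborel S"
    using lebesgue_le_hausdorff1[OF iso Sb] hausdorff1_le_lebesgue[OF iso Sb, of L]
    by (intro antisym) (auto simp: S_def)
  moreover have "emeasure (edge_measure e) A = emeasure lborel S"
    unfolding edge_measure_def
    by (subst emeasure_distr[OF measurable_edge_point A])
      (auto simp: emeasure_restrict_space space_restrict_space S_def L_def)
  ultimately show ?thesis by simp
qed

lemma vector_integral_discrete_flux:
  fixes G :: "'a::euclidean_space pair_pre_digraph"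
  assumes "finite (parcs G)" "\<And>e. e \<in> parcs G \<Longrightarrow> fst e \<noteq> snd e"
    and f: "f \<in> borel_measurable borel" "\<And>x. norm (f x) \<le> K"
  shows "vector_integral (discrete_flux G w) f = (\<Sum>e\<in>parcs G. LINT x|edge_measure e. f x \<bullet> (w e *\<^sub>R edge_direction e))"
proof (rule vector_integral_combination[OF assms(1) edge_measure _ f])
  fix A :: "'a set" assume A: "A \<in> sets borel"
  show "discrete_flux G w A = (\<Sum>e\<in>parcs G. measure (edge_measure e) A *\<^sub>R (w e *\<^sub>R edge_direction e))"
    unfolding discrete_flux_def using assms(2) A
    by (intro sum.cong) (simp_all add: hausdorff1_edge measure_def mult.commute)
qed

lemma integral_edge_measure:
  fixes f :: "'a::euclidean_space \<Rightarrow> real"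
  assumes "continuous_on UNIV f"
  shows "(LINT x|edge_measure e. f x) = integral {0..edge_length e} (\<lambda>s. f (edge_point e s))"
proof -
  have cont: "continuous_on {0..edge_length e} (\<lambda>s. f (edge_point e s))"
    by (rule continuous_on_compose2[OF assms continuous_edge_point]) auto
  have "(LINT x|edge_measure e. f x) = (LINT s|restrict_space lborel {0..edge_length e}. f (edge_point e s))"
    unfolding edge_measure_def
    by (rule integral_distr[OF measurable_edge_point borel_measurable_continuous_onI[OF assms]])
  also have "\<dots> = (LINT s:{0..edge_length e}|lborel. f (edge_point e s))"
    by (simp add: integral_restrict_space set_lebesgue_integral_def)
  also have "\<dots> = integral {0..edge_length e} (\<lambda>s. f (edge_point e s))"
    using borel_integrable_atLeastAtMost'[OF cont] by (rule set_borel_integral_eq_integral(2))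
  finally show ?thesis .
qed

section \<open>Kirchhoff's law for transport paths\<close>

lemma Ck_const: "Ck k (\<lambda>x. c)"
proof (induction k arbitrary: c)
  case (Suc k)
  have "\<forall>x. GDERIV (\<lambda>x. c) x :> 0" by (simp add: GDERIV_const)
  then show ?case using Suc[of 0] by (auto intro!: exI[of _ "\<lambda>_. 0"])
qed simp

lemma Ck_SucE:
  assumes "Ck (Suc k) f"
  obtains D where "\<And>x. GDERIV f x :> D x" "\<And>b. b \<in> Basis \<Longrightarrow> Ck k (\<lambda>x. D x \<bullet> b)"
  using assms by auto

lemma Ck_SucI:
  assumes "\<And>x. GDERIV f x :> D x" "\<And>b. b \<in> Basis \<Longrightarrow> Ck k (\<lambda>x. D x \<bullet> b)"
  shows "Ck (Suc k) f"
  using assms by auto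

lemma Ck_Suc_imp: "Ck (Suc k) f \<Longrightarrow> Ck k f"
proof (induction k arbitrary: f)
  case 0
  then obtain D where "\<And>x. GDERIV f x :> D x" by auto
  then have "isCont f x" for x by (meson gderiv_def has_derivative_continuous)
  then show ?case by (simp add: continuous_on_eq_continuous_at)
next
  case (Suc k)
  from Suc.prems show ?case by (rule Ck_SucE) (rule Ck_SucI, assumption, rule Suc.IH)
qed

lemma Ck_add: "Ck k f \<Longrightarrow> Ck k g \<Longrightarrow> Ck k (\<lambda>x. f x + g x)"
proof (induction k arbitrary: f g)
  case 0
  then show ?case by (auto intro: continuous_intros)
next
  case (Suc k)
  obtain Df where f': "(\<forall>x. GDERIV f x :> Df x) \<and> (\<forall>b\<in>Basis. Ck k (\<lambda>x. Df x \<bullet> b))"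
    using Suc.prems(1) unfolding Ck.simps by blast
  then have f: "\<And>x. GDERIV f x :> Df x" "\<And>b. b \<in> Basis \<Longrightarrow> Ck k (\<lambda>x. Df x \<bullet> b)" by auto
  obtain Dg where g': "(\<forall>x. GDERIV g x :> Dg x) \<and> (\<forall>b\<in>Basis. Ck k (\<lambda>x. Dg x \<bullet> b))"
    using Suc.prems(2) unfolding Ck.simps by blast
  then have g: "\<And>x. GDERIV g x :> Dg x" "\<And>b. b \<in> Basis \<Longrightarrow> Ck k (\<lambda>x. Dg x \<bullet> b)" by auto
  show ?case
    by (rule Ck_SucI[OF GDERIV_add[OF f(1) g(1)]]) (simp only: inner_add_left Suc.IH f(2) g(2))
qed

lemma Ck_mult: "Ck k f \<Longrightarrow> Ck k g \<Longrightarrow> Ck k (\<lambda>x. f x * g x)"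
proof (induction k arbitrary: f g)
  case 0
  then show ?case by (auto intro: continuous_intros)
next
  case (Suc k)
  have fg: "Ck k f" "Ck k g" using Suc.prems by (auto intro: Ck_Suc_imp simp del: Ck.simps)
  obtain Df where f': "(\<forall>x. GDERIV f x :> Df x) \<and> (\<forall>b\<in>Basis. Ck k (\<lambda>x. Df x \<bullet> b))"
    using Suc.prems(1) unfolding Ck.simps by blast
  then have f: "\<And>x. GDERIV f x :> Df x" "\<And>b. b \<in> Basis \<Longrightarrow> Ck k (\<lambda>x. Df x \<bullet> b)" by auto
  obtain Dg where g': "(\<forall>x. GDERIV g x :> Dg x) \<and> (\<forall>b\<in>Basis. Ck k (\<lambda>x. Dg x \<bullet> b))"
    using Suc.prems(2) unfolding Ck.simps by blast
  then have g: "\<And>x. GDERIV g x :> Dg x" "\<And>b. b \<in> Basis \<Longrightarrow> Ck k (\<lambda>x. Dg x \<bullet> b)" by auto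
  show ?case
    by (rule Ck_SucI[OF GDERIV_mult[OF f(1) g(1)]])
      (simp only: inner_add_left inner_scaleR_left Ck_add Suc.IH fg f(2) g(2))
qed

lemma Ck_affine: "Ck k (\<lambda>x. c * ((x - p) \<bullet> b))" for p b :: "'a::euclidean_space"
proof (cases k)
  case 0
  then show ?thesis by (auto intro!: continuous_intros)
next
  case (Suc k')
  have "GDERIV (\<lambda>x. c * ((x - p) \<bullet> b)) x :> c *\<^sub>R b" for x
    unfolding gderiv_def by (auto intro!: derivative_eq_intros simp: inner_commute)
  then show ?thesis using Suc Ck_const by (auto intro!: exI[of _ "\<lambda>_. c *\<^sub>R b"])
qed

text \<open>
  For \<open>m = 0\<close> the standard smooth function that vanishes exactly on the nonpositive half-line; the other
  values of \<open>m\<close> are the functions that span its derivatives.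
\<close>

definition flat_exp :: "nat \<Rightarrow> real \<Rightarrow> real" where
  "flat_exp m t = (if t > 0 then inverse t ^ m * exp (- inverse t) else 0)"

lemma flat_exp_deriv: "(flat_exp m has_real_derivative (flat_exp (m + 2) t - real m * flat_exp (m + 1) t)) (at t)"
proof -
  consider "t > 0" | "t < 0" | "t = 0" by linarith
  then show ?thesis
  proof cases
    case 1
    have "((\<lambda>t. inverse t ^ m * exp (- inverse t)) has_real_derivative (flat_exp (m + 2) t - real m * flat_exp (m + 1) t)) (at t)"
    proof (cases m)
      case 0
      then show ?thesis using 1
        by (auto intro!: derivative_eq_intros simp: flat_exp_def power2_eq_square)
    next
      case (Suc n)
      show ?thesis using 1 unfolding Suc
        by (auto intro!: derivative_eq_intros simp: flat_exp_def power2_eq_square algebra_simps) (cases n; simp)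
    qed
    then show ?thesis
      by (rule DERIV_cong_ev[THEN iffD1, rotated -1, OF _ refl _ refl])
        (use 1 eventually_nhds_in_open[of "{0<..}" t] in \<open>auto elim!: eventually_mono simp: flat_exp_def\<close>)
  next
    case 2
    have "((\<lambda>_. 0) has_real_derivative (flat_exp (m + 2) t - real m * flat_exp (m + 1) t)) (at t)"
      using 2 by (simp add: flat_exp_def)
    then show ?thesis
      by (rule DERIV_cong_ev[THEN iffD1, rotated -1, OF _ refl _ refl])
        (use 2 eventually_nhds_in_open[of "{..<0}" t] in \<open>auto elim!: eventually_mono simp: flat_exp_def\<close>)
  next
    case 3
    have R: "((\<lambda>h. flat_exp m h / h) \<longlongrightarrow> 0) (at_right 0)"
    proof -
      have "((\<lambda>h::real. inverse h ^ (m + 1) / exp (inverse h)) \<longlongrightarrow> 0) (at_right 0)"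
        by (rule filterlim_compose[OF tendsto_power_div_exp_0 filterlim_inverse_at_top_right])
      moreover have "\<forall>\<^sub>F h in at_right 0. inverse h ^ (m + 1) / exp (inverse h) = flat_exp m h / h"
        using eventually_at_right_less[of "0::real"]
        by eventually_elim (simp add: flat_exp_def exp_minus field_simps)
      ultimately show ?thesis by (rule Lim_transform_eventually)
    qed
    have L: "((\<lambda>h. flat_exp m h / h) \<longlongrightarrow> 0) (at_left 0)"
    proof (rule Lim_transform_eventually[OF tendsto_const])
      show "\<forall>\<^sub>F h in at_left 0. 0 = flat_exp m h / h"
        by (rule eventually_mono[OF eventually_at_left_real[of "-1"]]) (auto simp: flat_exp_def)
    qed
    have "((\<lambda>h. (flat_exp m (0 + h) - flat_exp m 0) / h) \<longlongrightarrow> 0) (at 0)"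
      using R L by (simp add: flat_exp_def[of _ 0] filterlim_at_split)
    then show ?thesis using 3 by (simp add: DERIV_def flat_exp_def)
  qed
qed

definition bump :: "'a::euclidean_space \<Rightarrow> real \<Rightarrow> 'a \<Rightarrow> real" where
  "bump p r x = flat_exp 0 (r\<^sup>2 - (x - p) \<bullet> (x - p))"

text \<open>
  The statement for all \<open>m\<close> together is stable under differentiation.
\<close>

lemma Ck_flat_quadratic: "Ck k (\<lambda>x. flat_exp m (r - (x - p) \<bullet> (x - p)))" for p :: "'a::euclidean_space"
proof (induction k arbitrary: m)
  have G: "GDERIV (\<lambda>x. r - (x - p) \<bullet> (x - p)) x :> (-2) *\<^sub>R (x - p)" for x
    unfolding gderiv_def by (auto intro!: derivative_eq_intros simp: inner_commute algebra_simps)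
  have GD: "GDERIV (\<lambda>x. flat_exp m (r - (x - p) \<bullet> (x - p))) x :>
      (flat_exp (m + 2) (r - (x - p) \<bullet> (x - p)) - real m * flat_exp (m + 1) (r - (x - p) \<bullet> (x - p))) *\<^sub>R ((-2) *\<^sub>R (x - p))" for x m
    by (rule GDERIV_DERIV_compose[OF G flat_exp_deriv])
  {
    case 0
    have "isCont (\<lambda>x. flat_exp m (r - (x - p) \<bullet> (x - p))) x" for x
      using GD by (meson gderiv_def has_derivative_continuous)
    then show ?case by (simp add: continuous_on_eq_continuous_at)
  next
    case (Suc k)
    have "Ck k (\<lambda>x. (flat_exp (m + 2) (r - (x - p) \<bullet> (x - p)) + (- real m) * flat_exp (m + 1) (r - (x - p) \<bullet> (x - p)))
        * ((-2) * ((x - p) \<bullet> b)))" for b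
      by (intro Ck_mult Ck_add Ck_const Suc.IH Ck_affine)
    moreover have "(\<lambda>x. ((flat_exp (m + 2) (r - (x - p) \<bullet> (x - p)) - real m * flat_exp (m + 1) (r - (x - p) \<bullet> (x - p))) *\<^sub>R ((-2) *\<^sub>R (x - p))) \<bullet> b)
      = (\<lambda>x. (flat_exp (m + 2) (r - (x - p) \<bullet> (x - p)) + (- real m) * flat_exp (m + 1) (r - (x - p) \<bullet> (x - p)))
        * ((-2) * ((x - p) \<bullet> b)))" for b
      by (simp only: inner_scaleR_left diff_conv_add_uminus mult_minus_left)
    ultimately show ?case by (intro Ck_SucI[OF GD[of m]]) (simp only:)
  }
qed

lemma test_function_bump: "r > 0 \<Longrightarrow> test_function (bump p r)"
proof -
  assume r: "r > 0"
  have "bump p r x = 0" if "x \<notin> cball p r" for x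
  proof -
    have "r \<le> norm (x - p)" using that by (simp add: dist_norm norm_minus_commute)
    then have "r\<^sup>2 \<le> (norm (x - p))\<^sup>2" using r by (intro power_mono) auto
    then show ?thesis by (simp add: bump_def flat_exp_def power2_norm_eq_inner)
  qed
  then have "{x. bump p r x \<noteq> 0} \<subseteq> cball p r" by blast
  then have "compact (closure {x. bump p r x \<noteq> 0})"
    by (meson bounded_cball bounded_subset compact_closure)
  then show ?thesis unfolding test_function_def bump_def using Ck_flat_quadratic by blast
qed

lemma bump_center: "r > 0 \<Longrightarrow> bump p r p > 0"
  by (simp add: bump_def flat_exp_def)

lemma bump_outside: "r > 0 \<Longrightarrow> dist x p \<ge> r \<Longrightarrow> bump p r x = 0"
  using power_mono[of r "norm (x - p)" 2] by (simp add: bump_def flat_exp_def power2_norm_eq_inner dist_norm)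

lemma GDERIV_unique:
  assumes "GDERIV f x :> D" "GDERIV f x :> D'"
  shows "D = D'"
proof -
  have "(\<lambda>h. h \<bullet> D) = (\<lambda>h. h \<bullet> D')"
    using assms unfolding gderiv_def by (rule has_derivative_unique)
  then have "\<forall>h. h \<bullet> D = h \<bullet> D'" by (simp add: fun_eq_iff)
  then show ?thesis by (simp add: inner_commute vector_eq_ldot)
qed

text \<open>
  The gradient vanishes outside the support of \<open>f\<close> and is continuous, hence bounded.
\<close>

lemma test_function_gradient:
  assumes f: "test_function f" and D: "\<And>x. GDERIV f x :> D x"
  shows "continuous_on UNIV D" "\<exists>K. \<forall>x. norm (D x) \<le> K"
proof -
  have "Ck (Suc 0) f" using f by (simp add: test_function_def)
  then obtain D' where D': "\<And>x. GDERIV f x :> D' x" "\<And>b. b \<in> Basis \<Longrightarrow> continuous_on UNIV (\<lambda>x. D' x \<bullet> b)" by auto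
  have "D = D'" using GDERIV_unique[OF D D'(1)] by blast
  then have "continuous_on UNIV (\<lambda>x. \<Sum>b\<in>Basis. (D x \<bullet> b) *\<^sub>R b)"
    by (intro continuous_on_sum continuous_on_scaleR continuous_on_const) (simp add: D'(2))
  then show cont: "continuous_on UNIV D" by (simp add: euclidean_representation)
  define S where "S = closure {x. f x \<noteq> 0}"
  have S: "compact S" using f by (simp add: test_function_def S_def)
  have zero: "D x = 0" if "x \<notin> S" for x
  proof (rule GDERIV_unique[OF D])
    have op: "open (- S)" using compact_imp_closed[OF S] by (rule open_Compl)
    have f0: "0 = f y" if "y \<in> - S" for y
      using that closure_subset[of "{x. f x \<noteq> 0}"] by (auto simp: S_def)
    have der: "((\<lambda>_. 0) has_derivative (\<lambda>h. h \<bullet> 0)) (at x)" by simp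
    have x: "x \<in> - S" using that by simp
    show "GDERIV f x :> 0"
      unfolding gderiv_def by (rule has_derivative_transform_within_open[OF der op x f0])
  qed
  have "bounded (D ` S)" using compact_continuous_image[OF continuous_on_subset[OF cont] S] by (simp add: compact_imp_bounded)
  then obtain K where K: "\<And>x. x \<in> S \<Longrightarrow> norm (D x) \<le> K" by (auto simp: bounded_iff)
  have "norm (D x) \<le> max K 0" for x using zero[of x] K[of x] by (cases "x \<in> S") (auto simp: le_max_iff_disj)
  then show "\<exists>K. \<forall>x. norm (D x) \<le> K" by blast
qed

text \<open>
  The fundamental theorem of calculus on each edge.
\<close>

lemma vector_integral_gradient:
  fixes G :: "'a::euclidean_space pair_pre_digraph"
  assumes G: "finite (parcs G)" "\<And>e. e \<in> parcs G \<Longrightarrow> fst e \<noteq> snd e"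
    and f: "test_function f" and D: "\<And>x. GDERIV f x :> D x"
  shows "vector_integral (discrete_flux G w) D = flow_gain (parcs G) w f"
proof -
  note cont = test_function_gradient(1)[OF f D]
  obtain K where K: "\<And>x. norm (D x) \<le> K" using test_function_gradient(2)[OF f D] by blast
  have "vector_integral (discrete_flux G w) D = (\<Sum>e\<in>parcs G. LINT x|edge_measure e. D x \<bullet> (w e *\<^sub>R edge_direction e))"
    by (rule vector_integral_discrete_flux[OF G _ K]) (auto intro: borel_measurable_continuous_onI cont)
  also have "\<dots> = flow_gain (parcs G) w f"
  proof (rule sum.cong[OF refl])
    fix e assume e: "e \<in> parcs G"
    define L where "L = edge_length e"
    have L: "L > 0" using G(2)[OF e] by (simp add: L_def edge_length_def)
    have "((\<lambda>s. D (edge_point e s) \<bullet> edge_direction e) has_integral f (edge_point e L) - f (edge_point e 0)) {0..L}"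
    proof (rule fundamental_theorem_of_calculus)
      fix s assume "s \<in> {0..L}"
      have "(edge_point e has_derivative (\<lambda>h. h *\<^sub>R edge_direction e)) (at s within {0..L})"
        unfolding edge_point_def by (auto intro!: derivative_eq_intros)
      moreover have "(f has_derivative (\<lambda>h. h \<bullet> D (edge_point e s))) (at (edge_point e s))"
        using D by (simp add: gderiv_def)
      ultimately have "((\<lambda>s. f (edge_point e s)) has_derivative (\<lambda>h. (h *\<^sub>R edge_direction e) \<bullet> D (edge_point e s))) (at s within {0..L})"
        by (rule has_derivative_compose)
      then show "((\<lambda>s. f (edge_point e s)) has_vector_derivative D (edge_point e s) \<bullet> edge_direction e) (at s within {0..L})"
        by (simp add: has_vector_derivative_def inner_commute)
    qed (use L in simp)
    then have int: "integral {0..L} (\<lambda>s. D (edge_point e s) \<bullet> edge_direction e) = f (edge_point e L) - f (edge_point e 0)"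
      by (rule integral_unique)
    have "edge_point e L = snd e" "edge_point e 0 = fst e"
      using L by (auto simp: edge_point_def edge_direction_def L_def edge_length_def)
    moreover have "(LINT x|edge_measure e. D x \<bullet> (w e *\<^sub>R edge_direction e)) = integral {0..L} (\<lambda>s. w e * (D (edge_point e s) \<bullet> edge_direction e))"
      unfolding L_def by (subst integral_edge_measure) (auto intro!: continuous_intros cont)
    ultimately show "(LINT x|edge_measure e. D x \<bullet> (w e *\<^sub>R edge_direction e)) = w e * (f (snd e) - f (fst e))"
      using int by simp
  qed
  finally show ?thesis .
qed

lemma C0I:
  fixes f :: "'a::euclidean_space \<Rightarrow> 'b::euclidean_space"
  assumes "continuous_on UNIV f" "\<And>x. norm x \<ge> R \<Longrightarrow> f x = 0"
  shows "f \<in> C0"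
proof -
  have "\<forall>\<^sub>F x in at_infinity. f x = 0" using assms(2) by (auto simp: eventually_at_infinity)
  then have "(f \<longlongrightarrow> 0) at_infinity" by (rule tendsto_eventually)
  then show ?thesis using assms(1) by (simp add: C0_def)
qed

lemma C0_bounded:
  fixes f :: "'a::euclidean_space \<Rightarrow> 'b::euclidean_space"
  assumes "f \<in> C0"
  shows "\<exists>K. \<forall>x. norm (f x) \<le> K"
proof -
  have "(f \<longlongrightarrow> 0) at_infinity" using assms by (simp add: C0_def)
  then have "\<forall>\<^sub>F x in at_infinity. dist (f x) 0 < 1" by (rule tendstoD) simp
  then obtain R where R: "\<And>x. R \<le> norm x \<Longrightarrow> norm (f x) < 1" by (auto simp: eventually_at_infinity)
  have "bounded (f ` cball 0 R)"
    using assms by (intro compact_imp_bounded compact_continuous_image) (auto simp: C0_def intro: continuous_on_subset)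
  then obtain K where "\<forall>x\<in>cball 0 R. norm (f x) \<le> K" by (auto simp: bounded_iff)
  then have K: "norm (f x) \<le> K" if "norm x \<le> R" for x using that by simp
  have "norm (f x) \<le> max 1 K" for x using R[of x] K[of x] by (cases "R \<le> norm x") auto
  then show ?thesis by blast
qed

lemma C0_borel: "f \<in> C0 \<Longrightarrow> f \<in> borel_measurable borel"
  by (auto simp: C0_def intro: borel_measurable_continuous_onI)

lemma test_function_C0:
  fixes f :: "'a::euclidean_space \<Rightarrow> real"
  assumes "test_function f"
  shows "f \<in> C0"
proof -
  have c: "continuous_on UNIV f" using assms by (simp add: test_function_def) (metis Ck.simps(1))
  have "bounded (closure {x. f x \<noteq> 0})" using assms by (simp add: test_function_def compact_imp_bounded)
  then obtain R where R: "\<And>x. x \<in> closure {x. f x \<noteq> 0} \<Longrightarrow> norm x \<le> R" by (auto simp: bounded_iff)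
  show ?thesis
  proof (rule C0I[OF c, of "R + 1"])
    fix x :: 'a assume "R + 1 \<le> norm x"
    then show "f x = 0" using R[of x] closure_subset[of "{x. f x \<noteq> 0}"] by force
  qed
qed

text \<open>
  The masses \<open>a i\<close> of coinciding atoms are added up.
\<close>

lemma discrete_measure_integral:
  fixes \<mu> :: "'a::euclidean_space measure"
  assumes "discrete_measure \<mu>"
  obtains S and \<alpha> :: "'a \<Rightarrow> real" where "finite S" "\<And>v. \<alpha> v \<ge> 0" "\<And>v. v \<notin> S \<Longrightarrow> \<alpha> v = 0"
    "\<And>f. f \<in> C0 \<Longrightarrow> (LINT x|\<mu>. f x) = (\<Sum>v\<in>S. \<alpha> v * f v)"
proof -
  from assms obtain k :: nat and a :: "nat \<Rightarrow> real" and x :: "nat \<Rightarrow> 'a" where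
    sets: "sets \<mu> = sets borel" and a: "\<And>i. i \<in> {1..k} \<Longrightarrow> a i > 0"
    and em: "\<And>A. A \<in> sets borel \<Longrightarrow> emeasure \<mu> A = (\<Sum>i\<in>{1..k}. ennreal (a i) * emeasure (return borel (x i)) A)"
    unfolding discrete_measure_def by blast
  have finret: "finite_measure (return borel y)" for y :: 'a
    by (rule finite_measureI) simp
  have fin: "finite_measure \<mu>"
  proof (rule finite_measureI)
    have "space \<mu> = UNIV" using sets_eq_imp_space_eq[OF sets] by simp
    then show "emeasure \<mu> (space \<mu>) \<noteq> \<infinity>" using em[of UNIV] by simp
  qed
  define \<alpha> where "\<alpha> v = (\<Sum>i\<in>{i\<in>{1..k}. x i = v}. a i)" for v
  show ?thesis
  proof (rule that[of "x ` {1..k}" \<alpha>])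
    show "\<alpha> v \<ge> 0" for v unfolding \<alpha>_def using a by (intro sum_nonneg) (auto intro: less_imp_le)
    show "\<alpha> v = 0" if "v \<notin> x ` {1..k}" for v
    proof -
      have "{i\<in>{1..k}. x i = v} = {}" using that by auto
      then show ?thesis by (simp only: \<alpha>_def sum.empty)
    qed
    fix f :: "'a \<Rightarrow> real" assume C0: "f \<in> C0"
    obtain K where "\<And>x. norm (f x) \<le> K" using C0_bounded[OF C0] by blast
    then have f: "f \<in> borel_measurable borel" "\<bar>f x\<bar> \<le> K" for x using C0_borel[OF C0] by auto
    have "(LINT y|\<mu>. f y) = (\<Sum>i\<in>{1..k}. a i * (LINT y|return borel (x i). f y))"
      by (rule integral_finite_combination[OF _ sets _ fin finret _ em f]) (use a in \<open>auto intro: less_imp_le\<close>)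
    also have "\<dots> = (\<Sum>i\<in>{1..k}. a i * f (x i))"
      using f(1) by (intro sum.cong) (simp_all add: integral_return)
    also have "\<dots> = (\<Sum>v\<in>x ` {1..k}. \<Sum>i\<in>{i\<in>{1..k}. x i = v}. a i * f (x i))"
      by (rule sum.image_gen) simp
    also have "\<dots> = (\<Sum>v\<in>x ` {1..k}. \<alpha> v * f v)"
      unfolding \<alpha>_def sum_distrib_right by (intro sum.cong) auto
    finally show "(LINT y|\<mu>. f y) = (\<Sum>v\<in>x ` {1..k}. \<alpha> v * f v)" .
  qed simp
qed

text \<open>
  On the finite set \<open>V\<close>, multiples of sufficiently narrow bumps coincide with the indicators of points, and
  these span all functions on \<open>V\<close>.
\<close>

lemma balancedI_bump:
  fixes E :: "('a::euclidean_space \<times> 'a) set"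
  assumes fin: "finite E" "finite V" and ends: "fst ` E \<subseteq> V" "snd ` E \<subseteq> V"
    and bump: "\<And>p r. r > 0 \<Longrightarrow> flow_gain E w (bump p r) = (\<Sum>v\<in>V. (\<beta> v - \<alpha> v) * bump p r v)"
  shows "balanced E w V \<alpha> \<beta>"
proof -
  define I where "I p = (\<lambda>v::'a. if v = p then 1 else 0 :: real)" for p
  have single: "flow_gain E w (I p) = (\<Sum>v\<in>V. (\<beta> v - \<alpha> v) * I p v)" if p: "p \<in> V" for p
  proof -
    obtain r where r: "r > 0" "\<And>v. v \<in> V \<Longrightarrow> v \<noteq> p \<Longrightarrow> r \<le> dist p v"
      using finite_set_avoid[OF fin(2), of p] by blast
    define c where "c = bump p r p"
    have c: "c > 0" using bump_center[OF r(1)] by (simp add: c_def)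
    have eq: "bump p r v = c * I p v" if "v \<in> V" for v
      using bump_outside[OF r(1), of v p] r(2)[OF that] by (auto simp: I_def c_def dist_commute)
    have "c * flow_gain E w (I p) = flow_gain E w (bump p r)"
    proof -
      have "fst e \<in> V" "snd e \<in> V" if "e \<in> E" for e using ends that by auto
      then show ?thesis unfolding sum_distrib_left by (intro sum.cong) (simp_all add: eq algebra_simps)
    qed
    also have "\<dots> = (\<Sum>v\<in>V. (\<beta> v - \<alpha> v) * bump p r v)" by (rule bump[OF r(1)])
    also have "\<dots> = c * (\<Sum>v\<in>V. (\<beta> v - \<alpha> v) * I p v)"
      unfolding sum_distrib_left by (intro sum.cong) (simp_all add: eq)
    finally show ?thesis using c by simp
  qed
  show ?thesis unfolding balanced_def
  proof
    fix f :: "'a \<Rightarrow> real"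
    have f: "f v = (\<Sum>p\<in>V. f p * I p v)" if "v \<in> V" for v
      using fin(2) that by (simp add: I_def if_distrib[of "(*) _"] cong: if_cong)
    have "flow_gain E w f = (\<Sum>e\<in>E. \<Sum>p\<in>V. f p * (w e * (I p (snd e) - I p (fst e))))"
    proof (rule sum.cong[OF refl])
      fix e assume "e \<in> E"
      then have "fst e \<in> V" "snd e \<in> V" using ends by auto
      from f[OF this(1)] f[OF this(2)]
      have "f (snd e) - f (fst e) = (\<Sum>p\<in>V. f p * (I p (snd e) - I p (fst e)))"
        by (simp add: sum_subtractf right_diff_distrib)
      then show "w e * (f (snd e) - f (fst e)) = (\<Sum>p\<in>V. f p * (w e * (I p (snd e) - I p (fst e))))"
        by (simp add: sum_distrib_left mult.left_commute)
    qed
    also have "\<dots> = (\<Sum>p\<in>V. f p * flow_gain E w (I p))"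
      by (subst sum.swap) (simp add: sum_distrib_left)
    also have "\<dots> = (\<Sum>p\<in>V. f p * (\<Sum>v\<in>V. (\<beta> v - \<alpha> v) * I p v))" by (simp add: single)
    also have "\<dots> = (\<Sum>p\<in>V. (\<beta> p - \<alpha> p) * f p)"
      using fin(2) by (intro sum.cong) (simp_all add: I_def if_distrib[of "(*) _"] cong: if_cong)
    finally show "flow_gain E w f = (\<Sum>v\<in>V. (\<beta> v - \<alpha> v) * f v)" .
  qed
qed

text \<open>
  The divergence condition for smooth bumps is Kirchhoff's law at the vertices, in which arbitrary test
  functions are admitted.
\<close>

lemma transport_path_balanced:
  fixes \<mu>p :: "'a::euclidean_space measure"
  assumes "transport_path \<mu>p \<mu>m G w"
  obtains V \<alpha> \<beta> where "finite V" "\<And>v. \<alpha> v \<ge> 0" "\<And>v. \<beta> v \<ge> 0" "balanced (parcs G) w V \<alpha> \<beta>"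
    "\<And>f. f \<in> C0 \<Longrightarrow> (LINT x|\<mu>p. f x) = (\<Sum>v\<in>V. \<alpha> v * f v)"
    "\<And>f. f \<in> C0 \<Longrightarrow> (LINT x|\<mu>m. f x) = (\<Sum>v\<in>V. \<beta> v * f v)"
proof -
  have G: "pair_digraph G" and disc: "discrete_measure \<mu>p" "discrete_measure \<mu>m"
    and dv: "has_divergence (discrete_flux G w) \<mu>p \<mu>m"
    using assms by (auto simp: transport_path_def)
  have finE: "finite (parcs G)" and loop: "\<And>e. e \<in> parcs G \<Longrightarrow> fst e \<noteq> snd e"
    using pair_fin_digraph.pair_finite_arcs[OF pair_digraph.axioms(1)[OF G]]
      pair_loopfree_digraph.pair_no_loops[OF pair_digraph.axioms(2)[OF G]] by auto
  obtain S \<alpha> where S: "finite S" "\<And>v. \<alpha> v \<ge> (0::real)" "\<And>v. v \<notin> S \<Longrightarrow> \<alpha> v = 0"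
    "\<And>f. f \<in> C0 \<Longrightarrow> (LINT x|\<mu>p. f x) = (\<Sum>v\<in>S. \<alpha> v * f v)"
    by (rule discrete_measure_integral[OF disc(1)]) blast
  obtain S' \<beta> where S': "finite S'" "\<And>v. \<beta> v \<ge> (0::real)" "\<And>v. v \<notin> S' \<Longrightarrow> \<beta> v = 0"
    "\<And>f. f \<in> C0 \<Longrightarrow> (LINT x|\<mu>m. f x) = (\<Sum>v\<in>S'. \<beta> v * f v)"
    by (rule discrete_measure_integral[OF disc(2)]) blast
  define V where "V = S \<union> S' \<union> fst ` parcs G \<union> snd ` parcs G"
  have finV: "finite V" using S S' finE by (simp add: V_def)
  have sumS: "(\<Sum>v\<in>S. \<alpha> v * f v) = (\<Sum>v\<in>V. \<alpha> v * f v)" for f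
    using finV S(3) by (intro sum.mono_neutral_left) (auto simp: V_def)
  have sumS': "(\<Sum>v\<in>S'. \<beta> v * f v) = (\<Sum>v\<in>V. \<beta> v * f v)" for f
    using finV S'(3) by (intro sum.mono_neutral_left) (auto simp: V_def)
  show ?thesis
  proof (rule that[OF finV S(2) S'(2)])
    show "(LINT x|\<mu>p. f x) = (\<Sum>v\<in>V. \<alpha> v * f v)" if "f \<in> C0" for f
      using S(4)[OF that] sumS by simp
    show "(LINT x|\<mu>m. f x) = (\<Sum>v\<in>V. \<beta> v * f v)" if "f \<in> C0" for f
      using S'(4)[OF that] sumS' by simp
    show "balanced (parcs G) w V \<alpha> \<beta>"
    proof (rule balancedI_bump[OF finE finV])
      show "fst ` parcs G \<subseteq> V" "snd ` parcs G \<subseteq> V" by (auto simp: V_def)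
      fix p :: 'a and r :: real assume r: "r > 0"
      define f where "f = bump p r"
      have tf: "test_function f" unfolding f_def by (rule test_function_bump[OF r])
      then have "Ck (Suc 0) f" by (simp add: test_function_def)
      then obtain D where D: "\<forall>x. GDERIV f x :> D x" by auto
      then have D': "GDERIV f x :> D x" for x by blast
      have "- vector_integral (discrete_flux G w) D = (LINT x|\<mu>p. f x) - (LINT x|\<mu>m. f x)"
        using dv tf D unfolding has_divergence_def by blast
      then have "flow_gain (parcs G) w f = (\<Sum>v\<in>V. \<beta> v * f v) - (\<Sum>v\<in>V. \<alpha> v * f v)"
        using vector_integral_gradient[OF finE loop tf D', of w] S(4)[OF test_function_C0[OF tf]] S'(4)[OF test_function_C0[OF tf]] sumS sumS' by simp
      then show "flow_gain (parcs G) w (bump p r) = (\<Sum>v\<in>V. (\<beta> v - \<alpha> v) * bump p r v)"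
        by (simp add: f_def sum_subtractf left_diff_distrib)
    qed
  qed
qed

section \<open>Lower bound for the relaxed costs\<close>

lemma vector2_eq: "vector [s, h] = s *\<^sub>R axis 1 1 + h *\<^sub>R (axis 2 1 :: real^2)"
  by (simp add: vec_eq_iff forall_2 axis_def)

lemma continuous_vector2: "continuous_on X (\<lambda>s. vector [s, h] :: real^2)"
  unfolding vector2_eq by (intro continuous_intros)

lemma segment_measure_integral:
  fixes f :: "real^2 \<Rightarrow> real"
  assumes "continuous_on UNIV f"
  shows "integrable lborel (\<lambda>s. indicat_real {0..l} s * f (vector [s, h]))"
    and "(LINT x|segment_measure l h. f x) = (LINT s|lborel. indicat_real {0..l} s * f (vector [s, h]))"
proof -
  have cont: "continuous_on {0..l} (\<lambda>s. f (vector [s, h]))"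
    by (rule continuous_on_compose2[OF assms continuous_vector2]) auto
  show "integrable lborel (\<lambda>s. indicat_real {0..l} s * f (vector [s, h]))"
    using borel_integrable_atLeastAtMost'[OF cont] by (simp add: set_integrable_def)
  have "(\<lambda>s. vector [s, h] :: real^2) \<in> borel_measurable (restrict_space lborel {0..l})"
    by (intro measurable_restrict_space1) (simp add: borel_measurable_continuous_onI continuous_vector2)
  then have "(LINT x|segment_measure l h. f x) = (LINT s|restrict_space lborel {0..l}. f (vector [s, h]))"
    unfolding segment_measure_def by (rule integral_distr[OF _ borel_measurable_continuous_onI[OF assms]])
  then show "(LINT x|segment_measure l h. f x) = (LINT s|lborel. indicat_real {0..l} s * f (vector [s, h]))"
    by (simp add: integral_restrict_space)
qed

definition clamp01 :: "real \<Rightarrow> real" where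
  "clamp01 u = max 0 (min 1 u)"

text \<open>
  A continuous cutoff around the lower segment; only sources where it is positive are used for
  calibration.
\<close>

definition near_source :: "real \<Rightarrow> real^2 \<Rightarrow> real" where
  "near_source l q = max 0 (1 - 8 * \<bar>q $ 2\<bar>) * clamp01 (l + 2 - \<bar>q $ 1\<bar>)"

text \<open>
  A continuous function that dominates the amount by which the potentials fail to reach 1. It vanishes on the
  upper segment, so the sinks of an approximating sequence make it small on average. The radius
  \<open>l + 10\<close> leaves room for all points within distance 2 of the relevant sources.
\<close>

definition sink_defect :: "real \<Rightarrow> real^2 \<Rightarrow> real" where
  "sink_defect l z = min 2 (8 * max 0 (1 - z $ 2)) * clamp01 (l + 10 - norm z)"

text \<open>
  A test function that dominates the indicator of all relevant sources within distance 2 of a point whose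
  first coordinate has integer part \<open>i\<close>.
\<close>

definition near_column :: "int \<Rightarrow> real^2 \<Rightarrow> real" where
  "near_column i q = clamp01 (4 - \<bar>q $ 1 - of_int i\<bar>) * clamp01 (2 - \<bar>q $ 2\<bar>)"

lemma norm_le_components: "norm q \<le> \<bar>q $ 1\<bar> + \<bar>q $ 2\<bar>" for q :: "real^2"
  using norm_le_l1_cart[of q] by (simp add: sum_2)

lemma near_source_bounds: "0 \<le> near_source l q" "near_source l q \<le> 1"
  and near_source_pos: "near_source l q > 0 \<Longrightarrow> \<bar>q $ 2\<bar> \<le> 1/8 \<and> \<bar>q $ 1\<bar> \<le> l + 2"
  and near_source_zero: "norm q \<ge> l + 3 \<Longrightarrow> near_source l q = 0"
proof -
  have c: "0 \<le> clamp01 u" "clamp01 u \<le> 1" for u by (auto simp: clamp01_def)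
  have m: "0 \<le> max 0 (1 - 8 * \<bar>q $ 2\<bar>)" "max 0 (1 - 8 * \<bar>q $ 2\<bar>) \<le> 1" by auto
  show "0 \<le> near_source l q" "near_source l q \<le> 1"
    unfolding near_source_def using c m by (auto intro!: mult_le_one)
  show pos: "\<bar>q $ 2\<bar> \<le> 1/8 \<and> \<bar>q $ 1\<bar> \<le> l + 2" if "near_source l q > 0"
  proof -
    have "max 0 (1 - 8 * \<bar>q $ 2\<bar>) > 0" "clamp01 (l + 2 - \<bar>q $ 1\<bar>) > 0"
      using that c m unfolding near_source_def by (smt (verit) zero_less_mult_iff)+
    then show ?thesis by (auto simp: clamp01_def)
  qed
  show "near_source l q = 0" if "norm q \<ge> l + 3"
  proof (rule ccontr)
    assume "near_source l q \<noteq> 0"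
    then have "near_source l q > 0" using \<open>0 \<le> near_source l q\<close> by simp
    then show False using pos norm_le_components[of q] that by linarith
  qed
qed

lemma continuous_cutoffs:
  "continuous_on UNIV (near_source l)" "continuous_on UNIV (sink_defect l)" "continuous_on UNIV (near_column i)"
  "continuous_on UNIV (\<lambda>q :: real^2. tent l h M j (q $ 1))"
  unfolding near_source_def[abs_def] sink_defect_def[abs_def] near_column_def[abs_def] clamp01_def tent_def
  by (intro continuous_intros; simp)+

text \<open>
  On the middle half of the interval of length \<open>l / M\<close> around the centre, the reward is at least \<open>h\<^sup>2 / 64\<close>.
\<close>

lemma tent_integral_ge:
  assumes "0 < l" "0 < h" "l / real M \<le> h" "j < M"
  shows "(LINT s|lborel. indicat_real {0..l} s * (near_source l (vector [s, 0]) * tent l h M j s)) \<ge> l / real M * h\<^sup>2 / 128"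
proof -
  define c where "c = cell_center l M j"
  define r where "r = l / (4 * real M)"
  have M: "real M > 0" using assms by simp
  have r: "r > 0" "r \<le> h / 4" using assms M by (auto simp: r_def field_simps)
  have c_eq: "c = (real j + 1/2) * (4 * r)" using M by (simp add: c_def cell_center_def r_def)
  have lM: "l = real M * (4 * r)" using M by (simp add: r_def)
  have "(real j + 1) * (4 * r) \<le> l" unfolding lM using assms r by (intro mult_right_mono) auto
  moreover have "real j * r \<ge> 0" using r by simp
  ultimately have sub: "{c - r..c + r} \<subseteq> {0..l}" using r unfolding c_eq by (auto simp: algebra_simps)
  have ns: "near_source l (vector [s, 0]) = 1" if "s \<in> {0..l}" for s
    using that by (simp add: near_source_def clamp01_def)
  have tent0: "tent l h M j s \<ge> 0" for s by (simp add: tent_def)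
  have "l / real M * h\<^sup>2 / 128 = (LINT s|lborel. h\<^sup>2 / 64 * indicat_real {c - r..c + r} s)"
    using r M by (simp add: r_def mult.commute)
  also have "\<dots> \<le> (LINT s|lborel. indicat_real {0..l} s * (near_source l (vector [s, 0]) * tent l h M j s))"
  proof (rule integral_mono)
    show "integrable lborel (\<lambda>s. h\<^sup>2 / 64 * indicat_real {c - r..c + r} s)"
      using emeasure_compact_finite[of "{c - r..c + r}"]
      by (intro integrable_mult_right) (auto simp: integrable_indicator_iff)
    have "continuous_on UNIV (\<lambda>q. near_source l q * tent l h M j (q $ 1))"
      by (intro continuous_on_mult continuous_cutoffs)
    from segment_measure_integral(1)[OF this, of l 0]
    show "integrable lborel (\<lambda>s. indicat_real {0..l} s * (near_source l (vector [s, 0]) * tent l h M j s))" by simp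
    fix s :: real
    show "h\<^sup>2 / 64 * indicat_real {c - r..c + r} s \<le> indicat_real {0..l} s * (near_source l (vector [s, 0]) * tent l h M j s)"
    proof (cases "s \<in> {c - r..c + r}")
      case True
      then have "\<bar>s - c\<bar> \<le> r" by (auto simp: abs_le_iff)
      then have "h / 4 \<le> max 0 (h / 2 - \<bar>s - c\<bar>)" using r by linarith
      then have "(h / 4)\<^sup>2 \<le> (max 0 (h / 2 - \<bar>s - c\<bar>))\<^sup>2" using assms by (intro power_mono) auto
      then show ?thesis using True sub ns by (auto simp: tent_def c_def[symmetric] power_divide)
    next
      case False
      then show ?thesis using ns tent0[of s] by (auto simp: indicator_def)
    qed
  qed
  finally show ?thesis .
qed

lemma near_column_integral_le:
  "(LINT s|lborel. indicat_real {0..l} s * near_column i (vector [s, 0])) \<le> 8"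
proof -
  have "(LINT s|lborel. indicat_real {0..l} s * near_column i (vector [s, 0]))
    \<le> (LINT s|lborel. indicat_real {of_int i - 4..of_int i + 4::real} s)"
  proof (rule integral_mono)
    show "integrable lborel (\<lambda>s. indicat_real {0..l} s * near_column i (vector [s, 0]))"
      by (rule segment_measure_integral(1)[OF continuous_cutoffs(3)])
    show "integrable lborel (indicat_real {of_int i - 4..of_int i + 4::real})"
      by (auto simp: integrable_indicator_iff)
    fix s :: real
    show "indicat_real {0..l} s * near_column i (vector [s, 0]) \<le> indicat_real {of_int i - 4..of_int i + 4} s"
      by (auto simp: indicator_def near_column_def clamp01_def)
  qed
  also have "\<dots> = 8" by simp
  finally show ?thesis .
qed

lemma sink_defect_ge:
  assumes t: "1/8 \<le> t" "t \<le> 3/4" and g: "0 \<le> g" "g \<le> 1/16" and q: "near_source l q > 0"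
  shows "1 - potential t g q v \<le> sink_defect l v"
proof -
  have q': "\<bar>q $ 2\<bar> \<le> 1/8" "\<bar>q $ 1\<bar> \<le> l + 2" using near_source_pos[OF q] by auto
  have nonneg: "0 \<le> sink_defect l v" by (auto simp: sink_defect_def clamp01_def)
  show ?thesis
  proof (cases "dist v q \<ge> 2")
    case True
    then show ?thesis using potential_far[of v q g t] q' g nonneg by auto
  next
    case False
    have "norm v \<le> norm q + dist v q" using norm_triangle_sub[of v q] by (simp add: dist_norm)
    then have "norm v \<le> l + 9" using norm_le_components[of q] q' False by linarith
    then have c: "clamp01 (l + 10 - norm v) = 1" by (simp add: clamp01_def)
    show ?thesis
    proof (cases "v $ 2 \<le> t")
      case True
      have "dist v q + q $ 2 - g \<ge> -1" using q' g zero_le_dist[of v q] by linarith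
      then have "potential t g q v \<ge> -1" using True by (simp add: potential_def)
      moreover have "sink_defect l v = 2" using True t c by (simp add: sink_defect_def)
      ultimately show ?thesis by linarith
    next
      case v: False
      have "min 1 (v $ 2) \<le> potential t g q v" using v by (auto simp: potential_def)
      moreover have "1 - min 1 (v $ 2) \<le> sink_defect l v" using v t c by (auto simp: sink_defect_def min_def max_def)
      ultimately show ?thesis by linarith
    qed
  qed
qed

lemma weak_starD: "weak_star \<mu>s \<mu> \<Longrightarrow> f \<in> C0 \<Longrightarrow> (\<lambda>k. LINT x|\<mu>s k. f x) \<longlonglongrightarrow> (LINT x|\<mu>. f x)"
  for f :: "'a::euclidean_space \<Rightarrow> real"
  by (simp add: weak_star_def)

text \<open>
  Weak-* convergence applied to finitely many test functions provides the hypotheses of \<open>discrete_excess\<close>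
  for late members of the sequence. Mass that escapes to infinity or sits far away from the segments does no
  harm, because the test functions only bound the relevant sources from below and the defect at nearby
  sinks from above.
\<close>

lemma excess_eventually:
  assumes tp: "\<And>k. transport_path (\<mu>ps k) (\<mu>ms k) (Gs k) (ws k)"
    and wp: "weak_star \<mu>ps (segment_measure l 0)" and wm: "weak_star \<mu>ms (segment_measure l 1)"
    and l: "0 < l" and h: "0 < h" "h \<le> 1" "l / real M \<le> h" "M = 1 \<or> h = l / real M" "M \<ge> 1"
    and par: "h ^ 3 \<le> 32 * m0" "h\<^sup>2 \<le> 4 * a" and \<delta>: "\<delta> > 0"
  shows "\<forall>\<^sub>F k in sequentially.
    surcharged_cost \<theta> a m0 9 (parcs (Gs k)) (ws k) \<ge> l + l * h\<^sup>2 / 128 - 3 * \<delta>"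
proof -
  define f1 where "f1 q = near_source l q * (1 - q $ 2)" for q :: "real^2"
  define f2 where "f2 j q = near_source l q * tent l h M j (q $ 1)" for j and q :: "real^2"
  define N where "N = \<lceil>l\<rceil> + 6"
  have cont: "continuous_on UNIV f1" "continuous_on UNIV (f2 j)" for j
    unfolding f1_def[abs_def] f2_def[abs_def] by (intro continuous_on_mult continuous_cutoffs continuous_intros)+
  have C0: "f1 \<in> C0" "f2 j \<in> C0" "sink_defect l \<in> C0" "near_column i \<in> C0" for i j
  proof -
    show "f1 \<in> C0" "f2 j \<in> C0"
      by (rule C0I[OF cont(1), of "l + 3"] C0I[OF cont(2), of "l + 3"]; simp add: f1_def f2_def near_source_zero)+
    show "sink_defect l \<in> C0"
      by (rule C0I[OF continuous_cutoffs(2), of "l + 10"]) (simp add: sink_defect_def clamp01_def)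
    show "near_column i \<in> C0"
    proof (rule C0I[OF continuous_cutoffs(3), of "\<bar>of_int i\<bar> + 6"])
      fix x :: "real^2" assume "\<bar>of_int i\<bar> + 6 \<le> norm x"
      then have "\<bar>x $ 1 - of_int i\<bar> \<ge> 4 \<or> \<bar>x $ 2\<bar> \<ge> 2" using norm_le_components[of x] by linarith
      then show "near_column i x = 0" by (auto simp: near_column_def clamp01_def)
    qed
  qed
  have "(LINT x|segment_measure l 0. f1 x) = (LINT s|lborel. indicat_real {0..l} s)"
    unfolding segment_measure_integral(2)[OF cont(1)]
    by (rule Bochner_Integration.integral_cong) (auto simp: f1_def near_source_def clamp01_def indicator_def)
  then have ev1: "\<forall>\<^sub>F k in sequentially. l - \<delta> < (LINT x|\<mu>ps k. f1 x)"
    using l \<delta> by (intro order_tendstoD(1)[OF weak_starD[OF wp C0(1)]]) simp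
  have ev2: "\<forall>\<^sub>F k in sequentially. \<forall>j\<in>{..<M}. l / real M * h\<^sup>2 / 128 - \<delta> / real M < (LINT x|\<mu>ps k. f2 j x)"
  proof (intro eventually_ball_finite ballI)
    fix j assume j: "j \<in> {..<M}"
    have "(LINT x|segment_measure l 0. f2 j x) \<ge> l / real M * h\<^sup>2 / 128"
      unfolding segment_measure_integral(2)[OF cont(2)] using tent_integral_ge[OF l h(1,3), of j] j
      by (simp add: f2_def)
    moreover have "\<delta> / real M > 0" using \<delta> h(5) by simp
    ultimately show "\<forall>\<^sub>F k in sequentially. l / real M * h\<^sup>2 / 128 - \<delta> / real M < (LINT x|\<mu>ps k. f2 j x)"
      by (intro order_tendstoD(1)[OF weak_starD[OF wp C0(2)]]) linarith
  qed simp
  have "(LINT x|segment_measure l 1. sink_defect l x) = 0"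
    unfolding segment_measure_integral(2)[OF continuous_cutoffs(2)] by (simp add: sink_defect_def)
  then have ev3: "\<forall>\<^sub>F k in sequentially. (LINT x|\<mu>ms k. sink_defect l x) < \<delta>"
    using \<delta> by (intro order_tendstoD(2)[OF weak_starD[OF wm C0(3)]]) simp
  have ev4: "\<forall>\<^sub>F k in sequentially. \<forall>i\<in>{- N..N}. (LINT x|\<mu>ps k. near_column i x) < 9"
  proof (intro eventually_ball_finite ballI)
    fix i
    show "\<forall>\<^sub>F k in sequentially. (LINT x|\<mu>ps k. near_column i x) < 9"
      using near_column_integral_le[of l i]
      by (intro order_tendstoD(2)[OF weak_starD[OF wp C0(4)]])
        (simp add: segment_measure_integral(2)[OF continuous_cutoffs(3)])
  qed simp
  from ev1 ev2 ev3 ev4 show ?thesis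
  proof eventually_elim
    case (elim k)
    obtain V \<alpha> \<beta> where V: "finite V" and a0: "\<And>v. \<alpha> v \<ge> 0" and b0: "\<And>v. \<beta> v \<ge> 0"
      and bal: "balanced (parcs (Gs k)) (ws k) V \<alpha> \<beta>"
      and Ip: "\<And>f. f \<in> C0 \<Longrightarrow> (LINT x|\<mu>ps k. f x) = (\<Sum>v\<in>V. \<alpha> v * f v)"
      and Im: "\<And>f. f \<in> C0 \<Longrightarrow> (LINT x|\<mu>ms k. f x) = (\<Sum>v\<in>V. \<beta> v * f v)"
      by (rule transport_path_balanced[OF tp[of k]]) blast
    have G: "pair_digraph (Gs k)" and w0: "\<And>e. e \<in> parcs (Gs k) \<Longrightarrow> ws k e \<ge> 0"
      using tp[of k] by (auto simp: transport_path_def)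
    have finE: "finite (parcs (Gs k))"
      using pair_fin_digraph.pair_finite_arcs[OF pair_digraph.axioms(1)[OF G]] .
    define A where "A = {q\<in>V. near_source l q > 0}"
    have A: "near_source l q > 0" "\<bar>q $ 2\<bar> \<le> 1/8" "\<bar>q $ 1\<bar> \<le> l + 2" if "q \<in> A" for q
      using that near_source_pos[of l q] by (auto simp: A_def)
    have restrict: "(\<Sum>v\<in>V. \<alpha> v * (near_source l v * f v)) \<le> (\<Sum>v\<in>A. \<alpha> v * f v)"
      if f: "\<And>q. q \<in> A \<Longrightarrow> f q \<ge> 0" for f
    proof -
      have "(\<Sum>v\<in>V. \<alpha> v * (near_source l v * f v)) = (\<Sum>v\<in>A. \<alpha> v * (near_source l v * f v))"
        using V near_source_bounds(1) by (intro sum.mono_neutral_right) (force simp: A_def not_less intro: antisym)+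
      also have "\<dots> \<le> (\<Sum>v\<in>A. \<alpha> v * f v)"
        using f near_source_bounds[of l] a0 by (intro sum_mono mult_left_mono mult_left_le_one_le) auto
      finally show ?thesis .
    qed
    show ?case
    proof (rule discrete_excess[OF finE V bal w0 a0 b0 _ _ _ _ _ l h par])
      show "A \<subseteq> V" by (auto simp: A_def)
      show "\<bar>q $ 2\<bar> \<le> 1/8" if "q \<in> A" for q using A[OF that] by blast
      show "sink_defect l v \<ge> 0" for v by (auto simp: sink_defect_def clamp01_def)
      show "1 - potential t g q v \<le> sink_defect l v"
        if "1/8 \<le> t" "t \<le> 3/4" "0 \<le> g" "g \<le> 1/16" "v \<in> V" "q \<in> A" for t g v q
        using that A(1) by (intro sink_defect_ge) auto
      show "(\<Sum>q\<in>A. \<alpha> q * (1 - q $ 2)) \<ge> l - \<delta>"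
      proof -
        have "0 \<le> 1 - q $ 2" if "q \<in> A" for q using A(2)[OF that] by linarith
        then have "(\<Sum>v\<in>V. \<alpha> v * f1 v) \<le> (\<Sum>q\<in>A. \<alpha> q * (1 - q $ 2))" unfolding f1_def by (rule restrict)
        then show ?thesis using elim(1) Ip[OF C0(1)] by linarith
      qed
      show "(\<Sum>q\<in>A. \<alpha> q * tent l h M j (q $ 1)) \<ge> l / real M * h\<^sup>2 / 128 - \<delta> / real M" if "j < M" for j
      proof -
        have "(\<Sum>v\<in>V. \<alpha> v * f2 j v) \<le> (\<Sum>q\<in>A. \<alpha> q * tent l h M j (q $ 1))"
          unfolding f2_def by (rule restrict) (simp add: tent_def)
        then show ?thesis using elim(2) that Ip[OF C0(2)[of j]] by force
      qed
      show "(\<Sum>v\<in>V. \<beta> v * sink_defect l v) \<le> \<delta>" using elim(3) Im[OF C0(3)] by linarith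
      show "\<delta> \<ge> 0" using \<delta> by simp
      fix p :: "real^2"
      show "(\<Sum>q\<in>{q\<in>A. dist p q \<le> 2}. \<alpha> q) \<le> 9"
      proof (cases "{q\<in>A. dist p q \<le> 2} = {}")
        case True
        then show ?thesis by (simp only: sum.empty)
      next
        case False
        then obtain q0 where q0: "q0 \<in> A" "dist p q0 \<le> 2" by blast
        define i where "i = \<lfloor>p $ 1\<rfloor>"
        have "\<bar>p $ 1\<bar> \<le> l + 4" using A(3)[OF q0(1)] component_le_dist[of p 1 q0] q0(2) by linarith
        then have i: "i \<in> {- N..N}" unfolding i_def N_def by (simp, linarith)
        have one: "near_column i q = 1" if q: "q \<in> A" "dist p q \<le> 2" for q
        proof -
          have "\<bar>q $ 1 - of_int i\<bar> \<le> 3" using component_le_dist[of p 1 q] q(2) unfolding i_def by linarith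
          then show ?thesis using A(2)[OF q(1)] by (simp add: near_column_def clamp01_def)
        qed
        have "(\<Sum>q\<in>{q\<in>A. dist p q \<le> 2}. \<alpha> q) = (\<Sum>q\<in>{q\<in>A. dist p q \<le> 2}. \<alpha> q * near_column i q)"
          using one by (intro sum.cong) auto
        also have "\<dots> \<le> (\<Sum>q\<in>V. \<alpha> q * near_column i q)"
          using V a0 by (intro sum_mono2) (auto simp: A_def near_column_def clamp01_def)
        also have "\<dots> \<le> 9" using elim(4) i Ip[OF C0(4)[of i]] by force
        finally show ?thesis .
      qed
    qed
  qed
qed

text \<open>
  The cells have to fill the segment exactly, except that a segment shorter than \<open>h0\<close> is treated as a
  single cell of width \<open>h0\<close>.
\<close>

lemma cell_width_exists:
  fixes l h0 :: real
  assumes "0 < l" "0 < h0"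
  obtains h and M :: nat where "h0 \<le> h" "h < 2 * h0" "l / real M \<le> h" "M = 1 \<or> h = l / real M" "M \<ge> 1"
proof (cases "l < h0")
  case True
  then show ?thesis using that[of h0 1] assms by simp
next
  case False
  define M where "M = nat \<lfloor>l / h0\<rfloor>"
  have "l / h0 \<ge> 1" using False assms by simp
  then have M: "M \<ge> 1" "real M \<le> l / h0" "l / h0 < real M + 1" unfolding M_def by linarith+
  have "h0 \<le> l / real M" using M assms by (simp add: field_simps)
  moreover have "l / real M < 2 * h0"
  proof -
    have "l < (real M + 1) * h0" using M(3) assms by (simp add: field_simps)
    also have "\<dots> \<le> (2 * real M) * h0" using M(1) assms by (intro mult_right_mono) auto
    finally show ?thesis using M(1) by (simp add: field_simps)
  qed
  ultimately show ?thesis using that[of "l / real M" M] M by simp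
qed

text \<open>
  The bound of \<open>excess_eventually\<close> passes to the lower limit along every approximating sequence.
\<close>

lemma relaxed_cost_ge:
  fixes J :: "(real^2) pair_pre_digraph \<Rightarrow> ((real^2) \<times> (real^2) \<Rightarrow> real) \<Rightarrow> real"
  assumes J: "\<And>G w. finite (parcs G) \<Longrightarrow> (\<And>e. e \<in> parcs G \<Longrightarrow> w e \<ge> 0) \<Longrightarrow>
      J G w \<ge> \<kappa> * surcharged_cost \<theta> a m0 9 (parcs G) w"
    and \<kappa>: "0 \<le> \<kappa>" "\<kappa> \<le> 1"
    and l: "0 < l" and h0: "0 < h0" "h0 \<le> 1/2" and par: "h0 ^ 3 \<le> 4 * m0" "h0\<^sup>2 \<le> a"
  shows "relaxed_cost J (segment_measure l 0) (segment_measure l 1) F \<ge> ereal (\<kappa> * (l + l * h0\<^sup>2 / 128))"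
  unfolding relaxed_cost_def
proof (rule Inf_greatest, clarify)
  fix \<mu>ps \<mu>ms Gs ws
  assume app: "approximating_graph_sequence (segment_measure l 0) (segment_measure l 1) F \<mu>ps \<mu>ms Gs ws"
  then have tp: "\<And>k. transport_path (\<mu>ps k) (\<mu>ms k) (Gs k) (ws k)"
    and wp: "weak_star \<mu>ps (segment_measure l 0)" and wm: "weak_star \<mu>ms (segment_measure l 1)"
    by (auto simp: approximating_graph_sequence_def)
  obtain h and M :: nat where h: "h0 \<le> h" "h < 2 * h0" "l / real M \<le> h" "M = 1 \<or> h = l / real M" "M \<ge> 1"
    using cell_width_exists[OF l h0(1)] by metis
  have "h ^ 3 \<le> (2 * h0) ^ 3" "h\<^sup>2 \<le> (2 * h0)\<^sup>2" using h h0 by (intro power_mono; simp)+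
  then have hp: "h ^ 3 \<le> 32 * m0" "h\<^sup>2 \<le> 4 * a" using par by (simp_all add: power_mult_distrib)
  have h1: "0 < h" "h \<le> 1" using h h0 by auto
  have "h0\<^sup>2 \<le> h\<^sup>2" using h h0 by (intro power_mono) auto
  define L where "L = l + l * h0\<^sup>2 / 128"
  have L: "L \<le> l + l * h\<^sup>2 / 128" using \<open>h0\<^sup>2 \<le> h\<^sup>2\<close> l by (simp add: L_def)
  have "ereal (\<kappa> * L) \<le> liminf (\<lambda>k. ereal (J (Gs k) (ws k))) + ereal e" if e: "e > 0" for e
  proof -
    from e have "e / 3 > 0" by simp
    from excess_eventually[OF tp wp wm l h1 h(3-5) hp this, of \<theta>]
    have "\<forall>\<^sub>F k in sequentially. ereal (\<kappa> * L - e) \<le> ereal (J (Gs k) (ws k))"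
    proof eventually_elim
      case (elim k)
      then have elim: "L - e \<le> surcharged_cost \<theta> a m0 9 (parcs (Gs k)) (ws k)"
        using L by simp
      have G: "pair_digraph (Gs k)" and w0: "\<And>e. e \<in> parcs (Gs k) \<Longrightarrow> ws k e \<ge> 0"
        using tp[of k] by (auto simp: transport_path_def)
      have fin: "finite (parcs (Gs k))"
        using pair_fin_digraph.pair_finite_arcs[OF pair_digraph.axioms(1)[OF G]] .
      have "\<kappa> * L - e \<le> \<kappa> * (L - e)" using \<kappa>(2) e mult_right_mono[of \<kappa> 1 e] by (simp add: right_diff_distrib)
      also have "\<dots> \<le> J (Gs k) (ws k)" by (rule order_trans[OF mult_left_mono[OF elim \<kappa>(1)] J[OF fin w0]])
      finally show ?case by simp
    qed
    then have "ereal (\<kappa> * L - e) \<le> liminf (\<lambda>k. ereal (J (Gs k) (ws k)))" by (rule Liminf_bounded)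
    from add_right_mono[OF this, of "ereal e"] show ?thesis by simp
  qed
  then show "ereal (\<kappa> * (l + l * h0\<^sup>2 / 128)) \<le> liminf (\<lambda>k. ereal (J (Gs k) (ws k)))"
    unfolding L_def[symmetric] by (rule ereal_le_epsilon2)
qed

section \<open>The reference cost\<close>

text \<open>
  The sample points are the right end points, matching the index set \<open>{1..n}\<close> of a discrete measure.
\<close>

lemma riemann_sums:
  fixes g :: "real \<Rightarrow> real"
  assumes l: "0 < l" and g: "continuous_on {0..l} g"
  shows "(\<lambda>k. \<Sum>i\<in>{1..Suc k}. l / real (Suc k) * g (real i * (l / real (Suc k)))) \<longlonglongrightarrow> integral {0..l} g"
proof (rule tendstoI)
  fix e :: real assume e: "e > 0"
  define e' where "e' = e / (2 * l)"
  have e': "e' > 0" using e l by (simp add: e'_def)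
  have "uniformly_continuous_on {0..l} g" using g by (rule compact_uniformly_continuous) simp
  then obtain d where d: "d > 0" "\<And>x y. x \<in> {0..l} \<Longrightarrow> y \<in> {0..l} \<Longrightarrow> dist y x < d \<Longrightarrow> dist (g y) (g x) < e'"
    unfolding uniformly_continuous_on_def using e' by metis
  have bound: "\<bar>integral {0..l} g - (\<Sum>i\<in>{1..Suc k}. l / real (Suc k) * g (real i * (l / real (Suc k))))\<bar> \<le> l * e'"
    if k: "l / real (Suc k) < d" for k
  proof -
    define r where "r = l / real (Suc k)"
    have r: "r > 0" "real (Suc k) * r = l" using l by (simp_all add: r_def)
    have "m \<le> Suc k \<Longrightarrow> \<bar>integral {0..real m * r} g - (\<Sum>i\<in>{1..m}. r * g (real i * r))\<bar> \<le> real m * r * e'" for m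
    proof (induction m)
      case (Suc m)
      have top: "real (Suc m) * r \<le> l" using Suc.prems r by (metis mult_right_mono of_nat_le_iff less_imp_le)
      have le: "real m * r \<le> real (Suc m) * r" "0 \<le> real m * r" using r by auto
      have cont: "continuous_on {0..real (Suc m) * r} g" "continuous_on {real m * r..real (Suc m) * r} g"
        using g by (rule continuous_on_subset; use top le in auto)+
      have comb: "integral {0..real m * r} g + integral {real m * r..real (Suc m) * r} g = integral {0..real (Suc m) * r} g"
        using le cont(1) by (intro Henstock_Kurzweil_Integration.integral_combine integrable_continuous_interval) auto
      have "\<bar>integral {real m * r..real (Suc m) * r} (\<lambda>x. g x - g (real (Suc m) * r))\<bar> \<le> e' * (real (Suc m) * r - real m * r)"
      proof -
        have "norm (integral {real m * r..real (Suc m) * r} (\<lambda>x. g x - g (real (Suc m) * r))) \<le> e' * (real (Suc m) * r - real m * r)"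
        proof (rule integral_bound)
          show "real m * r \<le> real (Suc m) * r" by (rule le)
          show "continuous_on {real m * r..real (Suc m) * r} (\<lambda>x. g x - g (real (Suc m) * r))"
            by (intro continuous_intros cont)
          fix x assume x: "x \<in> {real m * r..real (Suc m) * r}"
          have "r < d" using k by (simp only: r_def)
          moreover have "real (Suc m) * r = real m * r + r" by (simp add: algebra_simps)
          ultimately have "dist x (real (Suc m) * r) < d" using x by (auto simp: dist_real_def)
          then show "norm (g x - g (real (Suc m) * r)) \<le> e'"
            using d(2)[of "real (Suc m) * r" x] x top le by (auto simp: dist_real_def)
        qed
        then show ?thesis by simp
      qed
      moreover have "integral {real m * r..real (Suc m) * r} (\<lambda>x. g x - g (real (Suc m) * r))
        = integral {real m * r..real (Suc m) * r} g - r * g (real (Suc m) * r)"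
        using le cont(2) by (subst Henstock_Kurzweil_Integration.integral_diff)
          (auto intro: integrable_continuous_interval simp: algebra_simps)
      moreover have "e' * (real (Suc m) * r - real m * r) = r * e'" by (simp add: algebra_simps)
      moreover have "real (Suc m) * r * e' = real m * r * e' + r * e'" by (simp add: algebra_simps)
      moreover have "(\<Sum>i\<in>{1..Suc m}. r * g (real i * r)) = (\<Sum>i\<in>{1..m}. r * g (real i * r)) + r * g (real (Suc m) * r)"
        by simp
      moreover have "\<bar>integral {0..real m * r} g - (\<Sum>i\<in>{1..m}. r * g (real i * r))\<bar> \<le> real m * r * e'"
        using Suc by simp
      ultimately show ?case using comb by linarith
    qed simp
    from this[of "Suc k"] show ?thesis by (simp only: r r_def[symmetric])
  qed
  have "(\<lambda>k. l / real (Suc k)) \<longlonglongrightarrow> 0" using LIMSEQ_Suc[OF lim_const_over_n[of l]] by simp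
  then have "\<forall>\<^sub>F k in sequentially. l / real (Suc k) < d" by (rule order_tendstoD(2)) (rule d(1))
  then show "\<forall>\<^sub>F k in sequentially. dist (\<Sum>i\<in>{1..Suc k}. l / real (Suc k) * g (real i * (l / real (Suc k)))) (integral {0..l} g) < e"
  proof eventually_elim
    case (elim k)
    have "l * e' < e" using e l by (simp add: e'_def)
    then show ?case using bound[OF elim] by (simp only: dist_real_def abs_minus_commute)
  qed
qed

lemma restrict_lborel_integral:
  fixes f :: "real \<Rightarrow> real"
  assumes "continuous_on {a..b} f"
  shows "(LINT s|restrict_space lborel {a..b}. f s) = integral {a..b} f"
proof -
  have "(LINT s|restrict_space lborel {a..b}. f s) = (LINT s:{a..b}|lborel. f s)"
    by (simp add: integral_restrict_space set_lebesgue_integral_def)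
  also have "\<dots> = integral {a..b} f"
    using borel_integrable_atLeastAtMost'[OF assms] by (rule set_borel_integral_eq_integral(2))
  finally show ?thesis .
qed

lemma finite_restrict_lborel: "finite_measure (restrict_space lborel {a..b::real})"
  using emeasure_compact_finite[of "{a..b}"]
  by (intro finite_measureI) (simp add: emeasure_restrict_space space_restrict_space)

text \<open>
  Area on the rectangle \<open>[0, l] \<times> [0, 1]\<close>, written as an iterated integral in order to compare it with
  Riemann sums.
\<close>

definition rectangle_measure :: "real \<Rightarrow> (real^2) measure" where
  "rectangle_measure l = distr (restrict_space lborel {0..l} \<Otimes>\<^sub>M restrict_space lborel {0..1}) borel (\<lambda>(x, y). vector [x, y])"

lemma continuous_vector2_pair: "continuous_on X (\<lambda>z. vector [fst z, snd z] :: real^2)"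
  unfolding vector2_eq by (intro continuous_intros)

lemma measurable_rectangle:
  "(\<lambda>(x, y). vector [x, y] :: real^2) \<in> borel_measurable (restrict_space lborel A \<Otimes>\<^sub>M restrict_space lborel B)"
proof -
  have "(\<lambda>z. vector [fst z, snd z] :: real^2) \<in> borel_measurable (borel :: (real \<times> real) measure)"
    by (rule borel_measurable_continuous_onI[OF continuous_vector2_pair])
  moreover have "(\<lambda>z. (fst z, snd z)) \<in> restrict_space lborel A \<Otimes>\<^sub>M restrict_space lborel B \<rightarrow>\<^sub>M (borel :: (real \<times> real) measure)"
    unfolding borel_prod[symmetric]
    by (intro measurable_Pair measurable_compose[OF measurable_fst] measurable_compose[OF measurable_snd] measurable_restrict_space1) auto
  ultimately show ?thesis by (simp add: case_prod_unfold)
qed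

lemma rectangle_measure: "sets (rectangle_measure l) = sets borel" "finite_measure (rectangle_measure l)"
proof -
  have "finite_measure (restrict_space lborel {0..l} \<Otimes>\<^sub>M restrict_space lborel {0..1::real})"
    by (rule finite_measure_pair_measure[OF finite_restrict_lborel finite_restrict_lborel])
  then show "finite_measure (rectangle_measure l)"
    unfolding rectangle_measure_def by (rule finite_measure.finite_measure_distr) (rule measurable_rectangle)
qed (simp add: rectangle_measure_def)

lemma rectangle_measure_integral:
  fixes f :: "real^2 \<Rightarrow> real"
  assumes f: "continuous_on UNIV f" "\<And>x. \<bar>f x\<bar> \<le> K"
  shows "continuous_on {0..l} (\<lambda>x. integral {0..1} (\<lambda>y. f (vector [x, y])))"
    and "(LINT x|rectangle_measure l. f x) = integral {0..l} (\<lambda>x. integral {0..1} (\<lambda>y. f (vector [x, y])))"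
proof -
  let ?M = "restrict_space lborel {0..l}" and ?N = "restrict_space lborel {0..1::real}"
  have c2: "continuous_on X (\<lambda>z. f (vector [fst z, snd z]))" for X :: "(real \<times> real) set"
    by (rule continuous_on_compose2[OF f(1) continuous_vector2_pair]) auto
  show cont: "continuous_on {0..l} (\<lambda>x. integral {0..1} (\<lambda>y. f (vector [x, y])))"
    using integral_continuous_on_param[of "{0..l}" "0::real" "1::real" "\<lambda>x y. f (vector [x, y])"] c2[of "{0..l} \<times> {0..1}"]
    by (simp add: case_prod_unfold)
  have cy: "continuous_on {0..1} (\<lambda>y. f (vector [x, y]))" for x
    by (rule continuous_on_compose2[OF f(1) continuous_vector2_pair[of UNIV, THEN continuous_on_compose2, of _ "\<lambda>y. (x, y)", simplified]])
      (auto intro!: continuous_intros)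
  interpret M: finite_measure ?M by (rule finite_restrict_lborel)
  interpret N: finite_measure ?N by (rule finite_restrict_lborel)
  interpret P: pair_sigma_finite ?M ?N ..
  have fm: "f \<in> borel_measurable borel" by (rule borel_measurable_continuous_onI[OF f(1)])
  have meas: "(\<lambda>z. f (case z of (x, y) \<Rightarrow> vector [x, y])) \<in> borel_measurable (?M \<Otimes>\<^sub>M ?N)"
    using measurable_compose[OF measurable_rectangle fm] .
  have int: "integrable (?M \<Otimes>\<^sub>M ?N) (\<lambda>z. f (case z of (x, y) \<Rightarrow> vector [x, y]))"
    by (rule finite_measure.integrable_const_bound[OF finite_measure_pair_measure[OF finite_restrict_lborel finite_restrict_lborel], where B=K])
      (use f(2) meas in auto)
  have "(LINT x|rectangle_measure l. f x) = (LINT z|(?M \<Otimes>\<^sub>M ?N). f (case z of (x, y) \<Rightarrow> vector [x, y]))"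
    unfolding rectangle_measure_def by (rule integral_distr[OF measurable_rectangle fm])
  also have "\<dots> = (LINT x|(?M). LINT y|(?N). f (vector [x, y]))"
    using P.integral_fst'[OF int] by simp
  also have "\<dots> = (LINT x|(?M). integral {0..1} (\<lambda>y. f (vector [x, y])))"
    by (simp only: restrict_lborel_integral[OF cy])
  also have "\<dots> = integral {0..l} (\<lambda>x. integral {0..1} (\<lambda>y. f (vector [x, y])))"
    by (rule restrict_lborel_integral[OF cont])
  finally show "(LINT x|rectangle_measure l. f x) = integral {0..l} (\<lambda>x. integral {0..1} (\<lambda>y. f (vector [x, y])))" .
qed

lemma finite_measure_inner_compact:
  fixes N :: "'a::euclidean_space measure"
  assumes N: "sets N = sets borel" "finite_measure N" and A: "A \<in> sets borel" and d: "d > 0"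
  obtains K where "compact K" "K \<subseteq> A" "measure N (A - K) < d"
proof (cases "measure N A < d")
  case True
  then show ?thesis using that[of "{}"] by simp
next
  case False
  interpret N: finite_measure N by fact
  have "ennreal (measure N A - d) < emeasure N A"
    using d False by (simp add: N.emeasure_eq_measure ennreal_less_iff)
  then obtain K where K: "K \<subseteq> A" "compact K" "ennreal (measure N A - d) < emeasure N K"
    using inner_regular[OF N(1) _ A] N.emeasure_finite by (auto simp: less_SUP_iff)
  then have "measure N A - d < measure N K"
    using False by (simp add: N.emeasure_eq_measure ennreal_less_iff)
  moreover have "measure N (A - K) = measure N A - measure N K"
    using A K N(1) by (intro N.finite_measure_Diff) (auto simp: borel_compact)
  ultimately show ?thesis using that K by simp
qed

text \<open>
  Inner regularity by compact sets is applied to \<open>A\<close> and to its complement; the second compact set is the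
  complement of the open set \<open>U\<close>.
\<close>

lemma rca_scaled_measure:
  fixes N :: "'a::euclidean_space measure" and b :: "'b::euclidean_space"
  assumes N: "sets N = sets borel" "finite_measure N"
  shows "(\<lambda>A. measure N A *\<^sub>R b) \<in> rca"
proof -
  interpret N: finite_measure N by fact
  have "(\<lambda>n. measure N (A n) *\<^sub>R b) sums (measure N (\<Union>n. A n) *\<^sub>R b)"
    if "range A \<subseteq> sets borel" "disjoint_family A" for A :: "nat \<Rightarrow> 'a set"
    by (rule bounded_linear.sums[OF bounded_linear_scaleR_left N.finite_measure_UNION]) (use that N in auto)
  moreover have "regular_set_fun (\<lambda>A. measure N A *\<^sub>R b)"
    unfolding regular_set_fun_def
  proof (intro ballI allI impI)
    fix A :: "'a set" and e :: real assume A: "A \<in> sets borel" and e: "e > 0"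
    define y where "y = e / (norm b + 1)"
    have nb: "norm b + 1 > 0" using norm_ge_zero[of b] by linarith
    then have y: "y > 0" "y * (norm b + 1) = e" using e by (simp_all add: y_def)
    obtain K where K: "compact K" "K \<subseteq> A" "measure N (A - K) < y / 2"
      using finite_measure_inner_compact[OF N A, of "y / 2"] y by auto
    have "- A \<in> sets borel" using A by auto
    then obtain L where L: "compact L" "L \<subseteq> - A" "measure N (- A - L) < y / 2"
      using finite_measure_inner_compact[OF N, of "- A" "y / 2"] y by auto
    have KL: "K \<in> sets borel" "L \<in> sets borel" using K(1) L(1) by (auto simp: borel_compact)
    show "\<exists>K U. compact K \<and> open U \<and> K \<subseteq> A \<and> A \<subseteq> U \<and> (\<forall>B\<in>sets borel. B \<subseteq> U - K \<longrightarrow> norm (measure N B *\<^sub>R b) < e)"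
    proof (rule exI[of _ K], rule exI[of _ "- L"], intro conjI ballI impI)
      show "open (- L)" using L(1) by (simp add: compact_imp_closed open_Compl)
      fix B :: "'a set" assume B: "B \<in> sets borel" "B \<subseteq> - L - K"
      have "measure N B \<le> measure N ((A - K) \<union> (- A - L))"
        using B A KL N(1) by (intro N.finite_measure_mono) auto
      also have "\<dots> \<le> measure N (A - K) + measure N (- A - L)"
        using A KL N(1) by (intro measure_Un_le) auto
      finally have "measure N B * norm b \<le> y * norm b" using K(3) L(3) by (intro mult_right_mono) auto
      also have "\<dots> < y * (norm b + 1)" using y(1) by simp
      finally show "norm (measure N B *\<^sub>R b) < e" using y by simp
    qed (use K L in auto)
  qed
  ultimately show ?thesis by (auto simp: rca_def)
qed

definition grid_point :: "real \<Rightarrow> nat \<Rightarrow> real \<Rightarrow> nat \<Rightarrow> real^2" where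
  "grid_point l n y i = vector [real i * (l / real n), y]"

definition grid_edges :: "real \<Rightarrow> nat \<Rightarrow> ((real^2) \<times> (real^2)) set" where
  "grid_edges l n = (\<lambda>i. (grid_point l n 0 i, grid_point l n 1 i)) ` {1..n}"

definition grid_graph :: "real \<Rightarrow> nat \<Rightarrow> (real^2) pair_pre_digraph" where
  "grid_graph l n = \<lparr>pverts = fst ` grid_edges l n \<union> snd ` grid_edges l n, parcs = grid_edges l n\<rparr>"

lemma grid_sum:
  assumes "l > 0"
  shows "(\<Sum>e\<in>grid_edges l n. f e) = (\<Sum>i\<in>{1..n}. f (grid_point l n 0 i, grid_point l n 1 i))"
proof -
  have "inj_on (\<lambda>i. (grid_point l n 0 i, grid_point l n 1 i)) {1..n}"
  proof
    fix i j assume ij: "i \<in> {1..n}" "j \<in> {1..n}" "(grid_point l n 0 i, grid_point l n 1 i) = (grid_point l n 0 j, grid_point l n 1 j)"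
    then have "grid_point l n 0 i $ 1 = grid_point l n 0 j $ 1" by simp
    then have "real i * (l / real n) = real j * (l / real n)" by (simp add: grid_point_def)
    moreover have "l / real n \<noteq> 0" using ij(1) assms by simp
    ultimately show "i = j" by (simp only: mult_cancel_right of_nat_eq_iff) simp
  qed
  then show ?thesis unfolding grid_edges_def by (subst sum.reindex) auto
qed

lemma grid_edge:
  assumes "e = (grid_point l n 0 i, grid_point l n 1 i)"
  shows "edge_length e = 1" "edge_direction e = axis 2 1" "edge_point e s = grid_point l n s i"
proof -
  have d: "snd e - fst e = axis 2 (1::real)"
    by (simp add: assms grid_point_def vector2_eq)
  show "edge_length e = 1" "edge_direction e = axis 2 1" by (simp_all add: edge_length_def edge_direction_def d)
  then show "edge_point e s = grid_point l n s i"
    by (simp add: edge_point_def) (simp add: assms grid_point_def vector2_eq)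
qed

lemma pair_digraph_grid: "pair_digraph (grid_graph l n)"
proof
  fix e assume "e \<in> parcs (grid_graph l n)"
  then obtain i where e: "e = (grid_point l n 0 i, grid_point l n 1 i)"
    by (auto simp: grid_graph_def grid_edges_def)
  show "fst e \<noteq> snd e" using grid_edge(1)[OF e] by (auto simp: edge_length_def)
qed (auto simp: grid_graph_def grid_edges_def)

text \<open>
  The sum of \<open>n\<close> point masses \<open>l / n\<close> at height \<open>y\<close>, specified by the properties that are used of it.
\<close>

definition is_grid_measure :: "real \<Rightarrow> nat \<Rightarrow> real \<Rightarrow> (real^2) measure \<Rightarrow> bool" where
  "is_grid_measure l n y M \<longleftrightarrow> discrete_measure M \<and> emeasure M UNIV = ennreal (\<Sum>i\<in>{1..n}. l / real n) \<and>
    (\<forall>f\<in>C0. (LINT x|M. f x) = (\<Sum>i\<in>{1..n}. l / real n * f (grid_point l n y i)))"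

definition grid_measure :: "real \<Rightarrow> nat \<Rightarrow> real \<Rightarrow> (real^2) measure" where
  "grid_measure l n y = (SOME M. is_grid_measure l n y M)"

lemma is_grid_measure_grid_measure:
  assumes "l > 0"
  shows "is_grid_measure l n y (grid_measure l n y)"
proof -
  define N where "N i = return borel (grid_point l n y i)" for i
  have N: "sets (N i) = sets borel" "finite_measure (N i)" for i
    by (auto simp: N_def intro!: finite_measureI)
  have pos: "l / real n \<ge> 0" using assms by simp
  obtain M where M: "sets M = sets borel" "finite_measure M"
    "\<And>A. A \<in> sets borel \<Longrightarrow> emeasure M A = (\<Sum>i\<in>{1..n}. ennreal (l / real n) * emeasure (N i) A)"
    by (rule finite_combination_exists[of "{1..n}" N "\<lambda>_. l / real n"]) (use N pos in auto)
  have "discrete_measure M"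
    unfolding discrete_measure_def
    by (intro conjI M(1) exI[of _ n] exI[of _ "\<lambda>_. l / real n"] exI[of _ "grid_point l n y"])
      (use M(3) assms in \<open>auto simp: N_def\<close>)
  moreover have "emeasure M UNIV = ennreal (\<Sum>i\<in>{1..n}. l / real n)"
    using M(3)[of UNIV] pos by (simp add: N_def sum_ennreal del: sum_constant)
  moreover have "(LINT x|M. f x) = (\<Sum>i\<in>{1..n}. l / real n * f (grid_point l n y i))" if f: "f \<in> C0" for f
  proof -
    obtain K where "\<And>x. norm (f x) \<le> K" using C0_bounded[OF f] by blast
    then have "(LINT x|M. f x) = (\<Sum>i\<in>{1..n}. l / real n * (LINT x|N i. f x))"
      by (intro integral_finite_combination[OF _ M(1) N(1) M(2) N(2) pos M(3) C0_borel[OF f]]) auto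
    then show ?thesis using C0_borel[OF f] by (simp add: N_def integral_return)
  qed
  ultimately have "is_grid_measure l n y M" unfolding is_grid_measure_def by blast
  then show ?thesis unfolding grid_measure_def by (rule someI)
qed

lemma grid_measure:
  assumes "l > 0"
  shows "discrete_measure (grid_measure l n y)" "emeasure (grid_measure l n y) UNIV = ennreal (\<Sum>i\<in>{1..n}. l / real n)"
    and "f \<in> C0 \<Longrightarrow> (LINT x|grid_measure l n y. f x) = (\<Sum>i\<in>{1..n}. l / real n * f (grid_point l n y i))"
  using is_grid_measure_grid_measure[OF assms, of n y] unfolding is_grid_measure_def by blast+

lemma transport_path_grid:
  assumes l: "l > 0"
  shows "transport_path (grid_measure l n 0) (grid_measure l n 1) (grid_graph l n) (\<lambda>_. l / real n)"
  unfolding transport_path_def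
proof (intro conjI ballI)
  show "pair_digraph (grid_graph l n)" by (rule pair_digraph_grid)
  show "0 \<le> l / real n" using l by simp
  show "discrete_measure (grid_measure l n 0)" "discrete_measure (grid_measure l n 1)"
    by (rule grid_measure(1)[OF l])+
  show "emeasure (grid_measure l n 0) UNIV = emeasure (grid_measure l n 1) UNIV"
    by (simp only: grid_measure(2)[OF l])
  show "has_divergence (discrete_flux (grid_graph l n) (\<lambda>_. l / real n)) (grid_measure l n 0) (grid_measure l n 1)"
    unfolding has_divergence_def
  proof (intro allI impI, elim conjE)
    fix f :: "real^2 \<Rightarrow> real" and D assume f: "test_function f" and D: "\<forall>x. GDERIV f x :> D x"
    have "vector_integral (discrete_flux (grid_graph l n) (\<lambda>_. l / real n)) D
      = flow_gain (parcs (grid_graph l n)) (\<lambda>_. l / real n) f"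
      by (rule vector_integral_gradient[OF _ _ f])
        (use D pair_digraph_grid[of l n] in \<open>auto simp: pair_digraph_def pair_fin_digraph_def pair_fin_digraph_axioms_def
          dest: pair_loopfree_digraph.pair_no_loops\<close>)
    also have "\<dots> = (\<Sum>i\<in>{1..n}. l / real n * (f (grid_point l n 1 i) - f (grid_point l n 0 i)))"
      by (simp add: grid_graph_def grid_sum[OF l])
    also have "\<dots> = (LINT x|grid_measure l n 1. f x) - (LINT x|grid_measure l n 0. f x)"
      unfolding grid_measure(3)[OF l test_function_C0[OF f]] by (simp add: sum_subtractf right_diff_distrib)
    finally show "- vector_integral (discrete_flux (grid_graph l n) (\<lambda>_. l / real n)) D
      = (LINT x|grid_measure l n 0. f x) - (LINT x|grid_measure l n 1. f x)" by simp
  qed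
qed

lemma weak_star_grid:
  assumes l: "l > 0"
  shows "weak_star (\<lambda>k. grid_measure l (Suc k) y) (segment_measure l y)"
  unfolding weak_star_def
proof
  fix f :: "real^2 \<Rightarrow> real" assume f: "f \<in> C0"
  then have c: "continuous_on UNIV f" by (simp add: C0_def)
  have cs: "continuous_on {0..l} (\<lambda>s. f (vector [s, y]))"
    by (rule continuous_on_compose2[OF c continuous_vector2]) auto
  have "(LINT x|segment_measure l y. f x) = (LINT s|restrict_space lborel {0..l}. f (vector [s, y]))"
    unfolding segment_measure_integral(2)[OF c] by (simp add: integral_restrict_space)
  also have "\<dots> = integral {0..l} (\<lambda>s. f (vector [s, y]))" by (rule restrict_lborel_integral[OF cs])
  finally show "(\<lambda>k. LINT x|grid_measure l (Suc k) y. f x) \<longlonglongrightarrow> (LINT x|segment_measure l y. f x)"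
    using riemann_sums[OF l cs] by (simp only: grid_measure(3)[OF l f] grid_point_def)
qed

definition rectangle_flux :: "real \<Rightarrow> (real^2) set \<Rightarrow> real^2" where
  "rectangle_flux l A = measure (rectangle_measure l) A *\<^sub>R axis 2 1"

text \<open>
  The integral along a vertical edge depends continuously on its position, so that the sum over the edges is a
  Riemann sum for the integral over the rectangle.
\<close>

lemma vector_weak_star_grid:
  assumes l: "l > 0"
  shows "vector_weak_star (\<lambda>k. discrete_flux (grid_graph l (Suc k)) (\<lambda>_. l / real (Suc k))) (rectangle_flux l)"
  unfolding vector_weak_star_def
proof
  fix f :: "real^2 \<Rightarrow> real^2" assume f: "f \<in> C0"
  then have c: "continuous_on UNIV f" by (simp add: C0_def)
  obtain K where K: "\<And>x. norm (f x) \<le> K" using C0_bounded[OF f] by blast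
  define g where "g x = f x \<bullet> axis 2 1" for x
  have cg: "continuous_on UNIV g" unfolding g_def[abs_def] by (intro continuous_intros c)
  have gK: "\<bar>g x\<bar> \<le> K" for x
    using Cauchy_Schwarz_ineq2[of "f x" "axis 2 1"] K[of x] by (simp add: g_def)
  note R = rectangle_measure_integral[OF cg gK, of l]
  have lim: "vector_integral (rectangle_flux l) f = integral {0..l} (\<lambda>x. integral {0..1} (\<lambda>y. g (vector [x, y])))"
  proof -
    have "vector_integral (rectangle_flux l) f = (\<Sum>i\<in>{()}. LINT x|rectangle_measure l. f x \<bullet> axis 2 1)"
      by (rule vector_integral_combination[OF _ rectangle_measure _ C0_borel[OF f] K])
        (auto simp: rectangle_flux_def)
    then show ?thesis using R(2) by (simp add: g_def)
  qed
  have "vector_integral (discrete_flux (grid_graph l (Suc k)) (\<lambda>_. l / real (Suc k))) f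
    = (\<Sum>i\<in>{1..Suc k}. l / real (Suc k) * integral {0..1} (\<lambda>y. g (vector [real i * (l / real (Suc k)), y])))" for k
  proof -
    define n where "n = Suc k"
    have fin: "finite (parcs (grid_graph l n))" by (simp add: grid_graph_def grid_edges_def)
    have loop: "fst e \<noteq> snd e" if "e \<in> parcs (grid_graph l n)" for e
      using pair_digraph_grid[of l n] that by (auto simp: pair_digraph_def dest: pair_loopfree_digraph.pair_no_loops)
    have "vector_integral (discrete_flux (grid_graph l n) (\<lambda>_. l / real n)) f
      = (\<Sum>e\<in>parcs (grid_graph l n). LINT x|edge_measure e. f x \<bullet> ((l / real n) *\<^sub>R edge_direction e))"
      by (rule vector_integral_discrete_flux[OF fin loop C0_borel[OF f] K])
    also have "\<dots> = (\<Sum>i\<in>{1..n}. l / real n * integral {0..1} (\<lambda>y. g (grid_point l n y i)))"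
      unfolding grid_graph_def pair_pre_digraph.simps grid_sum[OF l]
    proof (rule sum.cong[OF refl])
      fix i
      define e where "e = (grid_point l n 0 i, grid_point l n 1 i)"
      note ge = grid_edge[OF e_def]
      have "(LINT x|edge_measure e. f x \<bullet> ((l / real n) *\<^sub>R edge_direction e)) = l / real n * (LINT x|edge_measure e. g x)"
        by (simp add: ge g_def)
      also have "(LINT x|edge_measure e. g x) = integral {0..1} (\<lambda>y. g (grid_point l n y i))"
        unfolding integral_edge_measure[OF cg] by (simp add: ge)
      finally show "(LINT x|edge_measure (grid_point l n 0 i, grid_point l n 1 i). f x \<bullet> ((l / real n) *\<^sub>R edge_direction (grid_point l n 0 i, grid_point l n 1 i)))
        = l / real n * integral {0..1} (\<lambda>y. g (grid_point l n y i))" by (simp only: e_def)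
    qed
    finally show ?thesis by (simp only: n_def grid_point_def)
  qed
  then show "(\<lambda>k. vector_integral (discrete_flux (grid_graph l (Suc k)) (\<lambda>_. l / real (Suc k))) f) \<longlonglongrightarrow> vector_integral (rectangle_flux l) f"
    using riemann_sums[OF l R(1)] unfolding lim by simp
qed

lemma segment_measure_fbm:
  assumes "l > 0"
  shows "segment_measure l y \<in> fbm" "emeasure (segment_measure l y) UNIV = ennreal l"
proof -
  have m: "(\<lambda>s. vector [s, y] :: real^2) \<in> borel_measurable (restrict_space lborel {0..l})"
    by (intro measurable_restrict_space1) (simp add: borel_measurable_continuous_onI continuous_vector2)
  show "segment_measure l y \<in> fbm"
    unfolding fbm_def segment_measure_def
    using finite_measure.finite_measure_distr[OF finite_restrict_lborel m] by simp
  show "emeasure (segment_measure l y) UNIV = ennreal l"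
    unfolding segment_measure_def using assms
    by (subst emeasure_distr[OF m]) (auto simp: emeasure_restrict_space space_restrict_space)
qed

lemma grid_approximates:
  assumes "l > 0"
  shows "approximating_graph_sequence (segment_measure l 0) (segment_measure l 1) (rectangle_flux l)
    (\<lambda>k. grid_measure l (Suc k) 0) (\<lambda>k. grid_measure l (Suc k) 1) (\<lambda>k. grid_graph l (Suc k)) (\<lambda>k _. l / real (Suc k))"
  unfolding approximating_graph_sequence_def
  using transport_path_grid[OF assms] weak_star_grid[OF assms] vector_weak_star_grid[OF assms] by blast

lemma rectangle_flux_mass_flux:
  assumes "l > 0"
  shows "rectangle_flux l \<in> rca" "mass_flux (segment_measure l 0) (segment_measure l 1) (rectangle_flux l)"
proof -
  show "rectangle_flux l \<in> rca"
    unfolding rectangle_flux_def[abs_def] by (rule rca_scaled_measure[OF rectangle_measure])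
  then show "mass_flux (segment_measure l 0) (segment_measure l 1) (rectangle_flux l)"
    unfolding mass_flux_def using segment_measure_fbm[OF assms] grid_approximates[OF assms] by auto
qed

lemma relaxed_cost_rectangle_le:
  assumes "l > 0" and J: "\<And>k. J (grid_graph l (Suc k)) (\<lambda>_. l / real (Suc k)) = l"
  shows "relaxed_cost J (segment_measure l 0) (segment_measure l 1) (rectangle_flux l) \<le> ereal l"
proof -
  have "relaxed_cost J (segment_measure l 0) (segment_measure l 1) (rectangle_flux l)
    \<le> liminf (\<lambda>k. ereal (J (grid_graph l (Suc k)) (\<lambda>_. l / real (Suc k))))"
    unfolding relaxed_cost_def
  proof (rule Inf_lower, intro CollectI exI conjI)
    show "approximating_graph_sequence (segment_measure l 0) (segment_measure l 1) (rectangle_flux l)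
      (\<lambda>k. grid_measure l (Suc k) 0) (\<lambda>k. grid_measure l (Suc k) 1) (\<lambda>k. grid_graph l (Suc k)) (\<lambda>k _. l / real (Suc k))"
      by (rule grid_approximates[OF assms(1)])
  qed (rule refl)
  also have "\<dots> = ereal l" by (simp only: J) (simp add: Liminf_const)
  finally show ?thesis .
qed

lemma urban_reference_le:
  assumes "l > 0" "a > 1"
  shows "urban_min 0 a (segment_measure l 0) (segment_measure l 1) \<le> ereal l"
proof -
  have "urban_cost 0 a (grid_graph l (Suc k)) (\<lambda>_. l / real (Suc k)) = l" for k
  proof -
    have "1 * (l / real (Suc k)) \<le> a * (l / real (Suc k))" using assms by (intro mult_right_mono) auto
    then have "min (a * (l / real (Suc k))) (l / real (Suc k) + 0) = l / real (Suc k)"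
      by (simp only: mult_1_left add_0_right min_absorb2)
    then show ?thesis unfolding urban_cost_def grid_graph_def pair_pre_digraph.simps grid_sum[OF assms(1)]
      by (simp only: grid_edge(1)[OF refl]) simp
  qed
  from relaxed_cost_rectangle_le[OF assms(1), of "urban_cost 0 a", OF this]
  show ?thesis unfolding urban_min_def
    using rectangle_flux_mass_flux[OF assms(1)] by (intro INF_lower2[of "rectangle_flux l"]) (auto simp: urban_functional_def)
qed

lemma branched_reference_le:
  assumes "l > 0"
  shows "branched_min 0 (segment_measure l 0) (segment_measure l 1) \<le> ereal l"
proof -
  have "branched_cost 0 (grid_graph l (Suc k)) (\<lambda>_. l / real (Suc k)) = l" for k
  proof -
    have "(l / real (Suc k)) powr (1 - 0) = l / real (Suc k)" using assms by simp
    then show ?thesis unfolding branched_cost_def grid_graph_def pair_pre_digraph.simps grid_sum[OF assms(1)]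
      by (simp only: grid_edge(1)[OF refl]) simp
  qed
  from relaxed_cost_rectangle_le[OF assms(1), of "branched_cost 0", OF this]
  show ?thesis unfolding branched_min_def
    using rectangle_flux_mass_flux[OF assms(1)] by (intro INF_lower2[of "rectangle_flux l"]) (auto simp: branched_functional_def)
qed

section \<open>Energy scaling\<close>

text \<open>
  The choice \<open>h0 = min (\<epsilon> powr (1/3)) (sqrt (a - 1))\<close> is the largest compatible with surcharge \<open>\<epsilon>\<close> for
  heavy and \<open>(a - 1) w\<close> for light edges. The threshold between the two is \<open>\<epsilon> / (a - 1)\<close>.
\<close>

lemma urban_min_ge:
  assumes \<epsilon>: "0 < \<epsilon>" "\<epsilon> \<le> 1/8" and a: "1 < a" and l: "0 < l"
  shows "urban_min \<epsilon> a (segment_measure l 0) (segment_measure l 1) \<ge> ereal (l + l * min (\<epsilon> powr (2/3)) (a - 1) / 128)"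
proof -
  define h0 where "h0 = min (\<epsilon> powr (1/3)) (sqrt (a - 1))"
  have h0: "0 < h0" using \<epsilon> a by (simp add: h0_def)
  have sq: "(\<epsilon> powr (1/3))\<^sup>2 = \<epsilon> powr (2/3)" "(\<epsilon> powr (1/3)) ^ 3 = \<epsilon>"
    using \<epsilon> by (simp_all add: powr_power)
  have "\<epsilon> powr (1/3) \<le> (1/8) powr (1/3)" using \<epsilon> by (intro powr_mono2) auto
  also have "(1/8::real) powr (1/3) = 1/2"
  proof -
    have "(1/8::real) = (1/2) powr 3" by (simp add: powr_numeral power3_eq_cube)
    then show ?thesis by (simp only: powr_powr) simp
  qed
  finally have h0': "h0 \<le> 1/2" by (simp add: h0_def)
  have h02: "h0\<^sup>2 = min (\<epsilon> powr (2/3)) (a - 1)"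
  proof (cases "\<epsilon> powr (1/3) \<le> sqrt (a - 1)")
    case True
    then have "(\<epsilon> powr (1/3))\<^sup>2 \<le> (sqrt (a - 1))\<^sup>2" by (intro power_mono) auto
    then show ?thesis using True a sq by (simp add: h0_def)
  next
    case False
    then have "(sqrt (a - 1))\<^sup>2 \<le> (\<epsilon> powr (1/3))\<^sup>2" using a by (intro power_mono) auto
    then show ?thesis using False a sq by (simp add: h0_def)
  qed
  have "h0 ^ 3 \<le> (\<epsilon> powr (1/3)) ^ 3" using h0 by (intro power_mono) (auto simp: h0_def)
  then have p3: "h0 ^ 3 \<le> 4 * \<epsilon>" using sq \<epsilon> by simp
  have p2: "h0\<^sup>2 \<le> a - 1" using h02 by simp
  have J: "1 * surcharged_cost (\<epsilon> / (a - 1)) (a - 1) \<epsilon> 9 (parcs G) w \<le> urban_cost \<epsilon> a G w"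
    if "finite (parcs G)" "\<And>e. e \<in> parcs G \<Longrightarrow> w e \<ge> 0" for G :: "(real^2) pair_pre_digraph" and w
    unfolding urban_cost_def mult_1
  proof (rule sum_mono)
    fix e
    have "min (w e) 9 + excess_weight (\<epsilon> / (a - 1)) (a - 1) \<epsilon> (w e) \<le> min (a * w e) (w e + \<epsilon>)"
      using a by (auto simp: excess_weight_def pos_le_divide_eq algebra_simps min_def)
    then show "edge_length e * (min (w e) 9 + excess_weight (\<epsilon> / (a - 1)) (a - 1) \<epsilon> (w e)) \<le> min (a * w e) (w e + \<epsilon>) * edge_length e"
      by (simp add: mult.commute mult_left_mono edge_length_def)
  qed
  show ?thesis unfolding urban_min_def
  proof (rule INF_greatest)
    fix F :: "(real^2) set \<Rightarrow> real^2" assume "F \<in> rca"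
    have "ereal (1 * (l + l * h0\<^sup>2 / 128)) \<le> relaxed_cost (urban_cost \<epsilon> a) (segment_measure l 0) (segment_measure l 1) F"
      by (rule relaxed_cost_ge[OF J _ _ l h0 h0' p3 p2]) auto
    then show "ereal (l + l * min (\<epsilon> powr (2/3)) (a - 1) / 128) \<le> urban_functional \<epsilon> a (segment_measure l 0) (segment_measure l 1) F"
      by (simp add: urban_functional_def h02)
  qed
qed

text \<open>
  By \<open>x powr (1 - \<epsilon>) \<ge> x (1 - \<epsilon> ln x)\<close>, weights up to \<open>\<epsilon> powr (1/3)\<close> pay an additional fraction
  \<open>\<epsilon> \<bar>ln \<epsilon>\<bar> / 3\<close>. Since \<open>ln 9 \<le> 8\<close>, giving up the fraction \<open>9 \<epsilon>\<close> leaves at least \<open>\<epsilon> x\<close> for the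
  heavy weights up to 9, and larger weights are reduced to 9 by monotonicity.
\<close>

lemma powr_excess_bound:
  assumes \<epsilon>: "0 < \<epsilon>" "\<epsilon> \<le> 1/18" and x: "0 \<le> x"
  shows "(1 - 9 * \<epsilon>) * min x 9 + excess_weight (\<epsilon> powr (1/3)) (\<epsilon> * \<bar>ln \<epsilon>\<bar> / 3) (\<epsilon> * \<epsilon> powr (1/3)) x \<le> x powr (1 - \<epsilon>)"
proof -
  define \<theta> where "\<theta> = \<epsilon> powr (1/3)"
  have \<theta>: "0 < \<theta>" "\<theta> \<le> 1" "ln \<theta> = ln \<epsilon> / 3" using \<epsilon> by (auto simp: \<theta>_def powr_le1 ln_powr)
  have ln0: "ln \<epsilon> \<le> 0" using \<epsilon> by simp
  have ln9: "ln (9::real) \<le> 8" using ln_le_minus_one[of "9::real"] by simp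
  have lower: "y * (1 - \<epsilon> * ln y) \<le> y powr (1 - \<epsilon>)" if "y > 0" for y
  proof -
    have "1 - \<epsilon> * ln y \<le> exp (- (\<epsilon> * ln y))" using exp_ge_add_one_self[of "- (\<epsilon> * ln y)"] by simp
    then have "y * (1 - \<epsilon> * ln y) \<le> y * exp (- (\<epsilon> * ln y))" using that by (intro mult_left_mono) auto
    also have "\<dots> = y powr (1 - \<epsilon>)"
      using that by (simp add: powr_diff powr_def[of y \<epsilon>] exp_minus divide_inverse)
    finally show ?thesis .
  qed
  consider "x = 0" | "0 < x" "x \<le> \<theta>" | "\<theta> < x" "x \<le> 9" | "9 < x" using x by linarith
  then have "(1 - 9 * \<epsilon>) * min x 9 + excess_weight \<theta> (\<epsilon> * \<bar>ln \<epsilon>\<bar> / 3) (\<epsilon> * \<theta>) x \<le> x powr (1 - \<epsilon>)"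
  proof cases
    case 1
    then show ?thesis using \<theta> by (simp add: excess_weight_def)
  next
    case 2
    then have "ln x \<le> ln \<epsilon> / 3" using \<theta> by (metis ln_le_cancel_iff)
    then have "\<epsilon> * \<bar>ln \<epsilon>\<bar> / 3 \<le> - (\<epsilon> * ln x)" using mult_left_mono[of "ln x" "ln \<epsilon> / 3" \<epsilon>] \<epsilon> ln0 by simp
    then have "(1 - 9 * \<epsilon>) + \<epsilon> * \<bar>ln \<epsilon>\<bar> / 3 \<le> 1 - \<epsilon> * ln x" using \<epsilon> by linarith
    then have "x * ((1 - 9 * \<epsilon>) + \<epsilon> * \<bar>ln \<epsilon>\<bar> / 3) \<le> x * (1 - \<epsilon> * ln x)" using 2 by (intro mult_left_mono) auto
    then show ?thesis using lower[of x] 2 \<theta> by (simp add: excess_weight_def algebra_simps)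
  next
    case 3
    have x0: "x > 0" using 3 \<theta> by linarith
    have "ln x \<le> 8" using ln9 3 x0 ln_le_cancel_iff[of x 9] by linarith
    then have "(1 - 9 * \<epsilon>) + \<epsilon> \<le> 1 - \<epsilon> * ln x" using mult_left_mono[of "ln x" 8 \<epsilon>] \<epsilon> by linarith
    then have "x * ((1 - 9 * \<epsilon>) + \<epsilon>) \<le> x * (1 - \<epsilon> * ln x)" using x0 by (intro mult_left_mono) auto
    moreover have "\<epsilon> * \<theta> \<le> \<epsilon> * x" using 3 \<epsilon> by (intro mult_left_mono) auto
    moreover have "x * ((1 - 9 * \<epsilon>) + \<epsilon>) = (1 - 9 * \<epsilon>) * x + \<epsilon> * x" by (simp add: algebra_simps)
    ultimately show ?thesis using lower[OF x0] 3 by (simp add: excess_weight_def min_def)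
  next
    case 4
    have "(9::real) * (1 - \<epsilon> * ln 9) \<le> 9 powr (1 - \<epsilon>)" by (rule lower) simp
    also have "\<dots> \<le> x powr (1 - \<epsilon>)" using 4 \<epsilon> by (intro powr_mono2) auto
    finally have "9 * (1 - \<epsilon> * ln 9) \<le> x powr (1 - \<epsilon>)" .
    moreover have "\<epsilon> * ln 9 \<le> \<epsilon> * 8" using ln9 \<epsilon> by (intro mult_left_mono) auto
    then have "9 * (1 - \<epsilon> * 8) \<le> 9 * (1 - \<epsilon> * ln 9)" by simp
    ultimately have "9 * (1 - \<epsilon> * 8) \<le> x powr (1 - \<epsilon>)" by (rule order_trans[rotated])
    moreover define p where "p = \<epsilon> * \<theta>"
    moreover have "p \<le> \<epsilon>" using \<theta> \<epsilon> by (simp add: p_def mult_left_le)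
    ultimately have "(1 - 9 * \<epsilon>) * 9 + p \<le> x powr (1 - \<epsilon>)" using \<epsilon>(1) by argo
    then show ?thesis using 4 \<theta> by (simp add: excess_weight_def min_def p_def)
  qed
  then show ?thesis by (simp only: \<theta>_def)
qed

text \<open>
  Here the width \<open>h0\<close> is the square root of the surcharge rate \<open>\<epsilon> \<bar>ln \<epsilon>\<bar> / 3\<close> of light edges. The loss of
  the factor \<open>1 - 9 \<epsilon>\<close> has no logarithm and is absorbed for small \<open>\<epsilon>\<close>.
\<close>

lemma branched_min_ge:
  assumes \<epsilon>: "0 < \<epsilon>" "\<epsilon> \<le> 1/18" and h0': "\<epsilon> * \<bar>ln \<epsilon>\<bar> / 3 \<le> 1/4"
    and cube: "(\<epsilon> * \<bar>ln \<epsilon>\<bar> / 3) powr (3/2) \<le> 4 * (\<epsilon> * \<epsilon> powr (1/3))" and l: "0 < l"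
  shows "branched_min \<epsilon> (segment_measure l 0) (segment_measure l 1)
    \<ge> ereal ((1 - 9 * \<epsilon>) * (l + l * (\<epsilon> * \<bar>ln \<epsilon>\<bar> / 3) / 128))"
proof -
  define a where "a = \<epsilon> * \<bar>ln \<epsilon>\<bar> / 3"
  define h0 where "h0 = sqrt a"
  have "ln \<epsilon> < 0" using \<epsilon> by simp
  then have a: "a > 0" using \<epsilon>(1) by (simp add: a_def mult_pos_neg)
  then have h0: "h0 > 0" "h0\<^sup>2 = a" by (simp_all add: h0_def)
  have "h0 \<le> sqrt (1/4)" using h0' by (simp add: h0_def a_def)
  also have "sqrt (1/4) = 1/2" by (rule real_sqrt_unique) (auto simp: power2_eq_square)
  finally have h12: "h0 \<le> 1/2" .
  have "h0 ^ 3 = a powr (3/2)"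
    using a by (simp add: h0_def powr_half_sqrt[symmetric] powr_power)
  then have p3: "h0 ^ 3 \<le> 4 * (\<epsilon> * \<epsilon> powr (1/3))" using cube by (simp add: a_def)
  have J: "(1 - 9 * \<epsilon>) * surcharged_cost (\<epsilon> powr (1/3)) a (\<epsilon> * \<epsilon> powr (1/3)) 9 (parcs G) w \<le> branched_cost \<epsilon> G w"
    if w: "finite (parcs G)" "\<And>e. e \<in> parcs G \<Longrightarrow> w e \<ge> 0" for G :: "(real^2) pair_pre_digraph" and w
    unfolding branched_cost_def sum_distrib_left
  proof (rule sum_mono)
    fix e assume "e \<in> parcs G"
    then have we: "w e \<ge> 0" by (rule w(2))
    define X where "X = excess_weight (\<epsilon> powr (1/3)) a (\<epsilon> * \<epsilon> powr (1/3)) (w e)"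
    have "X \<ge> 0" using we a \<epsilon> by (simp add: X_def excess_weight_def)
    then have "(1 - 9 * \<epsilon>) * X \<le> X" using \<epsilon> by (intro mult_left_le_one_le) auto
    then have "(1 - 9 * \<epsilon>) * (min (w e) 9 + X) \<le> w e powr (1 - \<epsilon>)"
      using powr_excess_bound[OF \<epsilon> we] by (simp add: X_def a_def distrib_left)
    then have "edge_length e * ((1 - 9 * \<epsilon>) * (min (w e) 9 + X)) \<le> edge_length e * (w e powr (1 - \<epsilon>))"
      by (intro mult_left_mono) (auto simp: edge_length_def)
    then show "(1 - 9 * \<epsilon>) * (edge_length e * (min (w e) 9 + excess_weight (\<epsilon> powr (1/3)) a (\<epsilon> * \<epsilon> powr (1/3)) (w e))) \<le> w e powr (1 - \<epsilon>) * edge_length e"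
      by (simp add: X_def mult.commute mult.left_commute)
  qed
  show ?thesis unfolding branched_min_def
  proof (rule INF_greatest)
    fix F :: "(real^2) set \<Rightarrow> real^2" assume "F \<in> rca"
    have "ereal ((1 - 9 * \<epsilon>) * (l + l * h0\<^sup>2 / 128)) \<le> relaxed_cost (branched_cost \<epsilon>) (segment_measure l 0) (segment_measure l 1) F"
      by (rule relaxed_cost_ge[OF J _ _ l h0(1) h12 p3]) (use \<epsilon> h0(2) in auto)
    then show "ereal ((1 - 9 * \<epsilon>) * (l + l * (\<epsilon> * \<bar>ln \<epsilon>\<bar> / 3) / 128)) \<le> branched_functional \<epsilon> (segment_measure l 0) (segment_measure l 1) F"
      by (simp add: branched_functional_def h0(2) a_def)
  qed
qed

lemma small_parameter:
  "\<forall>\<^sub>F \<epsilon> in at_right (0::real). \<epsilon> \<le> 1/18 \<and> \<epsilon> * \<bar>ln \<epsilon>\<bar> / 3 \<le> 1/4 \<and>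
    (\<epsilon> * \<bar>ln \<epsilon>\<bar> / 3) powr (3/2) \<le> 4 * (\<epsilon> * \<epsilon> powr (1/3)) \<and> 13824 \<le> \<bar>ln \<epsilon>\<bar>"
  by (intro eventually_conj; real_asymp)

lemma ereal_diff_ge:
  assumes "ereal x \<le> A" "B \<le> ereal y" "z \<le> x - y"
  shows "ereal z \<le> A - B"
proof -
  have "ereal z \<le> ereal x - ereal y" using assms(3) by simp
  also have "\<dots> \<le> A - B" using assms(1,2) by (rule ereal_minus_mono)
  finally show ?thesis .
qed

theorem theorem3p4p1:
  shows "\<exists>c>0::real. \<exists>\<epsilon>\<^sub>0>0::real. \<forall>(\<epsilon>::real) (a::real) (l::real).
    0 < \<epsilon> \<and> \<epsilon> < \<epsilon>\<^sub>0 \<and> 1 < a \<and> 0 < l \<longrightarrow>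
      urban_min \<epsilon> a (segment_measure l 0) (segment_measure l 1)
          - urban_min 0 a (segment_measure l 0) (segment_measure l 1)
        \<ge> ereal (c * l * min (\<epsilon> powr (2/3)) (a - 1)) \<and>
      branched_min \<epsilon> (segment_measure l 0) (segment_measure l 1)
          - branched_min 0 (segment_measure l 0) (segment_measure l 1)
        \<ge> ereal (c * l * (\<epsilon> * \<bar>ln \<epsilon>\<bar>))"
proof -
  obtain \<epsilon>0 :: real where \<epsilon>0: "\<epsilon>0 > 0" "\<And>\<epsilon>::real. 0 < \<epsilon> \<Longrightarrow> \<epsilon> < \<epsilon>0 \<Longrightarrow> \<epsilon> \<le> 1/18 \<and> \<epsilon> * \<bar>ln \<epsilon>\<bar> / 3 \<le> 1/4 \<and>
    (\<epsilon> * \<bar>ln \<epsilon>\<bar> / 3) powr (3/2) \<le> 4 * (\<epsilon> * \<epsilon> powr (1/3)) \<and> 13824 \<le> \<bar>ln \<epsilon>\<bar>"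
    using small_parameter unfolding eventually_at_right_field by blast
  show ?thesis
  proof (rule exI[of _ "1/1536"], intro conjI exI[of _ \<epsilon>0] allI impI, goal_cases)
    case (3 \<epsilon> a l)
    then have \<epsilon>: "0 < \<epsilon>" "\<epsilon> \<le> 1/8" and a: "1 < a" and l: "0 < l" using \<epsilon>0(2)[of \<epsilon>] by auto
    define m where "m = min (\<epsilon> powr (2/3)) (a - 1)"
    have "0 \<le> l * m" using l a by (simp add: m_def)
    then show ?case
      by (intro ereal_diff_ge[OF urban_min_ge[OF \<epsilon> a l] urban_reference_le[OF l a]])
        (simp add: m_def[symmetric])
  next
    case (4 \<epsilon> a l)
    then have \<epsilon>: "0 < \<epsilon>" "\<epsilon> < \<epsilon>0" "\<epsilon> \<le> 1/18" and l: "0 < l" using \<epsilon>0(2)[of \<epsilon>] by auto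
    define L where "L = \<bar>ln \<epsilon>\<bar>"
    have sm: "\<epsilon> * L / 3 \<le> 1/4" "(\<epsilon> * L / 3) powr (3/2) \<le> 4 * (\<epsilon> * \<epsilon> powr (1/3))" "13824 \<le> L"
      using \<epsilon>0(2)[OF \<epsilon>(1,2)] by (auto simp: L_def)
    have "1/1536 * (\<epsilon> * L) \<le> (1 - 9 * \<epsilon>) * (1 + \<epsilon> * L / 3 / 128) - 1"
    proof -
      have "(1 - 9 * \<epsilon>) * (1 + \<epsilon> * L / 3 / 128) - 1 = (1 - 9 * \<epsilon>) * (\<epsilon> * L / 384) - 9 * \<epsilon>"
        by (simp add: algebra_simps)
      moreover have "1/2 * (\<epsilon> * L / 384) \<le> (1 - 9 * \<epsilon>) * (\<epsilon> * L / 384)"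
        using \<epsilon> sm(3) by (intro mult_right_mono) auto
      moreover have "9 * \<epsilon> \<le> \<epsilon> * L / 1536"
        using mult_left_mono[OF sm(3), of \<epsilon>] \<epsilon> by simp
      ultimately show ?thesis by linarith
    qed
    then have "l * (1/1536 * (\<epsilon> * L)) \<le> l * ((1 - 9 * \<epsilon>) * (1 + \<epsilon> * L / 3 / 128) - 1)"
      using l by (intro mult_left_mono) auto
    then have "1/1536 * l * (\<epsilon> * L) \<le> (1 - 9 * \<epsilon>) * (l + l * (\<epsilon> * L / 3) / 128) - l"
      by (simp add: algebra_simps)
    then show ?case
      using branched_min_ge[OF \<epsilon>(1,3) sm(1,2)[unfolded L_def] l] branched_reference_le[OF l]
      by (intro ereal_diff_ge) (auto simp: L_def)
  qed (use \<epsilon>0 in auto)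
qed

end
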